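(* Let $\beta>0$. (a) There is a unique Borel probability measure $\mathbb{Q}^\beta_0\in\mathcal{P}(\mathcal{G}_0)$ such that for every partition $0=t_0<t_1<\dots<t_N<t_{N+1}=1$ of $[0,1]$ and every bounded measurable function $u:[0,1]^N\to\mathbb{R}$, $$\int_{\mathcal{G}_0}u(g(t_1),\dots,g(t_N))\,d\mathbb{Q}^\beta_0(g)=\frac{\Gamma(\beta)}{\prod_{i=0}^N\Gamma(\beta(t_{i+1}-t_i))}\int_{\Sigma_N}u(x_1,\dots,x_N)\prod_{i=0}^N(x_{i+1}-x_i)^{\beta(t_{i+1}-t_i)-1}\,dx_1\cdots dx_N .$$ (b) For each partition $\{t_i\}_{i=1}^N$ of $[0,1]$ define a measure $\mu_{\{t_i\}}$ on $(X(\{t_i\}),d^{\{t_i\}})$ by requiring that for all bounded continuous functions $u$ on $X(\{t_i\})$ $$\int_{X(\{t_i\})}u(x_1,\dots,x_N)\,d\mu_{\{t_i\}}=\frac{\Gamma(\beta)}{\prod_{i=0}^N\Gamma(\beta(t_{i+1}-t_i))}\int_{\Sigma_N}u(x_1,\dots,x_N)\prod_{i=0}^N(x_{i+1}-x_i)^{\beta(t_{i+1}-t_i)-1}\,dx_1\cdots dx_N ,$$ and let $\mu_N$ denote the measure associated to the standard partition $T_N^{\mathrm{std}}$. Then, as $N\to\infty$, one has the measured Gromov--Hausdorff convergence $$(X_N^{\mathrm{std}},d^N,\mu_N)\xrightarrow{GH}(\mathcal{G}_0,d^{L^2},\mathbb{Q}^\beta_0).$$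
   Context: $\mathcal{G}_0\subset L^2([0,1])$ is the set of right continuous, nondecreasing functions $g:[0,1]\to[0,1]$ with $g(1)=1$ (regarded as elements of $L^2([0,1])$; $g(t)$ always refers to this right continuous representative), and $d^{L^2}(f,g)=\|f-g\|_{L^2([0,1])}$. $\mathcal{P}(X)$ denotes the Borel probability measures on $X$, and $\Gamma(s)=\int_0^\infty t^{s-1}e^{-t}\,dt$. For $N\ge1$, $$\Sigma_N:=\{(x_1,\dots,x_N)\in[0,1]^N:0=x_0<x_1<\dots<x_N<x_{N+1}=1\},$$ with the convention $x_0=0$, $x_{N+1}=1$ in the products above. For a partition $\{t_i\}_{i=1}^N$, i.e. $0=t_0<t_1<\dots<t_N<t_{N+1}=1$, the metric space $(X(\{t_i\}),d^{\{t_i\}})$ is the set $X(\{t_i\})=\Sigma_N$ with metric $d^{\{t_i\}}(x,y)^2:=\sum_{i=1}^N|x_i-y_i|^2|t_{i+1}-t_i|$. The standard partition is $T_N^{\mathrm{std}}=\{0<\tfrac1{2^N}<\tfrac2{2^N}<\dots<\tfrac{2^N-1}{2^N}<1\}$, and $(X_N^{\mathrm{std}},d^N)$ is the metric space associated to it (so $X_N^{\mathrm{std}}=\Sigma_{2^N-1}$). For metric spaces $X,Y$ and $\epsilon>0$, a (not necessarily continuous) map $f:X\to Y$ is an $\epsilon$-isometry if (1) $|d_X(x,x')-d_Y(f(x),f(x'))|\le\epsilon$ for all $x,x'\in X$, and (2) for every $y\in Y$ there is $x\in X$ with $d_Y(y,f(x))\le\epsilon$. Metric measure spaces $(X_n,d_n,\mu_n)$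 converge to $(X,d,\mu)$ in the measured Gromov--Hausdorff topology, written $\xrightarrow{GH}$, if there are $\epsilon_n\to0$ and (Borel measurable) $\epsilon_n$-isometries $f_n:X_n\to X$ such that $(f_n)_*\mu_n\to\mu$ in the weak* topology on $\mathcal{P}(X)$ (i.e. tested against continuous functions on $X$). *)

theory Defs
  imports "HOL-Probability.Probability"
begin

section \<open>Metric measure spaces with explicit carriers\<close>

definition metric_borel :: "'a set \<Rightarrow> ('a \<Rightarrow> 'a \<Rightarrow> real) \<Rightarrow> 'a measure" where
  "metric_borel X d = sigma X {U. openin (Metric_space.mtopology X d) U}"

definition borel_measure_on :: "'a set \<Rightarrow> ('a \<Rightarrow> 'a \<Rightarrow> real) \<Rightarrow> 'a measure \<Rightarrow> bool" where
  "borel_measure_on X d \<mu> \<longleftrightarrow> Metric_space X d \<and> sets \<mu> = sets (metric_borel X d)"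

definition borel_prob_on :: "'a set \<Rightarrow> ('a \<Rightarrow> 'a \<Rightarrow> real) \<Rightarrow> 'a measure \<Rightarrow> bool" where
  "borel_prob_on X d \<mu> \<longleftrightarrow> borel_measure_on X d \<mu> \<and> prob_space \<mu>"

definition eps_isometry ::
  "real \<Rightarrow> 'a set \<Rightarrow> ('a \<Rightarrow> 'a \<Rightarrow> real) \<Rightarrow> 'b set \<Rightarrow> ('b \<Rightarrow> 'b \<Rightarrow> real) \<Rightarrow> ('a \<Rightarrow> 'b) \<Rightarrow> bool" where
  "eps_isometry \<epsilon> X dX Y dY f \<longleftrightarrow>
     f \<in> X \<rightarrow> Y \<and>
     (\<forall>x\<in>X. \<forall>x'\<in>X. \<bar>dX x x' - dY (f x) (f x')\<bar> \<le> \<epsilon>) \<and>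
     (\<forall>y\<in>Y. \<exists>x\<in>X. dY y (f x) \<le> \<epsilon>)"

text \<open>
  The test functions in the weak* convergence are all continuous functions on the limit space,
  with no boundedness required; this is the usual notion when the limit is compact.
\<close>

definition mGH_converges ::
  "(nat \<Rightarrow> 'a set) \<Rightarrow> (nat \<Rightarrow> 'a \<Rightarrow> 'a \<Rightarrow> real) \<Rightarrow> (nat \<Rightarrow> 'a measure) \<Rightarrow>
   'b set \<Rightarrow> ('b \<Rightarrow> 'b \<Rightarrow> real) \<Rightarrow> 'b measure \<Rightarrow> bool" where
  "mGH_converges X d \<mu> Y dY \<nu> \<longleftrightarrow>
     (\<forall>n. borel_prob_on (X n) (d n) (\<mu> n)) \<and> borel_prob_on Y dY \<nu> \<and>
     (\<exists>\<epsilon> f. (\<forall>n. \<epsilon> n > 0) \<and> \<epsilon> \<longlonglongrightarrow> 0 \<and>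
        (\<forall>n. eps_isometry (\<epsilon> n) (X n) (d n) Y dY (f n)) \<and>
        (\<forall>n. f n \<in> measurable (metric_borel (X n) (d n)) (metric_borel Y dY)) \<and>
        (\<forall>\<phi>. continuous_map (Metric_space.mtopology Y dY) euclideanreal \<phi> \<longrightarrow>
           (\<lambda>n. integral\<^sup>L (distr (\<mu> n) (metric_borel Y dY) (f n)) \<phi>)
             \<longlonglongrightarrow> integral\<^sup>L \<nu> \<phi>))"


section \<open>The space of right continuous nondecreasing functions\<close>

text \<open>
  Elements of \<open>G0\<close> are the right continuous representatives, normalised to be
  \<open>undefined\<close> outside \<open>[0,1]\<close>. Two of them that agree almost everywhere on \<open>[0,1]\<close> are
  equal, so \<open>L2_dist\<close> is a metric on \<open>G0\<close> and no passage to a.e.-classes is needed.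
\<close>

definition G0 :: "(real \<Rightarrow> real) set" where
  "G0 = {g \<in> {0..1} \<rightarrow>\<^sub>E {0..1}.
     mono_on {0..1} g \<and> (\<forall>t\<in>{0..<1}. continuous (at_right t) g) \<and> g 1 = 1}"

definition L2_dist :: "(real \<Rightarrow> real) \<Rightarrow> (real \<Rightarrow> real) \<Rightarrow> real" where
  "L2_dist f g = sqrt (LINT t:{0..1}|lborel. (f t - g t)\<^sup>2)"


section \<open>Partitions and the simplices\<close>

text \<open>
  A partition with \<open>N\<close> interior points is \<open>t 0, \<dots>, t (N + 1)\<close>; other values of \<open>t\<close> are irrelevant.
  A point of \<open>\<real>\<^sup>N\<close> is a function in \<open>extensional {1..N}\<close>, and \<open>bd N x\<close> adds the convention
  \<open>x\<^sub>0 = 0\<close>, \<open>x\<^sub>N\<^sub>+\<^sub>1 = 1\<close>.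
\<close>

definition is_partition :: "nat \<Rightarrow> (nat \<Rightarrow> real) \<Rightarrow> bool" where
  "is_partition N t \<longleftrightarrow> N \<ge> 1 \<and> t 0 = 0 \<and> t (N + 1) = 1 \<and> (\<forall>i\<le>N. t i < t (i + 1))"

definition bd :: "nat \<Rightarrow> (nat \<Rightarrow> real) \<Rightarrow> nat \<Rightarrow> real" where
  "bd N x i = (if i = 0 then 0 else if i = N + 1 then 1 else x i)"

definition simplex_set :: "nat \<Rightarrow> (nat \<Rightarrow> real) set" where
  "simplex_set N = {x \<in> {1..N} \<rightarrow>\<^sub>E {0..1}. \<forall>i\<le>N. bd N x i < bd N x (i + 1)}"

definition partition_dist :: "nat \<Rightarrow> (nat \<Rightarrow> real) \<Rightarrow> (nat \<Rightarrow> real) \<Rightarrow> (nat \<Rightarrow> real) \<Rightarrow> real" where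
  "partition_dist N t x y = sqrt (\<Sum>i=1..N. \<bar>x i - y i\<bar>\<^sup>2 * \<bar>t (i + 1) - t i\<bar>)"

text \<open>The standard dyadic partition, which has \<open>2 ^ N - 1\<close> interior points.\<close>

definition std_partition :: "nat \<Rightarrow> nat \<Rightarrow> real" where
  "std_partition N i = real i / 2 ^ N"

definition std_size :: "nat \<Rightarrow> nat" where
  "std_size N = 2 ^ N - 1"


section \<open>Dirichlet distributions and the entropic measure\<close>

definition dirichlet_integral ::
  "real \<Rightarrow> nat \<Rightarrow> (nat \<Rightarrow> real) \<Rightarrow> ((nat \<Rightarrow> real) \<Rightarrow> real) \<Rightarrow> real" where
  "dirichlet_integral \<beta> N t u =
     Gamma \<beta> / (\<Prod>i=0..N. Gamma (\<beta> * (t (i + 1) - t i))) *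
     (LINT x:simplex_set N|(\<Pi>\<^sub>M i\<in>{1..N}. lborel).
        u x * (\<Prod>i=0..N. (bd N x (i + 1) - bd N x i) powr (\<beta> * (t (i + 1) - t i) - 1)))"

definition is_entropic_measure :: "real \<Rightarrow> (real \<Rightarrow> real) measure \<Rightarrow> bool" where
  "is_entropic_measure \<beta> Q \<longleftrightarrow>
     borel_prob_on G0 L2_dist Q \<and>
     (\<forall>N t u. is_partition N t \<and>
        u \<in> borel_measurable (\<Pi>\<^sub>M i\<in>{1..N}. restrict_space borel {0..1}) \<and>
        bounded (u ` ({1..N} \<rightarrow>\<^sub>E {0..1})) \<longrightarrow>
        (LINT g|Q. u (\<lambda>i\<in>{1..N}. g (t i))) = dirichlet_integral \<beta> N t u)"

definition is_partition_measure ::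
  "real \<Rightarrow> nat \<Rightarrow> (nat \<Rightarrow> real) \<Rightarrow> (nat \<Rightarrow> real) measure \<Rightarrow> bool" where
  "is_partition_measure \<beta> N t \<mu> \<longleftrightarrow>
     borel_measure_on (simplex_set N) (partition_dist N t) \<mu> \<and>
     (\<forall>u. continuous_map (Metric_space.mtopology (simplex_set N) (partition_dist N t))
              euclideanreal u \<and>
           bounded (u ` simplex_set N) \<longrightarrow>
        (LINT x|\<mu>. u x) = dirichlet_integral \<beta> N t u)"

end

theory Submission
  imports Defs
begin

text \<open>
  The entropic measure is realised by Sethuraman's stick-breaking construction: with independent
  Beta(1, \<open>\<beta>\<close>) sticks \<open>V\<^sub>k\<close> and uniform positions \<open>U\<^sub>k\<close> on \<open>(0,1]\<close>, let \<open>g(t)\<close> be the total mass of the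
  atoms \<open>V\<^sub>k (1 - V\<^sub>0) \<dots> (1 - V\<^sub>k\<^sub>-\<^sub>1)\<close> with \<open>U\<^sub>k \<le> t\<close>. Splitting off the first atom gives a recursion for
  the moments of the increments of \<open>g\<close>, which the moments of the Dirichlet distribution satisfy as well;
  since the recursion has only one solution and measures on the cube are determined by their moments,
  all finite-dimensional marginals of \<open>g\<close> are Dirichlet at once, and no consistency argument or
  Kolmogorov extension is needed. Uniqueness holds because \<open>G0\<close> is separable and its Borel sets are generated by the
  values at dyadic points.

  For the convergence, the point \<open>x\<close> of the simplex is sent to the step function with values \<open>x\<^sub>i\<close> on the dyadic intervals.
  This is an exact isometry with \<open>O(2\<^sup>-\<^sup>N\<^sup>/\<^sup>2)\<close>-dense image. The image of \<open>\<mu>\<^sub>N\<close> is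
  the law under \<open>Q\<close> of the dyadic discretisation of \<open>g\<close>, which converges to \<open>g\<close> pointwise, so
  dominated convergence applies: a continuous test function is bounded, because \<open>G0\<close> is compact by
  Helly's selection theorem.
\<close>

section \<open>Dirichlet integrals\<close>

text \<open>Moments are taken in the increments of a point rather than in its coordinates. An atom
  falls into exactly one cell of a partition, so one factor of a monomial gains mass while all are
  scaled by \<open>1 - V\<close>; the binomial theorem then leads back to monomials of the same or
  lower degree. On the Dirichlet side such a monomial only raises the exponents of the density, and
  every moment becomes a quotient of Gamma products.

  Two obstacles shape the rest. The Dirichlet laws live on R^N with the product sigma-algebra, while
  test functions live on the cube or on the simplex with its metric Borel sets; clamping and
  \<open>simplex_proj\<close> retract R^N onto these sets without changing anything on the simplex,
  which carries all the mass. Moreover the simplex is open: samples of a function with flat pieces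
  fall outside it. Step functions are therefore built from weakly increasing values, density uses a
  perturbed sample, and strictness under Q holds only almost surely.

  Evaluation at a point is not continuous for the \<open>L2\<close> distance. It is upper
  semicontinuous, which makes it Borel, and conversely distances are limits of functions of dyadic
  values.\<close>

definition pos_powr :: "real \<Rightarrow> real \<Rightarrow> real" where
  "pos_powr a d = (if d > 0 then d powr (a - 1) else 0)"

lemma pos_powr_nonneg [simp]: "pos_powr a d \<ge> 0"
  by (simp add: pos_powr_def)

lemma measurable_pos_powr [measurable]:
  assumes [measurable]: "f \<in> borel_measurable M"
  shows "(\<lambda>x. pos_powr a (f x)) \<in> borel_measurable M"
  unfolding pos_powr_def by measurable

text \<open>Substituting \<open>x = s * y\<close> gives the Beta integral; the powers contribute
  \<open>a + b - 2\<close> to the exponent of \<open>s\<close> and the Jacobian contributes 1. Since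
  \<open>pos_powr\<close> vanishes at nonpositive arguments, the integral over the whole line only
  sees \<open>0 < x < s\<close>, and the order constraints of the simplex are built into the
  integrand.\<close>

lemma pos_powr_convolution:
  assumes "a > 0" "b > 0"
  shows "(\<integral>\<^sup>+x. ennreal (pos_powr a x * pos_powr b (s - x)) \<partial>lborel) =
           ennreal (Beta a b * pos_powr (a + b) s)"
proof (cases "s > 0")
  case False
  then have "pos_powr a x * pos_powr b (s - x) = 0" for x
    by (auto simp: pos_powr_def)
  then have "(\<lambda>x. ennreal (pos_powr a x * pos_powr b (s - x))) = (\<lambda>_. 0)"
    by (simp only: ennreal_0)
  then show ?thesis using False by (simp add: pos_powr_def)
next
  case True
  have "(\<integral>\<^sup>+x. ennreal (pos_powr a x * pos_powr b (s - x)) \<partial>lborel) =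
      s * (\<integral>\<^sup>+y. ennreal (pos_powr a (s * y) * pos_powr b (s - s * y)) \<partial>lborel)"
    using True by (subst nn_integral_real_affine[where c = s and t = 0]) auto
  also have "\<dots> = s * (\<integral>\<^sup>+y. ennreal (s powr (a + b - 2)) *
      ennreal (indicator {0<..<1} y * (y powr (a - 1) * (1 - y) powr (b - 1))) \<partial>lborel)"
  proof (intro arg_cong2[where f = "(*)"] refl nn_integral_cong)
    fix y :: real
    have "s - s * y = s * (1 - y)" by (simp add: algebra_simps)
    moreover have "s powr (a + b - 2) = s powr (a - 1) * s powr (b - 1)"
      by (simp add: powr_add[symmetric])
    ultimately show "ennreal (pos_powr a (s * y) * pos_powr b (s - s * y)) =
      ennreal (s powr (a + b - 2)) * ennreal (indicator {0<..<1} y * (y powr (a - 1) * (1 - y) powr (b - 1)))"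
      using True
      by (simp only: pos_powr_def powr_mult) 
         (auto simp: powr_mult indicator_def zero_less_mult_iff ennreal_mult[symmetric] mult_ac)
  qed
  also have "\<dots> = s * (ennreal (s powr (a + b - 2)) *
      (\<integral>\<^sup>+y. ennreal (indicator {0<..<1} y * (y powr (a - 1) * (1 - y) powr (b - 1))) \<partial>lborel))"
    by (subst nn_integral_cmult) auto
  also have "(\<integral>\<^sup>+y. ennreal (indicator {0<..<1} y * (y powr (a - 1) * (1 - y) powr (b - 1))) \<partial>lborel) = ennreal (Beta a b)"
  proof -
    have "((\<lambda>y. y powr (a - 1) * (1 - y) powr (b - 1)) has_integral Beta a b) {0<..<1}"
      using has_integral_Beta_real[OF assms] by (simp add: has_integral_Icc_iff_Ioo)
    from nn_integral_has_integral_lebesgue[OF _ this]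
    show ?thesis by (simp add: nn_integral_completion mult.commute)
  qed
  also have "ennreal s * (ennreal (s powr (a + b - 2)) * ennreal (Beta a b)) = ennreal (Beta a b * pos_powr (a + b) s)"
  proof -
    have "s powr (a + b - 1) = s * s powr (a + b - 2)"
      using True powr_add[of s 1 "a+b-2"] by (simp)
    moreover have "Beta a b \<ge> 0" using assms
      by (auto simp: Beta_def less_imp_le[OF Gamma_real_pos] intro!: divide_nonneg_pos mult_nonneg_nonneg Gamma_real_pos)
    ultimately show ?thesis using True
      by (simp add: pos_powr_def ennreal_mult[symmetric] mult_ac)
  qed
  finally show ?thesis .
qed

text \<open>The unnormalised Dirichlet density with the right end 1 replaced by a variable
  \<open>s\<close>. This generality carries the induction on the dimension: fixing the last
  coordinate at \<open>y\<close> leaves a kernel of one dimension less with right end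
  \<open>y\<close>.\<close>

definition dirichlet_kernel :: "real \<Rightarrow> nat \<Rightarrow> (nat \<Rightarrow> real) \<Rightarrow> (nat \<Rightarrow> real) \<Rightarrow> real" where
  "dirichlet_kernel s N a x =
     (\<Prod>i\<le>N. pos_powr (a i) ((if i = N then s else x (Suc i)) - (if i = 0 then 0 else x i)))"

text \<open>The condition does not depend on the point, so a branch has to be measurable only when
  it is taken. In the branch not taken, the index of a coordinate may lie outside the
  product.\<close>

lemma measurable_If_const:
  "(P \<Longrightarrow> f \<in> measurable M N) \<Longrightarrow> (\<not> P \<Longrightarrow> g \<in> measurable M N) \<Longrightarrow>
     (\<lambda>x. if P then f x else g x) \<in> measurable M N"
  by (cases P) auto

lemma dirichlet_kernel_nonneg [simp]: "dirichlet_kernel s N a x \<ge> 0"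
  by (auto simp: dirichlet_kernel_def intro!: prod_nonneg)

lemma measurable_dirichlet_kernel_pair:
  "(\<lambda>(s, x). dirichlet_kernel s N a x) \<in> borel_measurable (borel \<Otimes>\<^sub>M (\<Pi>\<^sub>M i\<in>{1..N}. lborel))"
proof -
  have [measurable]: "(\<lambda>x. snd x i) \<in> borel_measurable (borel \<Otimes>\<^sub>M (\<Pi>\<^sub>M i\<in>{1..N}. lborel))"
    if "i \<in> {1..N}" for i
    using measurable_compose[OF measurable_snd measurable_component_singleton[OF that, of "\<lambda>_. lborel"]] by simp
  show ?thesis
    unfolding dirichlet_kernel_def split_beta
    by (intro borel_measurable_prod measurable_pos_powr borel_measurable_diff; rule measurable_If_const) auto
qed

lemma measurable_dirichlet_kernel [measurable]:
  "dirichlet_kernel s N a \<in> borel_measurable (\<Pi>\<^sub>M i\<in>{1..N}. lborel)"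
  using measurable_compose[OF measurable_Pair1' measurable_dirichlet_kernel_pair, of s] by simp

lemma dirichlet_kernel_Suc:
  "dirichlet_kernel s (Suc N) a (x(Suc N := y)) =
     dirichlet_kernel y N a x * pos_powr (a (Suc N)) (s - y)"
  unfolding dirichlet_kernel_def by (auto intro!: prod.cong)

text \<open>The last coordinate is integrated in the outer integral: the inner one is the induction
  hypothesis with right end \<open>y\<close>, and what remains is a convolution. The Beta factors
  telescope to the quotient of Gamma values.\<close>

lemma nn_integral_dirichlet_kernel:
  assumes "\<And>i. i \<le> N \<Longrightarrow> a i > 0"
  shows "(\<integral>\<^sup>+x. ennreal (dirichlet_kernel s N a x) \<partial>(\<Pi>\<^sub>M i\<in>{1..N}. lborel)) =
     ennreal ((\<Prod>i\<le>N. Gamma (a i)) / Gamma (\<Sum>i\<le>N. a i) * pos_powr (\<Sum>i\<le>N. a i) s)"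
  using assms
proof (induction N arbitrary: s)
  case 0
  have "Gamma (a 0) \<noteq> 0" using 0[of 0] by (simp add: less_imp_neq[OF Gamma_real_pos, symmetric])
  then show ?case by (simp add: PiM_empty dirichlet_kernel_def nn_integral_count_space_finite)
next
  case (Suc N)
  interpret product_sigma_finite "\<lambda>_::nat. lborel :: real measure" ..
  let ?A = "\<Sum>i\<le>N. a i"
  have A: "?A > 0" and G: "(\<Prod>i\<le>N. Gamma (a i)) > 0"
    using Suc.prems by (auto intro!: sum_pos prod_pos Gamma_real_pos)
  have *: "{1..Suc N} = insert (Suc N) {1..N}" by auto
  have "(\<integral>\<^sup>+x. ennreal (dirichlet_kernel s (Suc N) a x) \<partial>(\<Pi>\<^sub>M i\<in>{1..Suc N}. lborel)) =
     (\<integral>\<^sup>+y. \<integral>\<^sup>+x. ennreal (dirichlet_kernel y N a x) * ennreal (pos_powr (a (Suc N)) (s - y)) \<partial>(\<Pi>\<^sub>M i\<in>{1..N}. lborel) \<partial>lborel)"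
    using measurable_dirichlet_kernel[of s "Suc N" a]
    unfolding *
    by (subst product_nn_integral_insert_rev)
       (auto simp: dirichlet_kernel_Suc ennreal_mult simp flip: * intro!: measurable_compose[OF _ measurable_ennreal])
  also have "\<dots> = (\<integral>\<^sup>+y. ennreal ((\<Prod>i\<le>N. Gamma (a i)) / Gamma ?A) *
      ennreal (pos_powr ?A y * pos_powr (a (Suc N)) (s - y)) \<partial>lborel)"
    using Suc G A
    by (intro nn_integral_cong, subst nn_integral_multc)
       (auto simp: ennreal_mult[symmetric] Gamma_real_pos less_imp_le simp del: One_nat_def
           intro!: arg_cong[where f = ennreal] measurable_compose[OF measurable_dirichlet_kernel])
  also have "\<dots> = ennreal ((\<Prod>i\<le>N. Gamma (a i)) / Gamma ?A) * ennreal (Beta ?A (a (Suc N)) * pos_powr (?A + a (Suc N)) s)"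
    using A Suc.prems by (subst nn_integral_cmult) (auto simp: pos_powr_convolution)
  also have "\<dots> = ennreal ((\<Prod>i\<le>Suc N. Gamma (a i)) / Gamma (\<Sum>i\<le>Suc N. a i) * pos_powr (\<Sum>i\<le>Suc N. a i) s)"
    using A G Gamma_real_pos[OF A]
    by (subst ennreal_mult'[symmetric])
       (auto simp: Beta_def mult.assoc less_imp_neq[symmetric] intro!: divide_nonneg_pos arg_cong[where f = ennreal])
  finally show ?case .
qed

section \<open>The normalised Dirichlet distribution and its moments\<close>

definition weight :: "real \<Rightarrow> (nat \<Rightarrow> real) \<Rightarrow> nat \<Rightarrow> real" where
  "weight \<beta> t i = \<beta> * (t (i + 1) - t i)"

definition increment :: "nat \<Rightarrow> nat \<Rightarrow> (nat \<Rightarrow> real) \<Rightarrow> real" where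
  "increment N i x = bd N x (i + 1) - bd N x i"

text \<open>Defined on all of R^N with the product sigma-algebra, which keeps pushforwards simple;
  the cut-off in the kernel concentrates it on the simplex. The passage to the simplex as carrier is
  left to \<open>partition_measure\<close>.\<close>

definition dirichlet_measure :: "real \<Rightarrow> nat \<Rightarrow> (nat \<Rightarrow> real) \<Rightarrow> (nat \<Rightarrow> real) measure" where
  "dirichlet_measure \<beta> N t = density (\<Pi>\<^sub>M i\<in>{1..N}. lborel)
     (\<lambda>x. ennreal (Gamma \<beta> / (\<Prod>i\<le>N. Gamma (weight \<beta> t i)) * dirichlet_kernel 1 N (weight \<beta> t) x))"

lemma sets_PiM_lborel: "sets (\<Pi>\<^sub>M i\<in>I. lborel) = sets (\<Pi>\<^sub>M i\<in>I. (borel :: real measure))"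
  by (intro sets_PiM_cong) auto

lemma sets_dirichlet_measure [measurable_cong]:
  "sets (dirichlet_measure \<beta> N t) = sets (\<Pi>\<^sub>M i\<in>{1..N}. borel)"
  by (simp add: dirichlet_measure_def sets_PiM_lborel)

lemma space_dirichlet_measure: "space (dirichlet_measure \<beta> N t) = extensional {1..N}"
  by (simp add: dirichlet_measure_def space_PiM PiE_UNIV_domain PiE_def)

lemma dirichlet_kernel_increment:
  "dirichlet_kernel 1 N a x = (\<Prod>i\<le>N. pos_powr (a i) (increment N i x))"
  unfolding dirichlet_kernel_def increment_def bd_def by (intro prod.cong) auto

lemma increment_pos: "x \<in> simplex_set N \<Longrightarrow> i \<le> N \<Longrightarrow> increment N i x > 0"
  by (auto simp: simplex_set_def increment_def)

lemma bd_eq_sum_increment: "k \<le> N + 1 \<Longrightarrow> bd N x k = (\<Sum>i<k. increment N i x)"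
  using sum_lessThan_telescope[of "bd N x" k] by (simp add: increment_def bd_def)

text \<open>Each coordinate is a partial sum of positive increments whose total is 1, so the bounds
  0 and 1 follow from positivity.\<close>

lemma simplex_setI:
  assumes "x \<in> extensional {1..N}" "\<And>i. i \<le> N \<Longrightarrow> increment N i x > 0"
  shows "x \<in> simplex_set N"
proof -
  have "x i \<in> {0..1}" if "i \<in> {1..N}" for i
  proof -
    have "x i = (\<Sum>j<i. increment N j x)"
      using bd_eq_sum_increment[of i N x] that by (auto simp: bd_def)
    moreover have "1 = (\<Sum>j<N+1. increment N j x)"
      using bd_eq_sum_increment[of "N+1" N x] by (auto simp: bd_def)
    moreover have "(\<Sum>j<i. increment N j x) \<le> (\<Sum>j<N+1. increment N j x)"
      using that assms(2) by (intro sum_mono2) (auto intro: less_imp_le)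
    moreover have "(\<Sum>j<i. increment N j x) \<ge> 0"
      using that assms(2) by (intro sum_nonneg) (auto intro: less_imp_le)
    ultimately show ?thesis by auto
  qed
  then show ?thesis
    using assms by (auto simp: simplex_set_def increment_def PiE_def Pi_def)
qed

lemma dirichlet_kernel_eq_0:
  assumes "x \<in> extensional {1..N}" "x \<notin> simplex_set N"
  shows "dirichlet_kernel 1 N a x = 0"
proof -
  obtain i where "i \<le> N" "increment N i x \<le> 0"
    using simplex_setI[OF assms(1)] assms(2) by force
  then show ?thesis
    by (auto simp: dirichlet_kernel_increment pos_powr_def intro!: prod_zero bexI[of _ i])
qed

lemma AE_dirichlet_measure: "AE x in dirichlet_measure \<beta> N t. x \<in> simplex_set N"
  unfolding dirichlet_measure_def
  by (subst AE_density)
     (auto intro!: AE_I2 simp: space_PiM PiE_def dirichlet_kernel_eq_0[of _ N] simp del: One_nat_def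
        intro: ccontr)

text \<open>The integral only sees \<open>u\<close> on the simplex, so \<open>u\<close> may be
  exchanged for any \<open>v\<close> that agrees with it there and is measurable on R^N. Test
  functions given on the cube or on the simplex enter through such a \<open>v\<close>.\<close>

lemma dirichlet_integral_eq:
  assumes v [measurable]: "v \<in> borel_measurable (\<Pi>\<^sub>M i\<in>{1..N}. borel)"
    and uv: "\<And>x. x \<in> simplex_set N \<Longrightarrow> u x = v x"
    and pos: "\<beta> > 0" "\<And>i. i \<le> N \<Longrightarrow> t i < t (i + 1)"
  shows "dirichlet_integral \<beta> N t u = (LINT x|dirichlet_measure \<beta> N t. v x)"
proof -
  have [measurable]: "v \<in> borel_measurable (\<Pi>\<^sub>M i\<in>{1..N}. lborel)"
    using v by (subst measurable_cong_sets[OF sets_PiM_lborel refl])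
  have nn: "Gamma \<beta> / (\<Prod>i\<le>N. Gamma (weight \<beta> t i)) \<ge> 0"
    using pos by (auto intro!: divide_nonneg_nonneg prod_nonneg less_imp_le[OF Gamma_real_pos] simp: weight_def)
  have "(LINT x|dirichlet_measure \<beta> N t. v x) =
     (LINT x|(\<Pi>\<^sub>M i\<in>{1..N}. lborel). Gamma \<beta> / (\<Prod>i\<le>N. Gamma (weight \<beta> t i)) * (dirichlet_kernel 1 N (weight \<beta> t) x * v x))"
    unfolding dirichlet_measure_def
    by (subst integral_density) (use nn in \<open>auto simp del: One_nat_def times_divide_eq_left simp: mult.assoc intro!: AE_I2 mult_nonneg_nonneg\<close>)
  also have "\<dots> = Gamma \<beta> / (\<Prod>i\<le>N. Gamma (weight \<beta> t i)) * (LINT x|(\<Pi>\<^sub>M i\<in>{1..N}. lborel). dirichlet_kernel 1 N (weight \<beta> t) x * v x)"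
    by (rule integral_mult_right_zero)
  also have "(LINT x|(\<Pi>\<^sub>M i\<in>{1..N}. lborel). dirichlet_kernel 1 N (weight \<beta> t) x * v x) =
    (LINT x:simplex_set N|(\<Pi>\<^sub>M i\<in>{1..N}. lborel). u x * (\<Prod>i=0..N. (bd N x (i + 1) - bd N x i) powr (\<beta> * (t (i + 1) - t i) - 1)))"
    unfolding set_lebesgue_integral_def
  proof (intro Bochner_Integration.integral_cong refl)
    fix x :: "nat \<Rightarrow> real" assume "x \<in> space (\<Pi>\<^sub>M i\<in>{1..N}. lborel)"
    then have ext: "x \<in> extensional {1..N}" by (auto simp: space_PiM PiE_def)
    show "dirichlet_kernel 1 N (weight \<beta> t) x * v x = indicat_real (simplex_set N) x *\<^sub>R
      (u x * (\<Prod>i=0..N. (bd N x (i + 1) - bd N x i) powr (\<beta> * (t (i + 1) - t i) - 1)))"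
    proof (cases "x \<in> simplex_set N")
      case True
      then show ?thesis
        using uv by (auto simp: dirichlet_kernel_increment pos_powr_def increment_pos weight_def increment_def[symmetric, where N = N and x = x, simplified]
          atMost_atLeast0 cong: prod.cong_simp)
    qed (use dirichlet_kernel_eq_0[OF ext] in auto)
  qed
  finally show ?thesis
    by (simp add: dirichlet_integral_def weight_def atMost_atLeast0)
qed

lemma measurable_increment [measurable]:
  assumes "i \<le> N"
  shows "increment N i \<in> borel_measurable (\<Pi>\<^sub>M i\<in>{1..N}. borel)"
  unfolding increment_def bd_def
  by (intro borel_measurable_diff measurable_If_const) (use assms in auto)

lemma sum_weight:
  assumes "is_partition N t"
  shows "(\<Sum>i\<le>N. weight \<beta> t i) = \<beta>"
proof -
  have "(\<Sum>i\<le>N. weight \<beta> t i) = \<beta> * (\<Sum>i<Suc N. t (Suc i) - t i)"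
    by (simp add: weight_def sum_distrib_left lessThan_Suc_atMost)
  then show ?thesis
    using assms by (subst (asm) sum_lessThan_telescope) (auto simp: is_partition_def)
qed

lemma weight_pos: "is_partition N t \<Longrightarrow> \<beta> > 0 \<Longrightarrow> i \<le> N \<Longrightarrow> weight \<beta> t i > 0"
  by (auto simp: is_partition_def weight_def)

text \<open>Multiplying by a monomial in the increments turns the parameters \<open>a i\<close> into
  \<open>a i + k i\<close>, so the moment is a quotient of two normalising constants; the quotients
  of Gamma values are Pochhammer symbols. The case \<open>k = 0\<close> says that the total mass is
  1.\<close>

lemma nn_integral_dirichlet_moments:
  assumes part: "is_partition N t" and \<beta>: "\<beta> > 0"
  shows "(\<integral>\<^sup>+x. ennreal (\<Prod>i\<le>N. increment N i x ^ k i) \<partial>dirichlet_measure \<beta> N t) =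
     ennreal ((\<Prod>i\<le>N. pochhammer (weight \<beta> t i) (k i)) / pochhammer \<beta> (\<Sum>i\<le>N. k i))"
proof -
  define a where "a = weight \<beta> t"
  define C where "C = Gamma \<beta> / (\<Prod>i\<le>N. Gamma (a i))"
  have a: "\<And>i. i \<le> N \<Longrightarrow> a i > 0" using weight_pos[OF part \<beta>] by (simp add: a_def)
  have C: "C \<ge> 0" using a \<beta> unfolding C_def
    by (auto intro!: divide_nonneg_nonneg prod_nonneg less_imp_le[OF Gamma_real_pos])
  have kernel: "dirichlet_kernel 1 N a x * (\<Prod>i\<le>N. increment N i x ^ k i) =
     dirichlet_kernel 1 N (\<lambda>i. a i + k i) x" for x
    unfolding dirichlet_kernel_increment prod.distrib[symmetric]
    by (intro prod.cong) (auto simp: pos_powr_def powr_add powr_realpow powr_diff)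
  have sum: "(\<Sum>i\<le>N. a i + k i) = \<beta> + (\<Sum>i\<le>N. k i)"
    using sum_weight[OF part, of \<beta>] by (simp add: sum.distrib a_def)
  have mb: "(\<lambda>x. ennreal (\<Prod>i\<le>N. increment N i x ^ k i)) \<in> borel_measurable (\<Pi>\<^sub>M i\<in>{1..N}. lborel)"
    by (subst measurable_cong_sets[OF sets_PiM_lborel refl]) measurable
  have "(\<integral>\<^sup>+x. ennreal (\<Prod>i\<le>N. increment N i x ^ k i) \<partial>dirichlet_measure \<beta> N t) =
    (\<integral>\<^sup>+x. ennreal C * ennreal (dirichlet_kernel 1 N (\<lambda>i. a i + k i) x) \<partial>(\<Pi>\<^sub>M i\<in>{1..N}. lborel))"
    unfolding dirichlet_measure_def a_def[symmetric] C_def[symmetric]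
    by (subst nn_integral_density)
       (use mb C in \<open>auto simp: kernel[symmetric] ennreal_mult' mult.assoc simp del: One_nat_def intro!: nn_integral_cong\<close>)
  also have "\<dots> = ennreal C * ennreal ((\<Prod>i\<le>N. Gamma (a i + k i)) / Gamma (\<beta> + (\<Sum>i\<le>N. k i)))"
    using a by (subst nn_integral_cmult, simp del: One_nat_def)
      (subst nn_integral_dirichlet_kernel, auto simp: sum pos_powr_def add_pos_nonneg)
  also have "\<dots> = ennreal ((\<Prod>i\<le>N. pochhammer (a i) (k i)) / pochhammer \<beta> (\<Sum>i\<le>N. k i))"
  proof -
    have "pochhammer (a i) (k i) = Gamma (a i + k i) / Gamma (a i)" if "i \<le> N" for i
      using a[OF that] by (intro pochhammer_Gamma) (auto elim!: nonpos_Ints_cases)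
    moreover have "pochhammer \<beta> (\<Sum>i\<le>N. k i) = Gamma (\<beta> + (\<Sum>i\<le>N. k i)) / Gamma \<beta>"
      using \<beta> by (subst pochhammer_Gamma) (auto elim!: nonpos_Ints_cases)
    ultimately show ?thesis
      using C by (simp add: ennreal_mult'[symmetric] C_def prod_dividef mult_ac)
  qed
  finally show ?thesis by (simp add: a_def)
qed

lemma prob_space_dirichlet_measure:
  assumes "is_partition N t" "\<beta> > 0"
  shows "prob_space (dirichlet_measure \<beta> N t)"
  using nn_integral_dirichlet_moments[OF assms, of "\<lambda>_. 0"]
  by (intro prob_spaceI) simp

section \<open>Measures on the cube determined by their moments\<close>

lemma sets_PiM_atMost:
  assumes I: "finite I"
  shows "sets (\<Pi>\<^sub>M i\<in>I. (borel :: real measure)) =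
    sigma_sets (\<Pi>\<^sub>E i\<in>I. UNIV) (range (\<lambda>c. \<Pi>\<^sub>E i\<in>I. {..c i}))"
proof -
  have *: "\<exists>S \<subseteq> range (atMost :: real \<Rightarrow> _). countable S \<and> UNIV = \<Union>S"
  proof (intro exI[of _ "range (\<lambda>n. {..real n})"] conjI)
    show "UNIV = \<Union>(range (\<lambda>n. {..real n}))" using real_arch_simple by blast
  qed auto
  have "sets (\<Pi>\<^sub>M i\<in>I. (borel :: real measure)) = sets (\<Pi>\<^sub>M i\<in>I. sigma UNIV (range (atMost :: real \<Rightarrow> _)))"
    by (simp only: borel_eq_atMost)
  also have "\<dots> = sets (sigma (\<Pi>\<^sub>E i\<in>I. UNIV)
      {{f \<in> \<Pi>\<^sub>E i\<in>I. UNIV. \<forall>i\<in>j. f i \<in> A i} | A j. j \<in> {I} \<and> A \<in> Pi j (\<lambda>_. range (atMost :: real \<Rightarrow> _))})"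
    using I * by (intro sets_PiM_sigma) auto
  also have "\<dots> = sigma_sets (\<Pi>\<^sub>E i\<in>I. UNIV) {{f \<in> \<Pi>\<^sub>E i\<in>I. UNIV. \<forall>i\<in>j. f i \<in> A i} | A j. j \<in> {I} \<and> A \<in> Pi j (\<lambda>_. range (atMost :: real \<Rightarrow> _))}"
    by (rule sets_measure_of) auto
  also have "{{f \<in> \<Pi>\<^sub>E i\<in>I. UNIV. \<forall>i\<in>j. f i \<in> A i} | A j. j \<in> {I} \<and> A \<in> Pi j (\<lambda>_. range (atMost :: real \<Rightarrow> _))} =
     {\<Pi>\<^sub>E i\<in>I. F i | F. \<forall>i\<in>I. F i \<in> range (atMost :: real \<Rightarrow> _)}"
    (is "?L = ?R")
  proof (intro equalityI subsetI)
    fix X assume "X \<in> ?L"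
    then obtain F where "X = {f \<in> \<Pi>\<^sub>E i\<in>I. UNIV. \<forall>i\<in>I. f i \<in> F i}" "\<forall>i\<in>I. F i \<in> range atMost"
      by blast
    moreover then have "X = (\<Pi>\<^sub>E i\<in>I. F i)" by (simp add: set_eq_iff PiE_iff) blast
    ultimately show "X \<in> ?R" by blast
  next
    fix X assume "X \<in> ?R"
    then obtain F where "X = (\<Pi>\<^sub>E i\<in>I. F i)" and F: "\<forall>i\<in>I. F i \<in> range atMost"
      by blast
    then have "X = {f \<in> \<Pi>\<^sub>E i\<in>I. UNIV. \<forall>i\<in>I. f i \<in> F i}" by (simp add: set_eq_iff PiE_iff) blast
    with F show "X \<in> ?L" by blast
  qed
  also have "{\<Pi>\<^sub>E i\<in>I. F i | F. \<forall>i\<in>I. F i \<in> range (atMost :: real \<Rightarrow> _)} = range (\<lambda>c. \<Pi>\<^sub>E i\<in>I. {..c i})"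
  proof safe
    fix F :: "'a \<Rightarrow> real set" assume "\<forall>i\<in>I. F i \<in> range atMost"
    then have "\<forall>i\<in>I. \<exists>r. F i = {..r}" by blast
    then obtain c where "\<forall>i\<in>I. F i = {..c i}" by (rule bchoice[THEN exE])
    then have "(\<Pi>\<^sub>E i\<in>I. F i) = (\<Pi>\<^sub>E i\<in>I. {..c i})" by (simp cong: PiE_cong)
    then show "Pi\<^sub>E I F \<in> range (\<lambda>c. \<Pi>\<^sub>E i\<in>I. {..c i})" by (rule range_eqI[where x = c])
  next
    fix c :: "'a \<Rightarrow> real"
    show "\<exists>F. Pi\<^sub>E I (\<lambda>i. {..c i}) = Pi\<^sub>E I F \<and> (\<forall>i\<in>I. F i \<in> range atMost)"
      by (rule exI[of _ "\<lambda>i. {..c i}"]) simp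
  qed
  finally show ?thesis .
qed

lemma measure_eqI_PiM_atMost:
  fixes M1 M2 :: "('i \<Rightarrow> real) measure"
  assumes I: "finite I" and fin: "finite_measure M1"
    and sets: "sets M1 = sets (\<Pi>\<^sub>M i\<in>I. borel)" "sets M2 = sets (\<Pi>\<^sub>M i\<in>I. borel)"
    and eq: "\<And>c. emeasure M1 (\<Pi>\<^sub>E i\<in>I. {..c i}) = emeasure M2 (\<Pi>\<^sub>E i\<in>I. {..c i})"
  shows "M1 = M2"
proof (rule measure_eqI_generator_eq[where A = "\<lambda>n. \<Pi>\<^sub>E i\<in>I. {..real n}"])
  interpret finite_measure M1 by (rule fin)
  show "Int_stable (range (\<lambda>c. \<Pi>\<^sub>E i\<in>I. {..c i :: real}))"
  proof (rule Int_stableI_image)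
    fix c d :: "'i \<Rightarrow> real"
    have "(\<Pi>\<^sub>E i\<in>I. {..c i}) \<inter> (\<Pi>\<^sub>E i\<in>I. {..d i}) = (\<Pi>\<^sub>E i\<in>I. {..min (c i) (d i)})"
      by (simp add: PiE_Int)
    then show "\<exists>k\<in>UNIV. (\<Pi>\<^sub>E i\<in>I. {..c i}) \<inter> (\<Pi>\<^sub>E i\<in>I. {..d i}) = (\<Pi>\<^sub>E i\<in>I. {..k i})"
      by (intro bexI[of _ "\<lambda>i. min (c i) (d i)"]) simp_all
  qed
  show "(\<Union>n. \<Pi>\<^sub>E i\<in>I. {..real n}) = (\<Pi>\<^sub>E i\<in>I. UNIV)"
  proof safe
    fix x :: "'i \<Rightarrow> real" assume x: "x \<in> (\<Pi>\<^sub>E i\<in>I. UNIV)"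
    obtain n where n: "(\<Sum>i\<in>I. \<bar>x i\<bar>) \<le> real n" using real_arch_simple by blast
    have "x i \<le> real n" if "i \<in> I" for i
      using member_le_sum[OF that, of "\<lambda>i. \<bar>x i\<bar>"] I n by simp
    with x show "x \<in> (\<Union>n. \<Pi>\<^sub>E i\<in>I. {..real n})" by (auto simp: PiE_iff)
  qed auto
  show "range (\<lambda>c. \<Pi>\<^sub>E i\<in>I. {..c i}) \<subseteq> Pow (\<Pi>\<^sub>E i\<in>I. (UNIV :: real set))"
    by (auto simp: PiE_iff)
  show "sets M1 = sigma_sets (\<Pi>\<^sub>E i\<in>I. UNIV) (range (\<lambda>c. \<Pi>\<^sub>E i\<in>I. {..c i}))"
    "sets M2 = sigma_sets (\<Pi>\<^sub>E i\<in>I. UNIV) (range (\<lambda>c. \<Pi>\<^sub>E i\<in>I. {..c i}))"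
    unfolding sets sets_PiM_atMost[OF I] by (rule refl)+
  show "emeasure M1 X = emeasure M2 X" if "X \<in> range (\<lambda>c. \<Pi>\<^sub>E i\<in>I. {..c i})" for X
    using that by (auto simp: eq)
  show "range (\<lambda>n. \<Pi>\<^sub>E i\<in>I. {..real n}) \<subseteq> range (\<lambda>c. \<Pi>\<^sub>E i\<in>I. {..c i})"
    by (rule image_subsetI, rule rangeI[of _ "\<lambda>_. real n" for n])
  show "emeasure M1 (\<Pi>\<^sub>E i\<in>I. {..real n}) \<noteq> \<infinity>" for n
    using emeasure_finite by (simp add: top_unique)
qed

text \<open>For \<open>n > 0\<close> a continuous majorant of the indicator of \<open>{..c}\<close>
  that falls linearly from 1 at \<open>c\<close> to 0 at \<open>c + 1/n\<close>.\<close>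

definition ramp :: "real \<Rightarrow> nat \<Rightarrow> real \<Rightarrow> real" where
  "ramp c n y = max 0 (min 1 (1 - real n * (y - c)))"

lemma continuous_on_ramp: "continuous_on S (ramp c n)"
  unfolding ramp_def by (intro continuous_intros)

lemma ramp_bounds: "0 \<le> ramp c n y" "ramp c n y \<le> 1" "\<bar>ramp c n y\<bar> \<le> 1"
  by (auto simp: ramp_def)

lemma measurable_ramp [measurable]: "ramp c n \<in> borel_measurable borel"
  unfolding ramp_def by measurable

lemma ramp_tendsto: "(\<lambda>n. ramp c n y) \<longlonglongrightarrow> indicator {..c} y"
proof (cases "y \<le> c")
  case True
  have "ramp c n y = 1" for n
  proof -
    have "real n * (y - c) \<le> 0" using True by (intro mult_nonneg_nonpos) auto
    then show ?thesis by (auto simp: ramp_def)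
  qed
  with True show ?thesis by simp
next
  case False
  obtain N where N: "1 / (y - c) \<le> real N" using real_arch_simple by blast
  have "ramp c n y = 0" if "n \<ge> N" for n
  proof -
    have "1 / (y - c) \<le> real n" using N that by linarith
    then have "1 \<le> real n * (y - c)" using False by (simp add: field_simps)
    then show ?thesis by (auto simp: ramp_def)
  qed
  then have "eventually (\<lambda>n. ramp c n y = indicator {..c} y) sequentially"
    using False by (auto simp: eventually_sequentially)
  then show ?thesis by (rule tendsto_eventually)
qed

lemma ramp_prod_bounds: "\<bar>\<Prod>i\<in>I. ramp (c i) n (x i)\<bar> \<le> 1"
  by (auto simp: abs_prod intro!: prod_le_1 ramp_bounds)

lemma ramp_prod_tendsto:
  assumes "finite I"
  shows "(\<lambda>n. \<Prod>i\<in>I. ramp (c i) n (x i)) \<longlonglongrightarrow> indicator {x. \<forall>i\<in>I. x i \<le> c i} x"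
proof -
  have "(\<lambda>n. \<Prod>i\<in>I. ramp (c i) n (x i)) \<longlonglongrightarrow> (\<Prod>i\<in>I. indicator {..c i} (x i))"
    by (intro tendsto_prod ramp_tendsto)
  also have "(\<Prod>i\<in>I. indicator {..c i} (x i) :: real) = indicator {x. \<forall>i\<in>I. x i \<le> c i} x"
    using assms by (auto simp: indicator_def prod_zero_iff intro!: prod.neutral)
  finally show ?thesis .
qed

text \<open>As the ramps steepen, dominated convergence gives equal masses of lower orthants. The
  test functions are bounded and continuous, so that they can be approximated by polynomials and are
  also admissible in the characterisations of the entropic measure and of the partition
  measures.\<close>

lemma measure_eqI_PiM_ramp:
  fixes M1 M2 :: "('i \<Rightarrow> real) measure"
  assumes I: "finite I" and fin: "finite_measure M1" "finite_measure M2"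
    and sets: "sets M1 = sets (\<Pi>\<^sub>M i\<in>I. borel)" "sets M2 = sets (\<Pi>\<^sub>M i\<in>I. borel)"
    and eq: "\<And>c n. (LINT x|M1. (\<Prod>i\<in>I. ramp (c i) n (x i))) = (LINT x|M2. (\<Prod>i\<in>I. ramp (c i) n (x i)))"
  shows "M1 = M2"
proof (rule measure_eqI_PiM_atMost[OF I fin(1) sets])
  fix c :: "'i \<Rightarrow> real"
  have lim: "(\<lambda>n. LINT x|M. (\<Prod>i\<in>I. ramp (c i) n (x i))) \<longlonglongrightarrow> measure M (\<Pi>\<^sub>E i\<in>I. {..c i})"
    if "finite_measure M" and s: "sets M = sets (\<Pi>\<^sub>M i\<in>I. borel)" for M
  proof -
    interpret finite_measure M by fact
    have sp: "space M = extensional I"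
      using sets_eq_imp_space_eq[OF s] by (simp add: space_PiM PiE_def)
    have [measurable]: "(\<Pi>\<^sub>E i\<in>I. {..c i}) \<in> sets M"
      unfolding s by (intro sets_PiM_I_finite I) auto
    have "(\<lambda>n. LINT x|M. (\<Prod>i\<in>I. ramp (c i) n (x i))) \<longlonglongrightarrow> (LINT x|M. indicator (\<Pi>\<^sub>E i\<in>I. {..c i}) x)"
    proof (rule integral_dominated_convergence[where w = "\<lambda>_. 1"])
      show "(\<lambda>x. \<Prod>i\<in>I. ramp (c i) n (x i)) \<in> borel_measurable M" for n
        unfolding measurable_cong_sets[OF s refl] by measurable
      show "AE x in M. (\<lambda>n. \<Prod>i\<in>I. ramp (c i) n (x i)) \<longlonglongrightarrow> indicator (\<Pi>\<^sub>E i\<in>I. {..c i}) x"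
      proof (rule AE_I2)
        fix x assume "x \<in> space M"
        then have "indicator (\<Pi>\<^sub>E i\<in>I. {..c i}) x = (indicator {x. \<forall>i\<in>I. x i \<le> c i} x :: real)"
          by (auto simp: sp indicator_def PiE_def Pi_def)
        then show "(\<lambda>n. \<Prod>i\<in>I. ramp (c i) n (x i)) \<longlonglongrightarrow> indicator (\<Pi>\<^sub>E i\<in>I. {..c i}) x"
          using ramp_prod_tendsto[OF I, of c x] by simp
      qed
    qed (auto simp: ramp_prod_bounds)
    then show ?thesis by simp
  qed
  have "measure M1 (\<Pi>\<^sub>E i\<in>I. {..c i}) = measure M2 (\<Pi>\<^sub>E i\<in>I. {..c i})"
    using LIMSEQ_unique[OF lim[OF fin(1) sets(1)]] lim[OF fin(2) sets(2)] by (simp add: eq)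
  then show "emeasure M1 (\<Pi>\<^sub>E i\<in>I. {..c i}) = emeasure M2 (\<Pi>\<^sub>E i\<in>I. {..c i})"
    using fin by (simp add: finite_measure.emeasure_eq_measure)
qed

lemma moments_prod_polynomial:
  fixes M :: "('i \<Rightarrow> real) measure"
  assumes I: "finite I" and fin: "finite_measure M" and sets: "sets M = sets (\<Pi>\<^sub>M i\<in>I. borel)"
    and AE: "AE x in M. \<forall>i\<in>I. x i \<in> {0..1}"
  shows "(LINT x|M. (\<Prod>i\<in>I. \<Sum>j\<le>d i. a i j * x i ^ j)) =
     (\<Sum>k\<in>(\<Pi>\<^sub>E i\<in>I. {..d i}). (\<Prod>i\<in>I. a i (k i)) * (LINT x|M. (\<Prod>i\<in>I. x i ^ k i)))"
proof -
  interpret finite_measure M by fact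
  have int: "integrable M (\<lambda>x. \<Prod>i\<in>I. x i ^ k i)" for k
  proof (rule integrable_const_bound[where B = 1])
    show "AE x in M. norm (\<Prod>i\<in>I. x i ^ k i) \<le> 1"
      using AE by eventually_elim (auto simp: abs_prod power_abs intro!: prod_le_1 power_le_one)
    show "(\<lambda>x. \<Prod>i\<in>I. x i ^ k i) \<in> borel_measurable M"
      unfolding measurable_cong_sets[OF sets refl] by measurable
  qed
  have "(LINT x|M. (\<Prod>i\<in>I. \<Sum>j\<le>d i. a i j * x i ^ j)) =
    (LINT x|M. (\<Sum>k\<in>(\<Pi>\<^sub>E i\<in>I. {..d i}). (\<Prod>i\<in>I. a i (k i)) * (\<Prod>i\<in>I. x i ^ k i)))"
    by (subst prod_sum_PiE[OF I]) (auto simp: prod.distrib)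
  also have "\<dots> = (\<Sum>k\<in>(\<Pi>\<^sub>E i\<in>I. {..d i}). (\<Prod>i\<in>I. a i (k i)) * (LINT x|M. (\<Prod>i\<in>I. x i ^ k i)))"
    using int by (subst Bochner_Integration.integral_sum) auto
  finally show ?thesis .
qed

text \<open>The test functions are products of functions of one coordinate, so the Weierstrass
  theorem on \<open>[0,1]\<close> is applied in each coordinate separately. The product of the
  approximating polynomials expands into monomials, whose integrals agree by assumption.\<close>

lemma measure_eqI_moments:
  fixes M1 M2 :: "('i \<Rightarrow> real) measure"
  assumes I: "finite I" and fin: "finite_measure M1" "finite_measure M2"
    and sets: "sets M1 = sets (\<Pi>\<^sub>M i\<in>I. borel)" "sets M2 = sets (\<Pi>\<^sub>M i\<in>I. borel)"
    and AE: "AE x in M1. \<forall>i\<in>I. x i \<in> {0..1}" "AE x in M2. \<forall>i\<in>I. x i \<in> {0..1}"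
    and moments: "\<And>k. (LINT x|M1. (\<Prod>i\<in>I. x i ^ k i)) = (LINT x|M2. (\<Prod>i\<in>I. x i ^ k i))"
  shows "M1 = M2"
proof (rule measure_eqI_PiM_ramp[OF I fin sets])
  fix c :: "'i \<Rightarrow> real" and m :: nat
  have "\<exists>a d. \<forall>y\<in>{0..1}. \<bar>ramp (c i) m y - (\<Sum>j\<le>d. a j * y ^ j)\<bar> < 1 / real (Suc n)" for i n
  proof -
    obtain g where "real_polynomial_function g" "\<And>y. y \<in> {0..1} \<Longrightarrow> \<bar>ramp (c i) m y - g y\<bar> < 1 / real (Suc n)"
      using Stone_Weierstrass_real_polynomial_function[of "{0..1}" "ramp (c i) m" "1 / real (Suc n)"]
        continuous_on_ramp by (auto simp del: of_nat_Suc)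
    moreover then obtain a d where "g = (\<lambda>x. \<Sum>i\<le>d. a i * x ^ i)"
      unfolding real_polynomial_function_iff_sum by blast
    ultimately show ?thesis by blast
  qed
  then obtain a d where ad: "\<And>i n y. y \<in> {0..1} \<Longrightarrow>
      \<bar>ramp (c i) m y - (\<Sum>j\<le>d i n. a i n j * y ^ j)\<bar> < 1 / real (Suc n)"
    by metis
  define p where "p i n y = (\<Sum>j\<le>d i n. a i n j * y ^ j)" for i n and y :: real
  \<comment> \<open>The ramp is bounded by 1 and the approximation error by
    \<open>1 / Suc n\<close>, hence by 1.\<close>
  have p_bound: "\<bar>p i n y\<bar> \<le> 2" if "y \<in> {0..1}" for i n y
  proof -
    have "1 / real (Suc n) \<le> 1" by simp
    then show ?thesis
      using ad[OF that, of i n] ramp_bounds(3)[of "c i" m y] unfolding p_def by linarith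
  qed
  have p_lim: "(\<lambda>n. p i n y) \<longlonglongrightarrow> ramp (c i) m y" if "y \<in> {0..1}" for i y
  proof (rule LIM_zero_cancel, rule Lim_transform_bound[OF _ LIMSEQ_inverse_real_of_nat])
    show "\<forall>\<^sub>F n in sequentially. norm (p i n y - ramp (c i) m y) \<le> norm (inverse (real (Suc n)))"
      using less_imp_le[OF ad[OF that, of i]] 
      by (intro always_eventually allI) (simp add: p_def abs_minus_commute inverse_eq_divide del: of_nat_Suc)
  qed
  have lim: "(\<lambda>n. LINT x|M. (\<Prod>i\<in>I. p i n (x i))) \<longlonglongrightarrow> (LINT x|M. (\<Prod>i\<in>I. ramp (c i) m (x i)))"
    if "finite_measure M" and s: "sets M = sets (\<Pi>\<^sub>M i\<in>I. borel)" and AE: "AE x in M. \<forall>i\<in>I. x i \<in> {0..1}" for M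
  proof (rule integral_dominated_convergence[where w = "\<lambda>_. 2 ^ card I"])
    interpret finite_measure M by fact
    show "integrable M (\<lambda>_. 2 ^ card I :: real)" by simp
    show "(\<lambda>x. \<Prod>i\<in>I. ramp (c i) m (x i)) \<in> borel_measurable M"
      unfolding measurable_cong_sets[OF s refl] by measurable
    show "(\<lambda>x. \<Prod>i\<in>I. p i n (x i)) \<in> borel_measurable M" for n
      unfolding measurable_cong_sets[OF s refl] p_def by measurable
    show "AE x in M. (\<lambda>n. \<Prod>i\<in>I. p i n (x i)) \<longlonglongrightarrow> (\<Prod>i\<in>I. ramp (c i) m (x i))"
      using AE by eventually_elim (auto intro!: tendsto_prod p_lim)
    show "AE x in M. norm (\<Prod>i\<in>I. p i n (x i)) \<le> 2 ^ card I" for n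
      using AE
    proof eventually_elim
      case (elim x)
      have "norm (\<Prod>i\<in>I. p i n (x i)) \<le> (\<Prod>i\<in>I. 2)"
        unfolding prod_norm[symmetric] using elim p_bound by (intro prod_mono) auto
      then show ?case by simp
    qed
  qed
  have "(LINT x|M1. (\<Prod>i\<in>I. p i n (x i))) = (LINT x|M2. (\<Prod>i\<in>I. p i n (x i)))" for n
    unfolding p_def by (simp add: moments_prod_polynomial[OF I fin(1) sets(1) AE(1)]
      moments_prod_polynomial[OF I fin(2) sets(2) AE(2)] moments)
  then show "(LINT x|M1. (\<Prod>i\<in>I. ramp (c i) m (x i))) = (LINT x|M2. (\<Prod>i\<in>I. ramp (c i) m (x i)))"
    using LIMSEQ_unique[OF lim[OF fin(1) sets(1) AE(1)]] lim[OF fin(2) sets(2) AE(2)] by simp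
qed

section \<open>The recursion for the Dirichlet moments\<close>

lemma mult_sum_fact_pochhammer:
  fixes a :: real
  shows "a * (\<Sum>m\<le>k. real (k choose m) * fact m * pochhammer a (k - m)) = pochhammer a (Suc k)"
proof (induction k)
  case (Suc k)
  \<comment> \<open>By the absorption identity the terms with positive index sum to
    \<open>Suc k\<close> times the sum for \<open>k\<close>. The term with index 0 is
    \<open>pochhammer a (Suc k)\<close>.\<close>
  have "real (Suc k choose Suc m) * fact (Suc m) = real (Suc k) * (real (k choose m) * fact m)" for m
  proof -
    have "real (Suc k choose Suc m) * real (Suc m) = real (Suc k) * real (k choose m)"
      unfolding of_nat_mult[symmetric] using Suc_times_binomial[of m k] by (simp only: mult.commute)
    then show ?thesis by (simp only: fact_Suc of_nat_mult mult.assoc[symmetric])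
  qed
  then have step: "real (Suc k choose Suc m) * fact (Suc m) * P = real (Suc k) * (real (k choose m) * fact m * P)" for m P
    by (simp only: mult.assoc)
  have "(\<Sum>m\<le>Suc k. real (Suc k choose m) * fact m * pochhammer a (Suc k - m)) =
      real (Suc k choose 0) * fact 0 * pochhammer a (Suc k - 0) +
      (\<Sum>m\<le>k. real (Suc k choose Suc m) * fact (Suc m) * pochhammer a (Suc k - Suc m))"
    by (rule sum.atMost_Suc_shift)
  also have "\<dots> = pochhammer a (Suc k) + real (Suc k) * (\<Sum>m\<le>k. real (k choose m) * fact m * pochhammer a (k - m))"
    by (simp only: step diff_Suc_Suc sum_distrib_left) simp
  finally have "(\<Sum>m\<le>Suc k. real (Suc k choose m) * fact m * pochhammer a (Suc k - m)) =
      pochhammer a (Suc k) + real (Suc k) * (\<Sum>m\<le>k. real (k choose m) * fact m * pochhammer a (k - m))" .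
  then have "a * (\<Sum>m\<le>Suc k. real (Suc k choose m) * fact m * pochhammer a (Suc k - m)) =
      a * pochhammer a (Suc k) + real (Suc k) * pochhammer a (Suc k)"
    by (simp only: distrib_left mult.left_commute[of a] Suc.IH)
  also have "\<dots> = pochhammer a (Suc (Suc k))"
    by (simp only: pochhammer_Suc[of a "Suc k"]) (simp add: algebra_simps)
  finally show ?case .
qed simp

text \<open>The mean of \<open>V^m * (1 - V)^l\<close> for \<open>V\<close> with the Beta(1, \<open>\<beta>\<close>) distribution.\<close>

definition stick_moment :: "real \<Rightarrow> nat \<Rightarrow> nat \<Rightarrow> real" where
  "stick_moment \<beta> m l = fact m * \<beta> * pochhammer \<beta> l / pochhammer \<beta> (Suc (m + l))"

definition dirichlet_moment :: "real \<Rightarrow> 'i set \<Rightarrow> ('i \<Rightarrow> real) \<Rightarrow> ('i \<Rightarrow> nat) \<Rightarrow> real" where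
  "dirichlet_moment \<beta> I p k = (\<Prod>i\<in>I. pochhammer (\<beta> * p i) (k i)) / pochhammer \<beta> (\<Sum>i\<in>I. k i)"

lemma sum_fun_upd_diff:
  fixes k :: "'i \<Rightarrow> nat"
  assumes "finite I" "j \<in> I" "m \<le> k j"
  shows "(\<Sum>i\<in>I. (k(j := k j - m)) i) = (\<Sum>i\<in>I. k i) - m" "m \<le> (\<Sum>i\<in>I. k i)"
proof -
  have "(\<Sum>i\<in>I. (k(j := k j - m)) i) = k j - m + (\<Sum>i\<in>I - {j}. k i)"
    by (subst sum.remove[OF assms(1,2)]) (auto intro!: sum.cong)
  moreover have "(\<Sum>i\<in>I. k i) = k j + (\<Sum>i\<in>I - {j}. k i)"
    using assms by (subst sum.remove[OF assms(1,2)]) auto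
  ultimately show "(\<Sum>i\<in>I. (k(j := k j - m)) i) = (\<Sum>i\<in>I. k i) - m" "m \<le> (\<Sum>i\<in>I. k i)"
    using assms(3) by auto
qed

text \<open>The recursion conditions on the first atom: it lies in cell \<open>j\<close> with
  probability \<open>p j\<close>, and \<open>m\<close> counts the factors of the \<open>j\<close>-th
  power that take its mass. In each term the Pochhammer symbol of \<open>n - m\<close> cancels
  between the stick moment and the Dirichlet moment; the sum over \<open>m\<close> is then given by
  \<open>mult_sum_fact_pochhammer\<close>. Cell \<open>j\<close> contributes the share
  \<open>\<beta> * p j + k j\<close> of the total \<open>\<beta> + n\<close>.\<close>

lemma dirichlet_moment_recursion:
  assumes \<beta>: "\<beta> > 0" and I: "finite I" and p: "(\<Sum>i\<in>I. p i) = 1"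
  shows "dirichlet_moment \<beta> I p k =
    (\<Sum>j\<in>I. p j * (\<Sum>m\<le>k j. real (k j choose m) * stick_moment \<beta> m ((\<Sum>i\<in>I. k i) - m) *
       dirichlet_moment \<beta> I p (k(j := k j - m))))"
proof -
  define n where "n = (\<Sum>i\<in>I. k i)"
  have poch: "pochhammer \<beta> l > 0" for l using \<beta> by (rule pochhammer_pos)
  have "p j * (\<Sum>m\<le>k j. real (k j choose m) * stick_moment \<beta> m (n - m) *
       dirichlet_moment \<beta> I p (k(j := k j - m))) =
     (\<beta> * p j + k j) * ((\<Prod>i\<in>I. pochhammer (\<beta> * p i) (k i)) / pochhammer \<beta> (Suc n))" if j: "j \<in> I" for j
  proof -
    have "real (k j choose m) * stick_moment \<beta> m (n - m) * dirichlet_moment \<beta> I p (k(j := k j - m)) =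
       real (k j choose m) * fact m * pochhammer (\<beta> * p j) (k j - m) *
       (\<beta> * (\<Prod>i\<in>I - {j}. pochhammer (\<beta> * p i) (k i)) / pochhammer \<beta> (Suc n))"
      if m: "m \<le> k j" for m
    proof -
      have "(\<Prod>i\<in>I. pochhammer (\<beta> * p i) ((k(j := k j - m)) i)) =
          pochhammer (\<beta> * p j) (k j - m) * (\<Prod>i\<in>I - {j}. pochhammer (\<beta> * p i) (k i))"
        by (subst prod.remove[OF I j]) (auto intro!: prod.cong)
      moreover have "m + (n - m) = n" using sum_fun_upd_diff[where k = k, OF I j m] by (simp add: n_def)
      ultimately show ?thesis
        using poch[of "n - m"]
        unfolding stick_moment_def dirichlet_moment_def sum_fun_upd_diff(1)[where k = k, OF I j m] n_def[symmetric]
        by (simp add: field_simps)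
    qed
    then have "(\<Sum>m\<le>k j. real (k j choose m) * stick_moment \<beta> m (n - m) * dirichlet_moment \<beta> I p (k(j := k j - m))) =
       (\<Sum>m\<le>k j. real (k j choose m) * fact m * pochhammer (\<beta> * p j) (k j - m)) *
       (\<beta> * (\<Prod>i\<in>I - {j}. pochhammer (\<beta> * p i) (k i)) / pochhammer \<beta> (Suc n))"
      unfolding sum_distrib_right by (intro sum.cong) auto
    then have "p j * (\<Sum>m\<le>k j. real (k j choose m) * stick_moment \<beta> m (n - m) *
       dirichlet_moment \<beta> I p (k(j := k j - m))) =
       ((\<beta> * p j) * (\<Sum>m\<le>k j. real (k j choose m) * fact m * pochhammer (\<beta> * p j) (k j - m))) *
       ((\<Prod>i\<in>I - {j}. pochhammer (\<beta> * p i) (k i)) / pochhammer \<beta> (Suc n))"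
      by simp
    also have "\<dots> = (\<beta> * p j + k j) * ((pochhammer (\<beta> * p j) (k j) * (\<Prod>i\<in>I - {j}. pochhammer (\<beta> * p i) (k i))) / pochhammer \<beta> (Suc n))"
      unfolding mult_sum_fact_pochhammer pochhammer_Suc[of "\<beta> * p j"] by simp
    also have "pochhammer (\<beta> * p j) (k j) * (\<Prod>i\<in>I - {j}. pochhammer (\<beta> * p i) (k i)) = (\<Prod>i\<in>I. pochhammer (\<beta> * p i) (k i))"
      by (rule prod.remove[OF I j, symmetric])
    finally show ?thesis .
  qed
  then have "(\<Sum>j\<in>I. p j * (\<Sum>m\<le>k j. real (k j choose m) * stick_moment \<beta> m (n - m) *
       dirichlet_moment \<beta> I p (k(j := k j - m)))) =
     (\<Sum>j\<in>I. \<beta> * p j + k j) * ((\<Prod>i\<in>I. pochhammer (\<beta> * p i) (k i)) / pochhammer \<beta> (Suc n))"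
    unfolding sum_distrib_right by (intro sum.cong) auto
  also have "(\<Sum>j\<in>I. \<beta> * p j + k j) = \<beta> + n"
    by (simp add: sum.distrib sum_distrib_left[symmetric] p n_def)
  also have "(\<beta> + n) * ((\<Prod>i\<in>I. pochhammer (\<beta> * p i) (k i)) / pochhammer \<beta> (Suc n)) = dirichlet_moment \<beta> I p k"
    unfolding dirichlet_moment_def n_def[symmetric] pochhammer_Suc using \<beta> by (simp add: add_pos_nonneg less_imp_neq[symmetric])
  finally show ?thesis unfolding n_def by (rule sym)
qed

text \<open>The term with \<open>m = 0\<close> has coefficient \<open>\<beta> / (\<beta> + n) < 1\<close>, so the recursion determines
  the moments of positive degree.\<close>

lemma moment_recursion_unique:
  assumes \<beta>: "\<beta> > 0" and I: "finite I" and p: "(\<Sum>i\<in>I. p i) = 1"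
    and M0: "\<And>k. (\<Sum>i\<in>I. k i) = 0 \<Longrightarrow> M k = 1"
    and M: "\<And>k. M k = (\<Sum>j\<in>I. p j * (\<Sum>m\<le>k j. real (k j choose m) * stick_moment \<beta> m ((\<Sum>i\<in>I. k i) - m) * M (k(j := k j - m))))"
  shows "M k = dirichlet_moment \<beta> I p k"
proof (induction "\<Sum>i\<in>I. k i" arbitrary: k rule: less_induct)
  case less
  define n where "n = (\<Sum>i\<in>I. k i)"
  show ?case
  proof (cases "n = 0")
    case True
    then have "\<forall>i\<in>I. k i = 0" using I by (simp add: n_def)
    then show ?thesis using M0[of k] True by (simp add: dirichlet_moment_def n_def)
  next
    case False
    let ?T = "dirichlet_moment \<beta> I p"
    \<comment> \<open>The recursion is linear, so the difference of two solutions satisfies it as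
      well. By induction on the degree only the terms with \<open>m = 0\<close> survive, and these
      contain the moment for \<open>k\<close> itself.\<close>
    have "M k - ?T k = (\<Sum>j\<in>I. p j * (\<Sum>m\<le>k j. real (k j choose m) * stick_moment \<beta> m (n - m) * (M (k(j := k j - m)) - ?T (k(j := k j - m)))))"
      by (subst M, subst dirichlet_moment_recursion[OF \<beta> I p])
         (simp add: n_def right_diff_distrib sum_subtractf)
    also have "\<dots> = (\<Sum>j\<in>I. p j * (stick_moment \<beta> 0 n * (M k - ?T k)))"
    proof (intro sum.cong refl arg_cong2[where f = "(*)"])
      fix j assume j: "j \<in> I"
      have "M (k(j := k j - m)) = ?T (k(j := k j - m))" if "m \<le> k j" "m \<noteq> 0" for m
        using sum_fun_upd_diff[where k = k, OF I j that(1)] that(2) False by (intro less) (auto simp: n_def)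
      then have "(\<Sum>m\<le>k j. real (k j choose m) * stick_moment \<beta> m (n - m) * (M (k(j := k j - m)) - ?T (k(j := k j - m)))) =
         (\<Sum>m\<in>{0}. real (k j choose m) * stick_moment \<beta> m (n - m) * (M (k(j := k j - m)) - ?T (k(j := k j - m))))"
        by (intro sum.mono_neutral_right) auto
      then show "(\<Sum>m\<le>k j. real (k j choose m) * stick_moment \<beta> m (n - m) * (M (k(j := k j - m)) - ?T (k(j := k j - m)))) =
         stick_moment \<beta> 0 n * (M k - ?T k)" by simp
    qed
    also have "\<dots> = stick_moment \<beta> 0 n * (M k - ?T k)"
      by (simp add: sum_distrib_right[symmetric] p)
    finally have "(1 - stick_moment \<beta> 0 n) * (M k - ?T k) = 0" by (simp add: algebra_simps)
    moreover have "stick_moment \<beta> 0 n < 1"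
    proof -
      have "stick_moment \<beta> 0 n = \<beta> / (\<beta> + n)"
        using pochhammer_pos[OF \<beta>, of n] by (simp add: stick_moment_def pochhammer_Suc)
      also have "\<dots> < 1" using \<beta> False by simp
      finally show ?thesis .
    qed
    ultimately show ?thesis by simp
  qed
qed

section \<open>The stick-breaking process\<close>

definition clamp01 :: "real \<Rightarrow> real" where
  "clamp01 x = max 0 (min 1 x)"

lemma clamp01_bounds: "0 \<le> clamp01 x" "clamp01 x \<le> 1"
  by (auto simp: clamp01_def)

lemma clamp01_id: "x \<in> {0..1} \<Longrightarrow> clamp01 x = x"
  by (auto simp: clamp01_def)

lemma measurable_clamp01 [measurable]: "clamp01 \<in> borel_measurable borel"
  unfolding clamp01_def by measurable

text \<open>An entry of the stream is a pair of a stick and a position. Clamping the stick makes the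
  bounds on the weights hold for every stream, so that no exceptional null set has to be carried
  along.\<close>

definition stick_weight :: "(real \<times> real) stream \<Rightarrow> nat \<Rightarrow> real" where
  "stick_weight \<omega> k = clamp01 (fst (\<omega> !! k)) * (\<Prod>j<k. 1 - clamp01 (fst (\<omega> !! j)))"

definition stick_mass :: "real set \<Rightarrow> (real \<times> real) stream \<Rightarrow> real" where
  "stick_mass B \<omega> = (\<Sum>k. stick_weight \<omega> k * indicator B (snd (\<omega> !! k)))"

lemma stick_weight_nonneg: "stick_weight \<omega> k \<ge> 0"
  unfolding stick_weight_def by (intro mult_nonneg_nonneg prod_nonneg) (auto simp: clamp01_bounds)

lemma sum_stick_weight: "(\<Sum>k<n. stick_weight \<omega> k) = 1 - (\<Prod>j<n. 1 - clamp01 (fst (\<omega> !! j)))"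
  by (induction n) (auto simp: stick_weight_def algebra_simps)

lemma sum_stick_weight_le: "(\<Sum>k<n. stick_weight \<omega> k) \<le> 1"
  unfolding sum_stick_weight by (auto intro!: prod_nonneg simp: clamp01_bounds)

lemma summable_stick_weight: "summable (stick_weight \<omega>)"
  by (rule summableI_nonneg_bounded[where x = 1]) (auto simp: stick_weight_nonneg sum_stick_weight_le)

lemma summable_stick_mass: "summable (\<lambda>k. stick_weight \<omega> k * indicator B (snd (\<omega> !! k)))"
  by (rule summable_comparison_test'[OF summable_stick_weight[of \<omega>]])
     (auto simp: stick_weight_nonneg indicator_def)

lemma stick_mass_nonneg: "stick_mass B \<omega> \<ge> 0"
  unfolding stick_mass_def by (intro suminf_nonneg summable_stick_mass) (auto simp: stick_weight_nonneg)

lemma stick_mass_mono: "A \<subseteq> B \<Longrightarrow> stick_mass A \<omega> \<le> stick_mass B \<omega>"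
  unfolding stick_mass_def
  by (intro suminf_le summable_stick_mass mult_left_mono stick_weight_nonneg) (auto simp: indicator_def)

lemma stick_mass_le_1: "stick_mass B \<omega> \<le> 1"
proof -
  have "stick_mass B \<omega> \<le> stick_mass UNIV \<omega>" by (rule stick_mass_mono) auto
  also have "\<dots> = suminf (stick_weight \<omega>)" by (simp add: stick_mass_def)
  also have "\<dots> \<le> 1" by (rule suminf_le_const[OF summable_stick_weight sum_stick_weight_le])
  finally show ?thesis .
qed

lemma stick_mass_disjoint_Un:
  assumes "A \<inter> B = {}"
  shows "stick_mass (A \<union> B) \<omega> = stick_mass A \<omega> + stick_mass B \<omega>"
  unfolding stick_mass_def
  by (subst suminf_add[OF summable_stick_mass summable_stick_mass])
     (use assms in \<open>auto simp: indicator_def intro!: suminf_cong\<close>)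

text \<open>The distributional fixed point equation of the Dirichlet process in pathwise form:
  prepending an entry shifts the weights by one place and multiplies them by the rest that the new
  stick leaves.\<close>

lemma stick_mass_Stream:
  "stick_mass B (x ## \<omega>) = clamp01 (fst x) * indicator B (snd x) + (1 - clamp01 (fst x)) * stick_mass B \<omega>"
proof -
  have w: "stick_weight (x ## \<omega>) (Suc k) = (1 - clamp01 (fst x)) * stick_weight \<omega> k" for k
    by (simp add: stick_weight_def prod.lessThan_Suc_shift del: prod.lessThan_Suc)
  have "stick_mass B (x ## \<omega>) = stick_weight (x ## \<omega>) 0 * indicator B (snd x) +
      (\<Sum>k. (1 - clamp01 (fst x)) * (stick_weight \<omega> k * indicator B (snd (\<omega> !! k))))"
    using suminf_split_head[OF summable_stick_mass[of "x ## \<omega>" B]]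
    unfolding stick_mass_def by (simp add: w mult.assoc)
  then show ?thesis
    using suminf_mult[OF summable_stick_mass[of \<omega> B]] by (simp add: stick_mass_def stick_weight_def)
qed

text \<open>\<open>pos_powr 1\<close> is the indicator of the positive half line, so this is Beta(1,
  \<open>\<beta>\<close>), with density \<open>\<beta> * (1 - v) powr (\<beta> - 1)\<close> on the
  open unit interval.\<close>

definition stick :: "real \<Rightarrow> real measure" where
  "stick \<beta> = density lborel (\<lambda>v. ennreal (\<beta> * (pos_powr 1 v * pos_powr \<beta> (1 - v))))"

definition stick_base :: "real \<Rightarrow> (real \<times> real) measure" where
  "stick_base \<beta> = stick \<beta> \<Otimes>\<^sub>M uniform_measure lborel {0<..1}"

lemma sets_stick [measurable_cong]: "sets (stick \<beta>) = sets borel"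
  by (simp add: stick_def)

lemma sets_stick_base [measurable_cong]: "sets (stick_base \<beta>) = sets (borel \<Otimes>\<^sub>M borel)"
  unfolding stick_base_def by (intro sets_pair_measure_cong) (auto simp: sets_stick)

lemma measurable_stick_mass [measurable]:
  assumes [measurable]: "B \<in> sets borel"
  shows "stick_mass B \<in> borel_measurable (stream_space (stick_base \<beta>))"
proof -
  have [measurable]: "(\<lambda>\<omega>. \<omega> !! k) \<in> measurable (stream_space (stick_base \<beta>)) (borel \<Otimes>\<^sub>M borel)" for k
    using measurable_snth[of k "stick_base \<beta>"] by (simp add: measurable_cong_sets[OF refl sets_stick_base])
  show ?thesis
    unfolding stick_mass_def stick_weight_def by measurable
qed

lemma nn_integral_stick_moment:
  assumes \<beta>: "\<beta> > 0"
  shows "(\<integral>\<^sup>+v. ennreal (clamp01 v ^ m * (1 - clamp01 v) ^ l) \<partial>stick \<beta>) = ennreal (stick_moment \<beta> m l)"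
proof -
  have "(\<integral>\<^sup>+v. ennreal (clamp01 v ^ m * (1 - clamp01 v) ^ l) \<partial>stick \<beta>) =
     (\<integral>\<^sup>+v. ennreal \<beta> * ennreal (pos_powr (1 + m) v * pos_powr (\<beta> + l) (1 - v)) \<partial>lborel)"
    unfolding stick_def
  proof (subst nn_integral_density, measurable, intro nn_integral_cong)
    fix v :: real
    have "\<beta> * (pos_powr 1 v * pos_powr \<beta> (1 - v)) * (clamp01 v ^ m * (1 - clamp01 v) ^ l) =
      \<beta> * (pos_powr (1 + m) v * pos_powr (\<beta> + l) (1 - v))"
      by (auto simp: pos_powr_def clamp01_id powr_realpow powr_add powr_diff)
    then show "ennreal (\<beta> * (pos_powr 1 v * pos_powr \<beta> (1 - v))) * ennreal (clamp01 v ^ m * (1 - clamp01 v) ^ l) =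
       ennreal \<beta> * ennreal (pos_powr (1 + m) v * pos_powr (\<beta> + l) (1 - v))"
      using \<beta> by (subst (1 2) ennreal_mult'[symmetric]) (auto simp: clamp01_bounds)
  qed
  also have "\<dots> = ennreal \<beta> * ennreal (Beta (1 + m) (\<beta> + l))"
    using \<beta> pos_powr_convolution[of "1 + m" "\<beta> + l" 1]
    by (subst nn_integral_cmult) (auto simp: pos_powr_def[of _ 1] add_pos_nonneg)
  also have "\<dots> = ennreal (stick_moment \<beta> m l)"
  proof -
    have "Gamma (1 + real m) = fact m" by (simp add: Gamma_fact)
    moreover have "pochhammer \<beta> l = Gamma (\<beta> + l) / Gamma \<beta>" 
      "pochhammer \<beta> (Suc (m + l)) = Gamma (\<beta> + Suc (m + l)) / Gamma \<beta>"
      using \<beta> by (subst pochhammer_Gamma; auto elim!: nonpos_Ints_cases)+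
    moreover have "Gamma \<beta> > 0" using \<beta> by (rule Gamma_real_pos)
    moreover have "1 + real m + (\<beta> + real l) = \<beta> + Suc (m + l)" by simp
    ultimately have "\<beta> * Beta (1 + m) (\<beta> + l) = stick_moment \<beta> m l"
      unfolding Beta_def stick_moment_def by (simp add: ac_simps)
    then show ?thesis using \<beta> by (simp add: ennreal_mult'[symmetric])
  qed
  finally show ?thesis .
qed

lemma stick_moment_nonneg: "\<beta> > 0 \<Longrightarrow> stick_moment \<beta> m l \<ge> 0"
  unfolding stick_moment_def
  by (intro divide_nonneg_nonneg mult_nonneg_nonneg less_imp_le[OF pochhammer_pos]) auto

lemma prob_space_stick: "\<beta> > 0 \<Longrightarrow> prob_space (stick \<beta>)"
  using nn_integral_stick_moment[of \<beta> 0 0] pochhammer_pos[of \<beta> 0]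
  by (intro prob_spaceI) (simp add: stick_moment_def)

lemma integral_stick_moment:
  "\<beta> > 0 \<Longrightarrow> (LINT v|stick \<beta>. clamp01 v ^ m * (1 - clamp01 v) ^ l) = stick_moment \<beta> m l"
  by (rule integral_eq_nn_integral[THEN trans])
     (auto simp: nn_integral_stick_moment stick_moment_nonneg clamp01_bounds intro!: AE_I2)

lemma prob_space_unif: "prob_space (uniform_measure lborel {0<..(1::real)})"
  by (rule prob_space_uniform_measure) auto

lemma prob_space_stick_base:
  assumes "\<beta> > 0" shows "prob_space (stick_base \<beta>)"
proof -
  interpret A: prob_space "stick \<beta>" using assms by (rule prob_space_stick)
  interpret B: prob_space "uniform_measure lborel {0<..(1::real)}" by (rule prob_space_unif)
  interpret pair_prob_space "stick \<beta>" "uniform_measure lborel {0<..(1::real)}" ..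
  show ?thesis unfolding stick_base_def by (rule prob_space_axioms)
qed

lemma integral_stick_base_prod:
  assumes \<beta>: "\<beta> > 0" and [measurable]: "B \<in> sets borel" and "B \<subseteq> {0<..1}"
  shows "(LINT x|stick_base \<beta>. clamp01 (fst x) ^ m * (1 - clamp01 (fst x)) ^ l * indicator B (snd x)) =
     stick_moment \<beta> m l * measure lborel B"
proof -
  interpret A: prob_space "stick \<beta>" using \<beta> by (rule prob_space_stick)
  interpret B: prob_space "uniform_measure lborel {0<..(1::real)}" by (rule prob_space_unif)
  interpret pair_prob_space "stick \<beta>" "uniform_measure lborel {0<..(1::real)}" ..
  let ?f = "\<lambda>x. clamp01 (fst x) ^ m * (1 - clamp01 (fst x)) ^ l * (indicator B (snd x) :: real)"
  have "integrable (stick \<beta> \<Otimes>\<^sub>M uniform_measure lborel {0<..(1::real)}) ?f"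
  proof (rule integrable_const_bound[where B = 1])
    show "AE x in stick \<beta> \<Otimes>\<^sub>M uniform_measure lborel {0<..(1::real)}. norm (?f x) \<le> 1"
      by (intro AE_I2) (auto simp: indicator_def clamp01_bounds abs_mult power_abs intro!: mult_le_one power_le_one)
  qed measurable
  from integral_fst'[OF this]
  have "(LINT x|stick_base \<beta>. ?f x) = (LINT v|stick \<beta>. clamp01 v ^ m * (1 - clamp01 v) ^ l *
      measure (uniform_measure lborel {0<..(1::real)}) B)"
    by (simp add: stick_base_def)
  also have "measure (uniform_measure lborel {0<..(1::real)}) B = measure lborel B"
  proof -
    have "{0<..1} \<inter> B = B" using assms(3) by auto
    then show ?thesis by (subst measure_uniform_measure) auto
  qed
  finally show ?thesis by (simp add: integral_stick_moment[OF \<beta>])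
qed

text \<open>A stream of independent entries is a first entry followed by an independent stream with
  the same law. The bounds 0 and 1 make everything integrable, so the identity passes from
  nonnegative integrals to Bochner integrals.\<close>

lemma (in prob_space) integral_stream_space:
  fixes f :: "'a stream \<Rightarrow> real"
  assumes [measurable]: "f \<in> borel_measurable (stream_space M)" and f: "\<And>\<omega>. 0 \<le> f \<omega>" "\<And>\<omega>. f \<omega> \<le> 1"
  shows "(LINT \<omega>|stream_space M. f \<omega>) = (LINT x|M. LINT \<omega>|stream_space M. f (x ## \<omega>))"
proof -
  interpret S: prob_space "stream_space M" by (rule prob_space_stream_space)
  have int: "integrable (stream_space M) (\<lambda>\<omega>. f (x ## \<omega>))" if [measurable]: "x \<in> space M" for x
    by (rule finite_measure.integrable_const_bound[OF S.finite_measure_axioms, where B = 1])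
       (use f in \<open>auto intro!: AE_I2\<close>)
  have [measurable]: "(\<lambda>x. LINT \<omega>|stream_space M. f (x ## \<omega>)) \<in> borel_measurable M"
    by (rule S.borel_measurable_lebesgue_integral) measurable
  have "ennreal (LINT \<omega>|stream_space M. f \<omega>) = (\<integral>\<^sup>+\<omega>. ennreal (f \<omega>) \<partial>stream_space M)"
    by (rule nn_integral_eq_integral[symmetric])
       (use f in \<open>auto intro!: AE_I2 finite_measure.integrable_const_bound[OF S.finite_measure_axioms, where B = 1]\<close>)
  also have "\<dots> = (\<integral>\<^sup>+x. (\<integral>\<^sup>+\<omega>. ennreal (f (x ## \<omega>)) \<partial>stream_space M) \<partial>M)"
    by (rule nn_integral_stream_space) measurable
  also have "\<dots> = (\<integral>\<^sup>+x. ennreal (LINT \<omega>|stream_space M. f (x ## \<omega>)) \<partial>M)"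
    by (intro nn_integral_cong nn_integral_eq_integral int AE_I2 f)
  also have "\<dots> = ennreal (LINT x|M. LINT \<omega>|stream_space M. f (x ## \<omega>))"
  proof (rule nn_integral_eq_integral)
    show "integrable M (\<lambda>x. LINT \<omega>|stream_space M. f (x ## \<omega>))"
    proof (rule integrable_const_bound[where B = 1])
      show "AE x in M. norm (LINT \<omega>|stream_space M. f (x ## \<omega>)) \<le> 1"
      proof (rule AE_I2)
        fix x assume "x \<in> space M"
        then show "norm (LINT \<omega>|stream_space M. f (x ## \<omega>)) \<le> 1"
          using S.integral_le_const[OF int, of x 1] f by (auto intro!: AE_I2 integral_nonneg_AE simp: abs_le_iff)
      qed
    qed measurable
  qed (auto intro!: AE_I2 integral_nonneg_AE f)
  finally show ?thesis
    using f by (subst (asm) ennreal_inj) (auto intro!: integral_nonneg_AE AE_I2)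
qed

text \<open>By disjointness the first atom lies in the cell \<open>j\<close> alone. All masses are
  scaled by \<open>1 - V\<close>, and the \<open>j\<close>-th one gains \<open>V\<close>. Expanding
  its power, \<open>m\<close> factors take \<open>V\<close> and the remaining factors of the whole
  monomial take \<open>1 - V\<close>, which explains the exponent of total degree minus
  \<open>m\<close>.\<close>

lemma prod_stick_mass_Stream:
  assumes I: "finite I" and j: "j \<in> I" and disj: "disjoint_family_on B I" and u: "snd x \<in> B j"
  shows "(\<Prod>i\<in>I. stick_mass (B i) (x ## \<omega>) ^ k i) =
    (\<Sum>m\<le>k j. (real (k j choose m) * (clamp01 (fst x) ^ m * (1 - clamp01 (fst x)) ^ ((\<Sum>i\<in>I. k i) - m))) *
       (\<Prod>i\<in>I. stick_mass (B i) \<omega> ^ (k(j := k j - m)) i))"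
proof -
  define v where "v = clamp01 (fst x)"
  define Y where "Y i = stick_mass (B i) \<omega>" for i
  have notin: "snd x \<notin> B i" if "i \<in> I" "i \<noteq> j" for i
    using disj that j u by (auto simp: disjoint_family_on_def)
  have n: "(\<Sum>i\<in>I. k i) = k j + (\<Sum>i\<in>I - {j}. k i)"
    by (rule sum.remove[OF I j])
  have "(\<Prod>i\<in>I. stick_mass (B i) (x ## \<omega>) ^ k i) =
     (v + (1 - v) * Y j) ^ k j * (\<Prod>i\<in>I - {j}. ((1 - v) * Y i) ^ k i)"
    using u notin
    by (subst prod.remove[OF I j]) (auto simp: stick_mass_Stream v_def Y_def intro!: prod.cong)
  also have "(\<Prod>i\<in>I - {j}. ((1 - v) * Y i) ^ k i) = (1 - v) ^ (\<Sum>i\<in>I - {j}. k i) * (\<Prod>i\<in>I - {j}. Y i ^ k i)"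
    by (simp add: power_mult_distrib prod.distrib power_sum)
  also have "(v + (1 - v) * Y j) ^ k j * \<dots> = (\<Sum>m\<le>k j. (real (k j choose m) * (v ^ m * (1 - v) ^ ((\<Sum>i\<in>I. k i) - m))) *
       (\<Prod>i\<in>I. Y i ^ (k(j := k j - m)) i))"
    unfolding binomial_ring sum_distrib_right
  proof (intro sum.cong refl)
    fix m assume "m \<in> {..k j}"
    then have "(\<Sum>i\<in>I. k i) - m = (k j - m) + (\<Sum>i\<in>I - {j}. k i)" using n by simp
    moreover have "(\<Prod>i\<in>I. Y i ^ (k(j := k j - m)) i) = Y j ^ (k j - m) * (\<Prod>i\<in>I - {j}. Y i ^ k i)"
      by (subst prod.remove[OF I j]) (auto intro!: prod.cong)
    ultimately show "of_nat (k j choose m) * v ^ m * ((1 - v) * Y j) ^ (k j - m) *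
        ((1 - v) ^ (\<Sum>i\<in>I - {j}. k i) * (\<Prod>i\<in>I - {j}. Y i ^ k i)) =
      real (k j choose m) * (v ^ m * (1 - v) ^ ((\<Sum>i\<in>I. k i) - m)) * (\<Prod>i\<in>I. Y i ^ (k(j := k j - m)) i)"
      by (simp add: power_add power_mult_distrib)
  qed
  finally show ?thesis by (simp add: v_def Y_def)
qed

text \<open>Sethuraman's argument: removing the first stick reproduces the process, which turns into the
  recursion for the moments of the Dirichlet distribution.\<close>

lemma integral_prod_stick_mass:
  assumes \<beta>: "\<beta> > 0" and I: "finite I" and disj: "disjoint_family_on B I"
    and B: "\<And>i. i \<in> I \<Longrightarrow> B i \<in> sets borel" and cover: "(\<Union>i\<in>I. B i) = {0<..1}"
  shows "(LINT \<omega>|stream_space (stick_base \<beta>). (\<Prod>i\<in>I. stick_mass (B i) \<omega> ^ k i)) =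
     dirichlet_moment \<beta> I (\<lambda>i. measure lborel (B i)) k"
proof (rule moment_recursion_unique[where M = "\<lambda>k. LINT \<omega>|stream_space (stick_base \<beta>). (\<Prod>i\<in>I. stick_mass (B i) \<omega> ^ k i)", OF \<beta> I])
  interpret base: prob_space "stick_base \<beta>" using \<beta> by (rule prob_space_stick_base)
  interpret S: prob_space "stream_space (stick_base \<beta>)" by (rule base.prob_space_stream_space)
  note [measurable] = B
  have Bsub: "B i \<subseteq> {0<..1}" if "i \<in> I" for i using cover that by auto
  show "(\<Sum>i\<in>I. measure lborel (B i)) = 1"
  proof -
    have fin: "emeasure lborel (B i) \<noteq> \<infinity>" if "i \<in> I" for i
      using emeasure_mono[OF Bsub[OF that], of lborel] by (auto simp: top_unique)
    have "(\<Sum>i\<in>I. measure lborel (B i)) = measure lborel (\<Union>i\<in>I. B i)"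
      by (rule measure_finite_Union[symmetric]) (use I disj B fin in auto)
    then show ?thesis by (simp add: cover)
  qed
  fix k :: "'a \<Rightarrow> nat"
  define M where "M k = (LINT \<omega>|stream_space (stick_base \<beta>). (\<Prod>i\<in>I. stick_mass (B i) \<omega> ^ k i))" for k
  define n where "n = (\<Sum>i\<in>I. k i)"
  show "M k = 1" if "(\<Sum>i\<in>I. k i) = 0"
    using that I by (simp add: M_def S.prob_space)
  have meas: "(\<lambda>\<omega>. \<Prod>i\<in>I. stick_mass (B i) \<omega> ^ k i) \<in> borel_measurable (stream_space (stick_base \<beta>))" for k
    by (intro borel_measurable_prod borel_measurable_power measurable_stick_mass B)
  have bounds: "0 \<le> (\<Prod>i\<in>I. stick_mass (B i) \<omega> ^ k i)" "(\<Prod>i\<in>I. stick_mass (B i) \<omega> ^ k i) \<le> 1" for k \<omega>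
    by (auto intro!: prod_nonneg prod_le_1 power_le_one simp: stick_mass_nonneg stick_mass_le_1)
  have int: "integrable (stream_space (stick_base \<beta>)) (\<lambda>\<omega>. \<Prod>i\<in>I. stick_mass (B i) \<omega> ^ k i)" for k
    by (rule S.integrable_const_bound[where B = 1]) (auto intro!: AE_I2 meas simp: bounds)
  let ?b = "\<lambda>m x. clamp01 (fst x) ^ m * (1 - clamp01 (fst x)) ^ (n - m)"
  \<comment> \<open>Off this event no cell contains the position. On it, the indicators in the sum
    over all cells select exactly one, and every term splits into a moment of the rest and a
    function of the first entry.\<close>
  have "AE x in stick_base \<beta>. snd x \<in> {0<..1}"
  proof (subst AE_iff_measurable)
    interpret A: prob_space "stick \<beta>" using \<beta> by (rule prob_space_stick)
    interpret U: prob_space "uniform_measure lborel {0<..(1::real)}" by (rule prob_space_unif)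
    show "emeasure (stick_base \<beta>) (UNIV \<times> - {0<..1}) = 0"
      unfolding stick_base_def
      by (subst U.emeasure_pair_measure_Times) (auto simp: emeasure_uniform_measure sets_stick)
  qed (auto simp: stick_base_def space_pair_measure stick_def)
  then have AE: "AE x in stick_base \<beta>. (LINT \<omega>|stream_space (stick_base \<beta>). (\<Prod>i\<in>I. stick_mass (B i) (x ## \<omega>) ^ k i)) =
     (\<Sum>j\<in>I. \<Sum>m\<le>k j. (real (k j choose m) * M (k(j := k j - m))) * (?b m x * indicator (B j) (snd x)))"
  proof eventually_elim
    case (elim x)
    then obtain j where j: "j \<in> I" "snd x \<in> B j" using cover by blast
    have "(\<Sum>i\<in>I. \<Sum>m\<le>k i. (real (k i choose m) * M (k(i := k i - m))) * (?b m x * indicator (B i) (snd x))) =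
       (\<Sum>i\<in>{j}. \<Sum>m\<le>k i. (real (k i choose m) * M (k(i := k i - m))) * (?b m x * indicator (B i) (snd x)))"
    proof (rule sum.mono_neutral_right)
      show "\<forall>i\<in>I - {j}. (\<Sum>m\<le>k i. (real (k i choose m) * M (k(i := k i - m))) * (?b m x * indicator (B i) (snd x))) = 0"
        using disj j by (auto simp: disjoint_family_on_def indicator_def)
    qed (use I j in auto)
    also have "\<dots> = (\<Sum>m\<le>k j. (real (k j choose m) * ?b m x) * M (k(j := k j - m)))"
      using j by (simp add: ac_simps)
    also have "\<dots> = (LINT \<omega>|stream_space (stick_base \<beta>). (\<Prod>i\<in>I. stick_mass (B i) (x ## \<omega>) ^ k i))"
      unfolding prod_stick_mass_Stream[OF I j(1) disj j(2)] M_def n_def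
      using int by (subst Bochner_Integration.integral_sum) auto
    finally show ?case by simp
  qed
  have int_b: "integrable (stick_base \<beta>) (\<lambda>x. ?b m x * indicator (B j) (snd x))" if [simp]: "j \<in> I" for m j
    by (rule base.integrable_const_bound[where B = 1])
       (auto intro!: AE_I2 mult_le_one power_le_one simp: indicator_def clamp01_bounds abs_mult power_abs)
  have "M k = (LINT x|stick_base \<beta>. LINT \<omega>|stream_space (stick_base \<beta>). (\<Prod>i\<in>I. stick_mass (B i) (x ## \<omega>) ^ k i))"
    unfolding M_def by (rule base.integral_stream_space) (auto simp: bounds meas)
  also have "\<dots> = (LINT x|stick_base \<beta>. (\<Sum>j\<in>I. \<Sum>m\<le>k j. (real (k j choose m) * M (k(j := k j - m))) * (?b m x * indicator (B j) (snd x))))"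
  proof (rule integral_cong_AE[OF _ _ AE])
    show "(\<lambda>x. LINT \<omega>|stream_space (stick_base \<beta>). (\<Prod>i\<in>I. stick_mass (B i) (x ## \<omega>) ^ k i)) \<in> borel_measurable (stick_base \<beta>)"
      using meas[of k] by (intro S.borel_measurable_lebesgue_integral) measurable
  qed measurable
  also have "\<dots> = (\<Sum>j\<in>I. \<Sum>m\<le>k j. (real (k j choose m) * M (k(j := k j - m))) * (stick_moment \<beta> m (n - m) * measure lborel (B j)))"
    using int_b by (simp add: Bochner_Integration.integral_sum integral_stick_base_prod[OF \<beta> B Bsub])
  also have "\<dots> = (\<Sum>j\<in>I. measure lborel (B j) * (\<Sum>m\<le>k j. real (k j choose m) * stick_moment \<beta> m (n - m) * M (k(j := k j - m))))"
    by (simp add: sum_distrib_left ac_simps)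
  finally show "M k = (\<Sum>j\<in>I. measure lborel (B j) * (\<Sum>m\<le>k j. real (k j choose m) * stick_moment \<beta> m ((\<Sum>i\<in>I. k i) - m) * M (k(j := k j - m))))"
    by (simp add: n_def)
qed

section \<open>Cells of a partition and the law of the stick masses\<close>

lemma partition_strict_mono:
  assumes "is_partition N t" "i < j" "j \<le> N + 1"
  shows "t i < t j"
  using assms(2,3)
proof (induction j)
  case (Suc j)
  have "t j < t (Suc j)" using assms(1) Suc.prems by (auto simp: is_partition_def)
  with Suc show ?case by (cases "i = j") auto
qed simp

lemma partition_mono:
  assumes "is_partition N t" "i \<le> j" "j \<le> N + 1"
  shows "t i \<le> t j"
  using partition_strict_mono[OF assms(1), of i j] assms by (cases "i = j") auto

lemma partition_bounds:
  assumes "is_partition N t" "i \<le> N + 1"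
  shows "0 \<le> t i" "t i \<le> 1"
  using partition_mono[OF assms(1), of 0 i] partition_mono[OF assms(1), of i "N + 1"] assms
  by (auto simp: is_partition_def)

lemma partition_inner:
  assumes "is_partition N t" "i \<in> {1..N}"
  shows "t i \<in> {0<..<1}"
  using partition_strict_mono[OF assms(1), of 0 i] partition_strict_mono[OF assms(1), of i "N + 1"] assms
  by (auto simp: is_partition_def)

lemma partition_disjoint:
  assumes "is_partition N t"
  shows "disjoint_family_on (\<lambda>i. {t i<..t (i + 1)}) {..N}"
proof (unfold disjoint_family_on_def, intro ballI impI)
  have *: "{t i<..t (i + 1)} \<inter> {t j<..t (j + 1)} = {}" if "i < j" "j \<le> N" for i j
    using partition_mono[OF assms, of "i + 1" j] that by auto
  fix i j assume "i \<in> {..N}" "j \<in> {..N}" "i \<noteq> j"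
  then show "{t i<..t (i + 1)} \<inter> {t j<..t (j + 1)} = {}"
    using *[of i j] *[of j i] by (cases "i < j") (auto simp: Int_commute)
qed

lemma partition_cover:
  assumes "is_partition N t" "k \<le> N + 1"
  shows "(\<Union>i<k. {t i<..t (i + 1)}) = {0<..t k}"
  using assms(2)
proof (induction k)
  case 0
  then show ?case using assms(1) by (simp add: is_partition_def)
next
  case (Suc k)
  have "t k < t (Suc k)" "0 \<le> t k"
    using partition_strict_mono[OF assms(1), of k "Suc k"] partition_bounds[OF assms(1), of k] Suc.prems by auto
  then show ?case using Suc by (auto simp: lessThan_Suc)
qed

lemma integral_dirichlet_moments:
  assumes part: "is_partition N t" and \<beta>: "\<beta> > 0"
  shows "(LINT x|dirichlet_measure \<beta> N t. (\<Prod>i\<le>N. increment N i x ^ k i)) =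
     dirichlet_moment \<beta> {..N} (\<lambda>i. t (i + 1) - t i) k"
proof -
  have "(LINT x|dirichlet_measure \<beta> N t. (\<Prod>i\<le>N. increment N i x ^ k i)) =
     enn2real (\<integral>\<^sup>+x. ennreal (\<Prod>i\<le>N. increment N i x ^ k i) \<partial>dirichlet_measure \<beta> N t)"
  proof (rule integral_eq_nn_integral)
    show "(\<lambda>x. \<Prod>i\<le>N. increment N i x ^ k i) \<in> borel_measurable (dirichlet_measure \<beta> N t)"
      unfolding measurable_cong_sets[OF sets_dirichlet_measure refl] by measurable
    show "AE x in dirichlet_measure \<beta> N t. 0 \<le> (\<Prod>i\<le>N. increment N i x ^ k i)"
      using AE_dirichlet_measure by eventually_elim (auto intro!: prod_nonneg zero_le_power less_imp_le[OF increment_pos])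
  qed
  also have "\<dots> = (\<Prod>i\<le>N. pochhammer (weight \<beta> t i) (k i)) / pochhammer \<beta> (\<Sum>i\<le>N. k i)"
    using \<beta> by (subst nn_integral_dirichlet_moments[OF part \<beta>])
      (auto intro!: enn2real_ennreal divide_nonneg_nonneg prod_nonneg less_imp_le[OF pochhammer_pos] weight_pos[OF part \<beta>])
  finally show ?thesis by (simp add: dirichlet_moment_def weight_def)
qed

lemma increment_in_unit: "x \<in> simplex_set N \<Longrightarrow> i \<le> N \<Longrightarrow> increment N i x \<in> {0..1}"
proof -
  assume x: "x \<in> simplex_set N" and i: "i \<le> N"
  have "bd N x (i + 1) \<le> 1" "0 \<le> bd N x i"
    using x i by (auto simp: simplex_set_def bd_def PiE_iff)
  then show ?thesis using increment_pos[OF x i] by (simp add: increment_def)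
qed

text \<open>The moments are known for the vector of all \<open>N + 1\<close> increments, whose
  parameters are the lengths of the cells on both sides. The laws of the increments are identified
  first and then pushed forward to the coordinates.\<close>

lemma dirichlet_measure_eq_distr_stick:
  assumes part: "is_partition N t" and \<beta>: "\<beta> > 0"
  shows "distr (stream_space (stick_base \<beta>)) (\<Pi>\<^sub>M i\<in>{1..N}. borel) (\<lambda>\<omega>. \<lambda>i\<in>{1..N}. stick_mass {0<..t i} \<omega>) =
    dirichlet_measure \<beta> N t"
proof -
  interpret base: prob_space "stick_base \<beta>" using \<beta> by (rule prob_space_stick_base)
  interpret S: prob_space "stream_space (stick_base \<beta>)" by (rule base.prob_space_stream_space)
  interpret D: prob_space "dirichlet_measure \<beta> N t" by (rule prob_space_dirichlet_measure[OF part \<beta>])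
  let ?B = "\<lambda>i. {t i<..t (i + 1)}"
  let ?inc = "\<lambda>x. \<lambda>i\<in>{..N}. increment N i x" and ?mass = "\<lambda>\<omega>. \<lambda>i\<in>{..N}. stick_mass (?B i) \<omega>"
  \<comment> \<open>Partial sums recover the coordinates from the increments, and the masses of the
    initial intervals from the masses of the cells.\<close>
  define PS where "PS y = (\<lambda>i\<in>{1..N}. \<Sum>j<i. y j :: real)" for y
  have inc [measurable]: "?inc \<in> measurable (dirichlet_measure \<beta> N t) (\<Pi>\<^sub>M i\<in>{..N}. borel)"
    unfolding measurable_cong_sets[OF sets_dirichlet_measure refl] by (intro measurable_restrict measurable_increment) auto
  have mass [measurable]: "?mass \<in> measurable (stream_space (stick_base \<beta>)) (\<Pi>\<^sub>M i\<in>{..N}. borel)"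
    by (intro measurable_restrict measurable_stick_mass) auto
  have PS [measurable]: "PS \<in> measurable (\<Pi>\<^sub>M i\<in>{..N}. borel) (\<Pi>\<^sub>M i\<in>{1..N}. borel)"
    unfolding PS_def by (intro measurable_restrict borel_measurable_sum measurable_component_singleton) auto
  have "distr (dirichlet_measure \<beta> N t) (\<Pi>\<^sub>M i\<in>{..N}. borel) ?inc =
      distr (stream_space (stick_base \<beta>)) (\<Pi>\<^sub>M i\<in>{..N}. borel) ?mass"
  proof (rule measure_eqI_moments[where I = "{..N}"])
    show "finite_measure (distr (dirichlet_measure \<beta> N t) (\<Pi>\<^sub>M i\<in>{..N}. borel) ?inc)"
      by (rule D.finite_measure_distr) measurable
    show "finite_measure (distr (stream_space (stick_base \<beta>)) (\<Pi>\<^sub>M i\<in>{..N}. borel) ?mass)"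
      by (rule S.finite_measure_distr) measurable
    show "AE x in distr (dirichlet_measure \<beta> N t) (\<Pi>\<^sub>M i\<in>{..N}. borel) ?inc. \<forall>i\<in>{..N}. x i \<in> {0..1}"
      by (subst AE_distr_iff[OF inc], measurable)
         (use AE_dirichlet_measure in \<open>eventually_elim, use increment_in_unit in auto\<close>)
    show "AE x in distr (stream_space (stick_base \<beta>)) (\<Pi>\<^sub>M i\<in>{..N}. borel) ?mass. \<forall>i\<in>{..N}. x i \<in> {0..1}"
      by (subst AE_distr_iff[OF mass], measurable) (auto intro!: AE_I2 simp: stick_mass_nonneg stick_mass_le_1)
    fix k :: "nat \<Rightarrow> nat"
    have len: "measure lborel (?B i) = t (i + 1) - t i" if "i \<le> N" for i
      using partition_strict_mono[OF part, of i "i + 1"] that by simp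
    have "(LINT x|distr (dirichlet_measure \<beta> N t) (\<Pi>\<^sub>M i\<in>{..N}. borel) ?inc. (\<Prod>i\<le>N. x i ^ k i)) =
      dirichlet_moment \<beta> {..N} (\<lambda>i. t (i + 1) - t i) k"
      by (subst integral_distr[OF inc]) (auto simp: integral_dirichlet_moments[OF part \<beta>])
    also have "\<dots> = dirichlet_moment \<beta> {..N} (\<lambda>i. measure lborel (?B i)) k"
      unfolding dirichlet_moment_def
      by (intro arg_cong2[where f = "(/)"] prod.cong refl, subst len) auto
    also have "\<dots> = (LINT \<omega>|stream_space (stick_base \<beta>). (\<Prod>i\<le>N. stick_mass (?B i) \<omega> ^ k i))"
      using partition_cover[OF part, of "N + 1"] part
      by (intro integral_prod_stick_mass[OF \<beta>, symmetric] partition_disjoint part)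
         (auto simp: is_partition_def lessThan_Suc_atMost)
    also have "\<dots> = (LINT x|distr (stream_space (stick_base \<beta>)) (\<Pi>\<^sub>M i\<in>{..N}. borel) ?mass. (\<Prod>i\<le>N. x i ^ k i))"
      by (subst integral_distr[OF mass]) auto
    finally show "(LINT x|distr (dirichlet_measure \<beta> N t) (\<Pi>\<^sub>M i\<in>{..N}. borel) ?inc. (\<Prod>i\<le>N. x i ^ k i)) =
      (LINT x|distr (stream_space (stick_base \<beta>)) (\<Pi>\<^sub>M i\<in>{..N}. borel) ?mass. (\<Prod>i\<le>N. x i ^ k i))" .
  qed auto
  then have "distr (distr (dirichlet_measure \<beta> N t) (\<Pi>\<^sub>M i\<in>{..N}. borel) ?inc) (\<Pi>\<^sub>M i\<in>{1..N}. borel) PS =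
      distr (distr (stream_space (stick_base \<beta>)) (\<Pi>\<^sub>M i\<in>{..N}. borel) ?mass) (\<Pi>\<^sub>M i\<in>{1..N}. borel) PS"
    by simp
  then have eq: "distr (dirichlet_measure \<beta> N t) (\<Pi>\<^sub>M i\<in>{1..N}. borel) (PS \<circ> ?inc) =
      distr (stream_space (stick_base \<beta>)) (\<Pi>\<^sub>M i\<in>{1..N}. borel) (PS \<circ> ?mass)"
    by (simp only: distr_distr[OF PS inc] distr_distr[OF PS mass])
  have "PS \<circ> ?mass = (\<lambda>\<omega>. \<lambda>i\<in>{1..N}. stick_mass {0<..t i} \<omega>)"
  proof (intro ext)
    fix \<omega> i
    have "(\<Sum>j<l. stick_mass (?B j) \<omega>) = stick_mass {0<..t l} \<omega>" if "l \<le> N + 1" for l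
      using that
    proof (induction l)
      case 0
      have "stick_mass {} \<omega> = 0" by (simp add: stick_mass_def)
      then show ?case using part by (simp add: is_partition_def)
    next
      case (Suc l)
      have "{0<..t (Suc l)} = {0<..t l} \<union> ?B l"
        using partition_bounds[OF part, of l] partition_mono[OF part, of l "Suc l"] Suc.prems by auto
      then show ?case using Suc by (simp add: stick_mass_disjoint_Un)
    qed
    then show "(PS \<circ> ?mass) \<omega> i = (\<lambda>i\<in>{1..N}. stick_mass {0<..t i} \<omega>) i"
      by (auto simp: PS_def)
  qed
  moreover have "distr (dirichlet_measure \<beta> N t) (\<Pi>\<^sub>M i\<in>{1..N}. borel) (PS \<circ> ?inc) =
      distr (dirichlet_measure \<beta> N t) (\<Pi>\<^sub>M i\<in>{1..N}. borel) (\<lambda>x. x)"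
  proof (intro distr_cong refl)
    fix x assume "x \<in> space (dirichlet_measure \<beta> N t)"
    then have "x \<in> extensional {1..N}" by (simp add: space_dirichlet_measure)
    then show "(PS \<circ> ?inc) x = x"
      by (auto simp: PS_def fun_eq_iff extensional_def bd_eq_sum_increment[symmetric] bd_def)
  qed
  moreover have "distr (dirichlet_measure \<beta> N t) (\<Pi>\<^sub>M i\<in>{1..N}. borel) (\<lambda>x. x) = dirichlet_measure \<beta> N t"
    by (rule distr_id2) (simp add: sets_dirichlet_measure)
  ultimately show ?thesis using eq by simp
qed

section \<open>The metric space of right continuous nondecreasing functions\<close>

lemma (in Metric_space) open_sets_subset_Pow: "{U. openin mtopology U} \<subseteq> Pow M"
  using openin_subset[of mtopology] by (auto simp: topspace_mtopology)

lemma space_metric_borel: "Metric_space X d \<Longrightarrow> space (metric_borel X d) = X"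
  by (simp add: metric_borel_def space_measure_of Metric_space.open_sets_subset_Pow)

lemma sets_metric_borel:
  "Metric_space X d \<Longrightarrow>
     sets (metric_borel X d) = sigma_sets X {U. openin (Metric_space.mtopology X d) U}"
  by (simp add: metric_borel_def sets_measure_of Metric_space.open_sets_subset_Pow)

lemma open_in_metric_borel:
  "Metric_space X d \<Longrightarrow> openin (Metric_space.mtopology X d) U \<Longrightarrow> U \<in> sets (metric_borel X d)"
  by (simp add: sets_metric_borel)

lemma borel_measurable_metric_borel:
  assumes X: "Metric_space X d"
    and f: "continuous_map (Metric_space.mtopology X d) euclideanreal f"
  shows "f \<in> borel_measurable (metric_borel X d)"
proof (rule borel_measurableI)
  fix S :: "real set" assume "open S"
  then have "openin (Metric_space.mtopology X d) {x \<in> topspace (Metric_space.mtopology X d). f x \<in> S}"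
    using f by (auto simp: continuous_map_def)
  then show "f -` S \<inter> space (metric_borel X d) \<in> sets (metric_borel X d)"
    using open_in_metric_borel[OF X]
    by (simp add: space_metric_borel[OF X] Metric_space.topspace_mtopology[OF X] vimage_def Int_def conj_commute)
qed

lemma metric_open_eq_Union_balls:
  assumes X: "Metric_space X d" and D: "D \<subseteq> X"
    and dense: "\<And>x e. x \<in> X \<Longrightarrow> e > 0 \<Longrightarrow> \<exists>y\<in>D. d y x < e"
    and U: "openin (Metric_space.mtopology X d) U"
  shows "U = (\<Union>(y, r)\<in>{(y, r). y \<in> D \<and> r \<in> \<rat> \<and> {x\<in>X. d y x < r} \<subseteq> U}. {x\<in>X. d y x < r})"
proof (intro equalityI subsetI)
  interpret Metric_space X d by fact
  fix x assume x: "x \<in> U"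
  from U have "U \<subseteq> X" "\<exists>r>0. mball x r \<subseteq> U" using x by (auto simp: openin_mtopology)
  then obtain r where r: "r > 0" "mball x r \<subseteq> U" "x \<in> X" using x by blast
  \<comment> \<open>With \<open>q\<close> below \<open>r / 2\<close> and a centre \<open>y\<close>
    at distance less than \<open>q\<close>, the ball of radius \<open>q\<close> around
    \<open>y\<close> contains \<open>x\<close> and stays inside the ball of radius \<open>r\<close>
    around \<open>x\<close>.\<close>
  obtain q where q: "q \<in> \<rat>" "0 < q" "q < r / 2" using Rats_dense_in_real[of 0 "r / 2"] r by auto
  obtain y where y: "y \<in> D" "d y x < q" using dense[OF r(3) q(2)] by auto
  have "{z\<in>X. d y z < q} \<subseteq> mball x r"
  proof
    fix z assume z: "z \<in> {z\<in>X. d y z < q}"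
    have "d x z \<le> d x y + d y z" using triangle[of x y z] y z r D by auto
    also have "\<dots> < r" using y z q by (auto simp: commute)
    finally show "z \<in> mball x r" using z r by auto
  qed
  with y q r show "x \<in> (\<Union>(y, r)\<in>{(y, r). y \<in> D \<and> r \<in> \<rat> \<and> {x\<in>X. d y x < r} \<subseteq> U}. {x\<in>X. d y x < r})"
    by (intro UN_I[of "(y, q)"]) auto
qed auto

text \<open>By separability every open set is a countable union of balls with centres in
  \<open>D\<close> and rational radii, so it suffices to measure the distances to the points of
  \<open>D\<close>.\<close>

lemma measurable_metric_borel:
  assumes X: "Metric_space X d" and D: "D \<subseteq> X" "countable D"
    and dense: "\<And>x e. x \<in> X \<Longrightarrow> e > 0 \<Longrightarrow> \<exists>y\<in>D. d y x < e"
    and f: "f \<in> space M \<rightarrow> X"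
    and balls: "\<And>y. y \<in> D \<Longrightarrow> (\<lambda>\<omega>. d y (f \<omega>)) \<in> borel_measurable M"
  shows "f \<in> measurable M (metric_borel X d)"
  unfolding metric_borel_def
proof (rule measurable_measure_of[OF Metric_space.open_sets_subset_Pow[OF X] f], safe)
  fix U assume U: "openin (Metric_space.mtopology X d) U"
  let ?I = "{(y, r). y \<in> D \<and> r \<in> \<rat> \<and> {x\<in>X. d y x < r} \<subseteq> U}"
  have "f -` U \<inter> space M = (\<Union>(y, r)\<in>?I. {\<omega>\<in>space M. d y (f \<omega>) < r})"
    by (subst metric_open_eq_Union_balls[OF X D(1) dense U]) (use f in auto)
  also have "\<dots> \<in> sets M"
  proof (rule sets.countable_UN'')
    show "countable ?I"
      by (rule countable_subset[of _ "D \<times> \<rat>"]) (auto simp: D countable_rat)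
  qed (use balls in auto)
  finally show "f -` U \<inter> space M \<in> sets M" .
qed

section \<open>Extension to the real line and the \<open>L2\<close> metric\<close>

definition ext :: "(real \<Rightarrow> real) \<Rightarrow> real \<Rightarrow> real" where
  "ext g x = (if x < 0 then 0 else if x \<ge> 1 then 1 else g x)"

lemma G0_bounds: "g \<in> G0 \<Longrightarrow> t \<in> {0..1} \<Longrightarrow> g t \<in> {0..1}"
  by (auto simp: G0_def PiE_iff)

lemma G0_mono: "g \<in> G0 \<Longrightarrow> 0 \<le> s \<Longrightarrow> s \<le> t \<Longrightarrow> t \<le> 1 \<Longrightarrow> g s \<le> g t"
  by (auto simp: G0_def mono_on_def)

lemma G0_at_1: "g \<in> G0 \<Longrightarrow> g 1 = 1"
  by (auto simp: G0_def)

lemma ext_eq: "g \<in> G0 \<Longrightarrow> t \<in> {0..1} \<Longrightarrow> ext g t = g t"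
  by (auto simp: ext_def G0_at_1)

lemma ext_bounds: "g \<in> G0 \<Longrightarrow> 0 \<le> ext g x" "g \<in> G0 \<Longrightarrow> ext g x \<le> 1"
  using G0_bounds[of g x] by (auto simp: ext_def)

text \<open>The constants 0 and 1 outside the unit interval keep the extension nondecreasing on the
  whole line. Borel measurability then comes from monotonicity, and the extended functions have the
  form required by Helly's theorem.\<close>

lemma mono_ext: "g \<in> G0 \<Longrightarrow> mono (ext g)"
  using G0_mono[of g] G0_bounds[of g] by (intro monoI) (auto simp: ext_def)

lemma measurable_ext: "g \<in> G0 \<Longrightarrow> ext g \<in> borel_measurable borel"
  by (rule borel_measurable_mono[OF mono_ext])

lemma continuous_ext:
  assumes g: "g \<in> G0"
  shows "continuous (at_right x) (ext g)"
proof -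
  consider "x < 0" | "0 \<le> x" "x < 1" | "x \<ge> 1" by linarith
  then show ?thesis
  proof cases
    case 1
    then have "eventually (\<lambda>y. 0 = ext g y) (at_right x)"
      unfolding eventually_at_right_field by (intro exI[of _ 0]) (auto simp: ext_def)
    from tendsto_cong[OF this, of 0] have "(ext g \<longlongrightarrow> 0) (at_right x)" by simp
    with 1 show ?thesis
      unfolding continuous_within by (simp add: ext_def[of g x])
  next
    case 2
    then have "eventually (\<lambda>y. g y = ext g y) (at_right x)"
      unfolding eventually_at_right_field by (intro exI[of _ 1]) (auto simp: ext_def)
    moreover have "(g \<longlongrightarrow> g x) (at_right x)"
      using 2 g by (auto simp: G0_def continuous_within)
    ultimately have "(ext g \<longlongrightarrow> g x) (at_right x)" using tendsto_cong by blast
    with 2 show ?thesis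
      unfolding continuous_within by (simp add: ext_def[of g x])
  next
    case 3
    then have "eventually (\<lambda>y. 1 = ext g y) (at_right x)"
      unfolding eventually_at_right_field by (intro exI[of _ "x + 1"]) (auto simp: ext_def)
    from tendsto_cong[OF this, of 1] have "(ext g \<longlongrightarrow> 1) (at_right x)" by simp
    with 3 show ?thesis
      unfolding continuous_within by (simp add: ext_def[of g x])
  qed
qed

lemma G0_eqI:
  assumes "f \<in> G0" "g \<in> G0" "\<And>t. 0 \<le> t \<Longrightarrow> t < 1 \<Longrightarrow> f t = g t"
  shows "f = g"
proof
  fix t show "f t = g t"
    using assms by (cases "t = 1"; cases "t \<in> {0..1}") (auto simp: G0_def PiE_iff extensional_def)
qed

text \<open>Written with \<open>ext\<close>, so that for functions in \<open>G0\<close> the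
  integrand is Borel on the whole line; on the unit interval the values are unchanged.\<close>

definition sq_dist :: "(real \<Rightarrow> real) \<Rightarrow> (real \<Rightarrow> real) \<Rightarrow> real" where
  "sq_dist f g = (LINT t:{0..1}|lborel. (ext f t - ext g t)\<^sup>2)"

lemma L2_dist_sq_dist: "f \<in> G0 \<Longrightarrow> g \<in> G0 \<Longrightarrow> L2_dist f g = sqrt (sq_dist f g)"
  unfolding L2_dist_def sq_dist_def
  by (intro arg_cong[where f = sqrt] set_lebesgue_integral_cong) (auto simp: ext_eq)

lemma sq_dist_nonneg: "sq_dist f g \<ge> 0"
  unfolding sq_dist_def set_lebesgue_integral_def by (intro integral_nonneg_AE) auto

lemma ext_diff_bound: "f \<in> G0 \<Longrightarrow> g \<in> G0 \<Longrightarrow> \<bar>ext f t - ext g t\<bar> \<le> 1"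
  using ext_bounds[of f t] ext_bounds[of g t] by auto

lemma set_integrable_unit_bounded:
  fixes h :: "real \<Rightarrow> real"
  assumes [measurable]: "h \<in> borel_measurable borel" and "\<And>t. t \<in> {0..1} \<Longrightarrow> \<bar>h t\<bar> \<le> C"
  shows "set_integrable lborel {0..1} h"
  unfolding set_integrable_def
proof (rule Bochner_Integration.integrable_bound[where f = "\<lambda>t. C * indicator {0..1} t"])
  show "integrable lborel (\<lambda>t. C * indicator {0..1::real} t)" by simp
  show "AE x in lborel. norm (indicat_real {0..1} x *\<^sub>R h x) \<le> norm (C * indicat_real {0..1} x)"
    using assms(2) by (intro AE_I2) (force simp: indicator_def)
qed measurable

lemma set_integrable_ext_diff:
  assumes "f \<in> G0" "g \<in> G0"
  shows "set_integrable lborel {0..1} (\<lambda>t. (ext f t - ext g t)\<^sup>2)"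
  using ext_diff_bound[OF assms] measurable_ext[OF assms(1)] measurable_ext[OF assms(2)]
  by (intro set_integrable_unit_bounded[where C = 1]) (auto simp: abs_square_le_1)

text \<open>Minkowski's inequality from the weighted estimate
  \<open>(x + y)^2 \<le> (1 + b/a) * x^2 + (1 + a/b) * y^2\<close>, whose defect is
  \<open>(b * x - a * y)^2 / (a * b)\<close>. With \<open>a\<close> and \<open>b\<close> bounding
  the two distances, integration gives \<open>(a + b)^2\<close>.\<close>

lemma sq_dist_triangle:
  assumes f: "f \<in> G0" and g: "g \<in> G0" and h: "h \<in> G0"
  shows "sqrt (sq_dist f h) \<le> sqrt (sq_dist f g) + sqrt (sq_dist g h)"
proof (rule field_le_epsilon)
  fix e :: real assume e: "e > 0"
  \<comment> \<open>The summand \<open>e / 2\<close> keeps the weights defined when a distance is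
    0.\<close>
  define a where "a = sqrt (sq_dist f g) + e / 2"
  define b where "b = sqrt (sq_dist g h) + e / 2"
  have ab: "a > 0" "b > 0" using e sq_dist_nonneg by (auto simp: a_def b_def add_nonneg_pos)
  have pw: "(x + y)\<^sup>2 \<le> (1 + b / a) * x\<^sup>2 + (1 + a / b) * y\<^sup>2" for x y :: real
  proof -
    have "0 \<le> (b * x - a * y)\<^sup>2 / (a * b)" using ab by simp
    also have "\<dots> = (1 + b / a) * x\<^sup>2 + (1 + a / b) * y\<^sup>2 - (x + y)\<^sup>2"
      using ab by (simp add: field_simps power2_eq_square)
    finally show ?thesis by simp
  qed
  have "sq_dist f h \<le> (LINT t:{0..1}|lborel. (1 + b / a) * (ext f t - ext g t)\<^sup>2 + (1 + a / b) * (ext g t - ext h t)\<^sup>2)"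
    unfolding sq_dist_def
  proof (rule set_integral_mono)
    fix t :: real
    show "(ext f t - ext h t)\<^sup>2 \<le> (1 + b / a) * (ext f t - ext g t)\<^sup>2 + (1 + a / b) * (ext g t - ext h t)\<^sup>2"
      using pw[of "ext f t - ext g t" "ext g t - ext h t"] by simp
  qed (intro set_integral_add set_integrable_mult_right set_integrable_ext_diff f g h impI)+
  also have "\<dots> = (1 + b / a) * sq_dist f g + (1 + a / b) * sq_dist g h"
    unfolding sq_dist_def
    by (subst set_integral_add) (auto intro!: set_integrable_mult_right set_integrable_ext_diff f g h)
  also have "\<dots> \<le> (1 + b / a) * a\<^sup>2 + (1 + a / b) * b\<^sup>2"
  proof (intro add_mono mult_left_mono)
    show "sq_dist f g \<le> a\<^sup>2" "sq_dist g h \<le> b\<^sup>2"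
      using e sq_dist_nonneg by (auto simp: a_def b_def power2_sum real_sqrt_pow2)
  qed (use ab in auto)
  also have "\<dots> = (a + b)\<^sup>2"
    using ab by (simp add: field_simps power2_eq_square)
  finally have "sqrt (sq_dist f h) \<le> a + b"
    using ab by (intro real_le_lsqrt sq_dist_nonneg) auto
  then show "sqrt (sq_dist f h) \<le> sqrt (sq_dist f g) + sqrt (sq_dist g h) + e"
    by (simp add: a_def b_def)
qed

text \<open>If \<open>g\<close> stays below \<open>c\<close> on \<open>[t, s]\<close> then a nondecreasing \<open>f\<close> with \<open>f t \<ge> c\<close> differs
  from \<open>g\<close> on all of \<open>[t, s]\<close>.\<close>

lemma sq_dist_lower_bound:
  assumes f: "f \<in> G0" and g: "g \<in> G0" and ts: "0 \<le> t" "t \<le> s" "s \<le> 1" and c: "g s \<le> c" "c \<le> f t"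
  shows "(s - t) * (c - g s)\<^sup>2 \<le> sq_dist f g"
proof -
  have "(s - t) * (c - g s)\<^sup>2 = (LINT r:{0..1}|lborel. (c - g s)\<^sup>2 * indicator {t..s} r)"
  proof -
    have "(LINT r:{0..1}|lborel. (c - g s)\<^sup>2 * indicator {t..s} r) = (LINT r|lborel. (c - g s)\<^sup>2 * indicator {t..s} r)"
      unfolding set_lebesgue_integral_def
      using ts by (intro Bochner_Integration.integral_cong) (auto simp: indicator_def)
    also have "\<dots> = (c - g s)\<^sup>2 * (s - t)" using ts by simp
    finally show ?thesis unfolding mult.commute[of "s - t"] by (rule sym)
  qed
  also have "\<dots> \<le> sq_dist f g"
    unfolding sq_dist_def
  proof (rule set_integral_mono)
    show "set_integrable lborel {0..1} (\<lambda>r. (c - g s)\<^sup>2 * indicat_real {t..s} r)"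
      by (rule set_integrable_unit_bounded[where C = "(c - g s)\<^sup>2"]) (auto simp: indicator_def)
    show "set_integrable lborel {0..1} (\<lambda>t. (ext f t - ext g t)\<^sup>2)"
      by (rule set_integrable_ext_diff[OF f g])
    fix r :: real assume r: "r \<in> {0..1}"
    show "(c - g s)\<^sup>2 * indicator {t..s} r \<le> (ext f r - ext g r)\<^sup>2"
    proof (cases "r \<in> {t..s}")
      case True
      then have "f t \<le> f r" "g r \<le> g s" using r ts G0_mono[OF f, of t r] G0_mono[OF g, of r s] by auto
      then show ?thesis using True r c by (auto simp: ext_eq f g intro!: power_mono)
    qed simp
  qed
  finally show ?thesis .
qed

lemma G0_right_less:
  assumes g: "g \<in> G0" and t: "0 \<le> t" "t < 1" and c: "g t < c"
  shows "\<exists>s. t < s \<and> s < 1 \<and> g s < c"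
proof -
  have "(g \<longlongrightarrow> g t) (at_right t)"
    using g t by (auto simp: G0_def continuous_within)
  from order_tendstoD(2)[OF this c] obtain b where b: "b > t" "\<And>y. t < y \<Longrightarrow> y < b \<Longrightarrow> g y < c"
    unfolding eventually_at_right_field by blast
  obtain s where "t < s" "s < min b 1" using dense[of t "min b 1"] b t by auto
  with b show ?thesis by auto
qed

lemma sq_dist_commute: "sq_dist f g = sq_dist g f"
  unfolding sq_dist_def by (simp add: power2_commute)

text \<open>If \<open>f t > g t\<close>, right continuity keeps \<open>g\<close> below
  \<open>f t\<close> slightly to the right of \<open>t\<close>, where \<open>f\<close> is at least
  \<open>f t\<close>; this forces a positive distance. Exchanging the functions gives equality on
  \<open>[0,1)\<close>.\<close>

lemma sq_dist_eq_0:
  assumes f: "f \<in> G0" and g: "g \<in> G0" and 0: "sq_dist f g = 0"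
  shows "f = g"
proof -
  have *: "f t \<le> g t" if f: "f \<in> G0" and g: "g \<in> G0" and 0: "sq_dist f g = 0" and t: "0 \<le> t" "t < 1" for f g t
  proof (rule ccontr)
    assume "\<not> f t \<le> g t"
    then obtain s where s: "t < s" "s < 1" "g s < f t" using G0_right_less[OF g t, of "f t"] by auto
    have "0 < (s - t) * (f t - g s)\<^sup>2" using s by simp
    also have "\<dots> \<le> sq_dist f g" using s t by (intro sq_dist_lower_bound f g) auto
    finally show False using 0 by simp
  qed
  show ?thesis
    using *[OF f g 0] *[OF g f] 0 by (intro G0_eqI f g antisym) (auto simp: sq_dist_commute)
qed

lemma Metric_space_G0: "Metric_space G0 L2_dist"
proof
  show "0 \<le> L2_dist f g" for f g
    unfolding L2_dist_def set_lebesgue_integral_def by (auto intro!: integral_nonneg_AE)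
  show "L2_dist f g = L2_dist g f" for f g
    unfolding L2_dist_def by (simp add: power2_commute)
  show "L2_dist f g = 0 \<longleftrightarrow> f = g" if "f \<in> G0" "g \<in> G0" for f g
    using sq_dist_eq_0[OF that] that by (auto simp: L2_dist_sq_dist sq_dist_def)
  show "L2_dist f h \<le> L2_dist f g + L2_dist g h" if "f \<in> G0" "g \<in> G0" "h \<in> G0" for f g h
    using sq_dist_triangle[OF that] that by (simp add: L2_dist_sq_dist)
qed

text \<open>Evaluation at \<open>t < 1\<close> is upper semicontinuous. If \<open>g t < c\<close>,
  right continuity gives \<open>s > t\<close> with \<open>g s < c\<close>, and every
  \<open>f\<close> with \<open>f t \<ge> c\<close> has distance at least
  \<open>sqrt ((s - t) * (c - g s)^2)\<close> from \<open>g\<close>.\<close>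

lemma measurable_eval_G0:
  assumes t: "t \<in> {0..1}"
  shows "(\<lambda>g. g t) \<in> borel_measurable (metric_borel G0 L2_dist)"
proof (cases "t = 1")
  case True
  then show ?thesis
    using measurable_cong[of "metric_borel G0 L2_dist" "\<lambda>g. g t" "\<lambda>_. 1" borel]
    by (simp add: space_metric_borel[OF Metric_space_G0] G0_at_1)
next
  case False
  then have t: "0 \<le> t" "t < 1" using t by auto
  interpret Metric_space G0 L2_dist by (rule Metric_space_G0)
  have "openin mtopology {g\<in>G0. g t < c}" for c
    unfolding openin_mtopology
  proof safe
    fix g assume g: "g \<in> G0" "g t < c"
    then obtain s where s: "t < s" "s < 1" "g s < c" using G0_right_less[OF _ t] by blast
    let ?r = "sqrt ((s - t) * (c - g s)\<^sup>2)"
    have "f t < c" if "f \<in> mball g ?r" for f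
    proof (rule ccontr)
      assume "\<not> f t < c"
      then have "(s - t) * (c - g s)\<^sup>2 \<le> sq_dist f g"
        using s t that by (intro sq_dist_lower_bound g) auto
      then have "?r \<le> L2_dist g f" using that g by (simp add: L2_dist_sq_dist sq_dist_commute)
      then show False using that by simp
    qed
    moreover have "?r > 0" using s by simp
    ultimately show "\<exists>r>0. mball g r \<subseteq> {g\<in>G0. g t < c}"
      by (intro exI[of _ ?r]) (auto simp: in_mball)
  qed
  then have "{g\<in>G0. g t < c} \<in> sets (metric_borel G0 L2_dist)" for c
    using open_in_metric_borel[OF Metric_space_G0] by blast
  then show ?thesis
    unfolding borel_measurable_iff_less by (simp add: space_metric_borel[OF Metric_space_G0])
qed

section \<open>Dyadic step functions and dyadic samples\<close>

definition nondecreasing_point :: "nat \<Rightarrow> (nat \<Rightarrow> real) \<Rightarrow> bool" where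
  "nondecreasing_point n x \<longleftrightarrow> (\<forall>i\<le>n. bd n x i \<le> bd n x (i + 1))"

definition dyadic_step :: "nat \<Rightarrow> (nat \<Rightarrow> real) \<Rightarrow> real \<Rightarrow> real" where
  "dyadic_step N x = (\<lambda>s\<in>{0..1}. bd (std_size N) x (nat \<lfloor>2 ^ N * s\<rfloor>))"

definition dyadic_sample :: "nat \<Rightarrow> (real \<Rightarrow> real) \<Rightarrow> nat \<Rightarrow> real" where
  "dyadic_sample N g = (\<lambda>i\<in>{1..std_size N}. g (std_partition N i))"

lemma Suc_std_size: "Suc (std_size N) = 2 ^ N"
  by (simp add: std_size_def)

lemma is_partition_std: "N \<ge> 1 \<Longrightarrow> is_partition (std_size N) (std_partition N)"
proof -
  assume "N \<ge> 1"
  then have "(2::nat) ^ N \<ge> 2 ^ 1" by (intro power_increasing) auto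
  then have "std_size N \<ge> 1" by (simp add: std_size_def)
  moreover have "std_partition N (std_size N + 1) = 1"
    using Suc_std_size[of N] unfolding std_partition_def by (metis Suc_eq_plus1 divide_self of_nat_numeral of_nat_power power_not_zero zero_neq_numeral)
  ultimately show ?thesis
    by (auto simp: is_partition_def std_partition_def divide_strict_right_mono)
qed

lemma std_partition_bounds: "i \<le> 2 ^ N \<Longrightarrow> std_partition N i \<in> {0..1}"
proof -
  assume "i \<le> 2 ^ N"
  then have "real i \<le> 2 ^ N" by (metis of_nat_le_iff of_nat_numeral of_nat_power)
  then show ?thesis by (auto simp: std_partition_def)
qed

lemma nondecreasing_point_mono:
  assumes "nondecreasing_point n x" "i \<le> j" "j \<le> n + 1"
  shows "bd n x i \<le> bd n x j"
  using assms(2,3)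
proof (induction j)
  case (Suc j)
  have "bd n x j \<le> bd n x (Suc j)" using assms(1) Suc.prems by (auto simp: nondecreasing_point_def)
  with Suc show ?case by (cases "i = Suc j") auto
qed simp

lemma nondecreasing_point_bounds:
  assumes "nondecreasing_point n x" "i \<le> n + 1"
  shows "bd n x i \<in> {0..1}"
  using nondecreasing_point_mono[OF assms(1), of 0 i] nondecreasing_point_mono[OF assms(1), of i "n + 1"] assms
  by (auto simp: bd_def)

lemma nondecreasing_point_simplex: "x \<in> simplex_set n \<Longrightarrow> nondecreasing_point n x"
  by (auto simp: simplex_set_def nondecreasing_point_def less_imp_le)

lemma dyadic_index_le:
  assumes "s \<in> {0..1::real}"
  shows "nat \<lfloor>2 ^ N * s\<rfloor> \<le> 2 ^ N"
proof -
  have "2 ^ N * s \<le> 2 ^ N" using assms by simp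
  then have "\<lfloor>2 ^ N * s\<rfloor> \<le> 2 ^ N" using floor_mono[of "2 ^ N * s" "2 ^ N"] by simp
  then show ?thesis by (simp add: nat_le_iff)
qed

lemma dyadic_index_less:
  assumes "s \<in> {0..<1::real}"
  shows "nat \<lfloor>2 ^ N * s\<rfloor> < 2 ^ N"
proof -
  have "2 ^ N * s < 2 ^ N" using assms by simp
  then have "\<lfloor>2 ^ N * s\<rfloor> < 2 ^ N" by (simp add: floor_less_iff)
  then show ?thesis by (simp add: nat_less_iff)
qed

lemma dyadic_index_iff:
  assumes "0 \<le> (s :: real)"
  shows "nat \<lfloor>2 ^ N * s\<rfloor> = i \<longleftrightarrow> s \<in> {std_partition N i..<std_partition N (Suc i)}"
proof -
  have "nat \<lfloor>2 ^ N * s\<rfloor> = i \<longleftrightarrow> \<lfloor>2 ^ N * s\<rfloor> = int i" using assms by auto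
  also have "\<dots> = (real i \<le> 2 ^ N * s \<and> 2 ^ N * s < real i + 1)" by (simp add: floor_eq_iff)
  also have "\<dots> = (s \<in> {std_partition N i..<std_partition N (Suc i)})"
    by (auto simp: std_partition_def field_simps)
  finally show ?thesis .
qed

lemma integral_dyadic:
  fixes h :: "nat \<Rightarrow> real"
  shows "(LINT s:{0..1::real}|lborel. h (nat \<lfloor>2 ^ N * s\<rfloor>)) = (\<Sum>i<2 ^ N. h i) / 2 ^ N"
proof -
  let ?J = "\<lambda>i. {std_partition N i..<std_partition N (Suc i)}"
  have "(LINT s:{0..1::real}|lborel. h (nat \<lfloor>2 ^ N * s\<rfloor>)) = (LINT s|lborel. (\<Sum>i<2 ^ N. h i * indicator (?J i) s))"
    unfolding set_lebesgue_integral_def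
  proof (rule integral_cong_AE)
    show "AE s in lborel. indicat_real {0..1} s *\<^sub>R h (nat \<lfloor>2 ^ N * s\<rfloor>) = (\<Sum>i<2 ^ N. h i * indicator (?J i) s)"
      using AE_lborel_singleton[of 1]
    proof eventually_elim
      case (elim s)
      show ?case
      proof (cases "s \<in> {0..<1}")
        case True
        have "s \<in> ?J i \<longleftrightarrow> i = nat \<lfloor>2 ^ N * s\<rfloor>" for i
          using True by (subst eq_commute[of i], subst dyadic_index_iff) auto
        then have "(\<Sum>i<2 ^ N. h i * indicator (?J i) s) = (\<Sum>i<2 ^ N. if i = nat \<lfloor>2 ^ N * s\<rfloor> then h i else 0)"
          by (intro sum.cong refl) (simp add: indicator_def del: atLeastLessThan_iff)
        also have "\<dots> = h (nat \<lfloor>2 ^ N * s\<rfloor>)"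
          using dyadic_index_less[OF True] by (subst sum.delta) auto
        finally show ?thesis using True by simp
      next
        case False
        have "s \<notin> ?J i" if "i < 2 ^ N" for i
          using std_partition_bounds[of i N] std_partition_bounds[of "Suc i" N] that False elim by auto
        then have "(\<Sum>i<2 ^ N. h i * indicator (?J i) s) = 0"
          by (intro sum.neutral ballI) (simp add: indicator_def del: atLeastLessThan_iff)
        then show ?thesis using False elim by (auto simp: indicator_def)
      qed
    qed
  qed measurable
  also have "\<dots> = (\<Sum>i<2 ^ N. h i * (std_partition N (Suc i) - std_partition N i))"
  proof (subst Bochner_Integration.integral_sum)
    have le: "std_partition N i \<le> std_partition N (Suc i)" for i
      by (auto simp: std_partition_def divide_right_mono)
    show "integrable lborel (\<lambda>s. h i * indicator (?J i) s)" if "i \<in> {..<2 ^ N}" for i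
      using le by (intro integrable_mult_right integrable_real_indicator) auto
    show "(\<Sum>i<2 ^ N. (LINT s|lborel. h i * indicator (?J i) s)) = (\<Sum>i<2 ^ N. h i * (std_partition N (Suc i) - std_partition N i))"
      using le by (intro sum.cong refl) simp
  qed
  also have "\<dots> = (\<Sum>i<2 ^ N. h i) / 2 ^ N"
    unfolding sum_divide_distrib
    by (intro sum.cong refl) (simp add: std_partition_def diff_divide_distrib[symmetric])
  finally show ?thesis .
qed

text \<open>Weak monotonicity covers the points of the simplex as well as the samples of arbitrary
  functions, which may have equal values. The floor makes each interval closed on the left, whence
  right continuity; at 1 it gives the index \<open>std_size N + 1\<close>, where \<open>bd\<close>
  is 1.\<close>

lemma dyadic_step_in_G0:
  assumes x: "nondecreasing_point (std_size N) x"
  shows "dyadic_step N x \<in> G0"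
proof -
  have S: "std_size N + 1 = 2 ^ N" using Suc_std_size[of N] by simp
  have "bd (std_size N) x (nat \<lfloor>2 ^ N * s\<rfloor>) \<in> {0..1}" if "s \<in> {0..1}" for s :: real
    using dyadic_index_le[OF that, of N] by (intro nondecreasing_point_bounds[OF x]) (simp only: S)
  then have range: "dyadic_step N x \<in> {0..1} \<rightarrow>\<^sub>E {0..1}"
    unfolding dyadic_step_def by (intro restrict_PiE_iff[THEN iffD2] ballI)
  have mono: "mono_on {0..1} (dyadic_step N x)"
  proof (rule mono_onI)
    fix r s :: real assume rs: "r \<in> {0..1}" "s \<in> {0..1}" "r \<le> s"
    then have "nat \<lfloor>2 ^ N * r\<rfloor> \<le> nat \<lfloor>2 ^ N * s\<rfloor>" by (intro nat_mono floor_mono) auto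
    then have "bd (std_size N) x (nat \<lfloor>2 ^ N * r\<rfloor>) \<le> bd (std_size N) x (nat \<lfloor>2 ^ N * s\<rfloor>)"
      using dyadic_index_le[OF rs(2), of N] by (intro nondecreasing_point_mono[OF x]) (simp_all only: S)
    then show "dyadic_step N x r \<le> dyadic_step N x s"
      using rs by (simp add: dyadic_step_def)
  qed
  have cont: "continuous (at_right t) (dyadic_step N x)" if t: "t \<in> {0..<1}" for t
  proof -
    let ?i = "nat \<lfloor>2 ^ N * t\<rfloor>"
    have ti: "t \<in> {std_partition N ?i..<std_partition N (Suc ?i)}"
      using dyadic_index_iff[of t N ?i] t by auto
    have i: "Suc ?i \<le> 2 ^ N" using dyadic_index_less[OF t, of N] by (rule Suc_leI)
    have "eventually (\<lambda>s. dyadic_step N x t = dyadic_step N x s) (at_right t)"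
      unfolding eventually_at_right_field
    proof (intro exI[of _ "std_partition N (Suc ?i)"] conjI allI impI)
      fix s assume s: "t < s" "s < std_partition N (Suc ?i)"
      then have "nat \<lfloor>2 ^ N * s\<rfloor> = ?i" using ti t by (intro dyadic_index_iff[THEN iffD2]) auto
      moreover have "s \<in> {0..1}" using s t std_partition_bounds[OF i] by auto
      ultimately show "dyadic_step N x t = dyadic_step N x s"
        using t by (simp add: dyadic_step_def)
    qed (use ti in auto)
    from tendsto_cong[OF this, of "dyadic_step N x t"] show ?thesis
      unfolding continuous_within by simp
  qed
  have "dyadic_step N x 1 = 1"
    using S by (simp add: dyadic_step_def bd_def nat_power_eq not_less)
  with range mono cont show ?thesis by (simp add: G0_def)
qed

lemma ext_dyadic_step:
  "nondecreasing_point (std_size N) x \<Longrightarrow> t \<in> {0..1} \<Longrightarrow>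
     ext (dyadic_step N x) t = bd (std_size N) x (nat \<lfloor>2 ^ N * t\<rfloor>)"
  by (simp add: ext_eq dyadic_step_in_G0 del: atLeastAtMost_iff) (simp add: dyadic_step_def)

lemma sq_dist_dyadic_step:
  assumes "nondecreasing_point (std_size N) x" "nondecreasing_point (std_size N) y"
  shows "sq_dist (dyadic_step N x) (dyadic_step N y) =
    (\<Sum>i<2 ^ N. (bd (std_size N) x i - bd (std_size N) y i)\<^sup>2) / 2 ^ N"
proof -
  have "sq_dist (dyadic_step N x) (dyadic_step N y) =
    (LINT s:{0..1::real}|lborel. (\<lambda>i. (bd (std_size N) x i - bd (std_size N) y i)\<^sup>2) (nat \<lfloor>2 ^ N * s\<rfloor>))"
    unfolding sq_dist_def using assms
    by (intro set_lebesgue_integral_cong) (auto simp: ext_dyadic_step)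
  then show ?thesis
    unfolding integral_dyadic[where h = "\<lambda>i. (bd (std_size N) x i - bd (std_size N) y i)\<^sup>2"] .
qed

text \<open>The weight of coordinate \<open>i\<close> in the partition metric is the length of the
  interval on which the step function has the value \<open>x i\<close>. The first interval
  contributes nothing, since both functions vanish there.\<close>

lemma L2_dist_dyadic_step:
  assumes x: "nondecreasing_point (std_size N) x" and y: "nondecreasing_point (std_size N) y"
  shows "L2_dist (dyadic_step N x) (dyadic_step N y) = partition_dist (std_size N) (std_partition N) x y"
proof -
  have "{..<2 ^ N} = insert 0 {1..std_size N}"
    unfolding Suc_std_size[symmetric] by auto
  then have "(\<Sum>i<2 ^ N. (bd (std_size N) x i - bd (std_size N) y i)\<^sup>2) / 2 ^ N =
    (\<Sum>i=1..std_size N. (bd (std_size N) x i - bd (std_size N) y i)\<^sup>2) / 2 ^ N"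
    by (simp add: bd_def)
  also have "\<dots> = (\<Sum>i=1..std_size N. \<bar>x i - y i\<bar>\<^sup>2 * \<bar>std_partition N (i + 1) - std_partition N i\<bar>)"
    unfolding sum_divide_distrib
    by (intro sum.cong refl) (auto simp: bd_def std_partition_def diff_divide_distrib[symmetric])
  finally show ?thesis
    by (simp add: L2_dist_sq_dist dyadic_step_in_G0 x y sq_dist_dyadic_step partition_dist_def)
qed

text \<open>Since both functions take values in \<open>[0,1]\<close>, the squared distance is at most the \<open>L\<^sup>1\<close>
  distance, which telescopes by monotonicity of \<open>g\<close>.\<close>

lemma sq_dist_dyadic_approx:
  assumes g: "g \<in> G0" and x: "nondecreasing_point (std_size N) x"
    and near: "\<And>i. i \<in> {1..std_size N} \<Longrightarrow> \<bar>x i - g (std_partition N i)\<bar> \<le> \<delta>" and \<delta>: "\<delta> \<ge> 0"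
  shows "sq_dist g (dyadic_step N x) \<le> \<delta> + 1 / 2 ^ N"
proof -
  have S: "std_size N + 1 = 2 ^ N" using Suc_std_size[of N] by simp
  have g1: "g (std_partition N (2 ^ N)) = 1" by (simp add: std_partition_def G0_at_1[OF g])
  \<comment> \<open>\<open>G\<close> is 0 at index 0 even if \<open>g 0 > 0\<close>, as is the step
    function. The telescoping sum of its increments is therefore exactly 1, and a jump of
    \<open>g\<close> at 0 is accounted for.\<close>
  define G where "G = bd (std_size N) (dyadic_sample N g)"
  have G: "G i = (if i = 0 then 0 else g (std_partition N i))" if "i \<le> 2 ^ N" for i
    using that S g1 by (auto simp: G_def bd_def dyadic_sample_def)
  have "sq_dist g (dyadic_step N x) \<le> (LINT s:{0..1::real}|lborel. (\<lambda>i. \<delta> + (G (Suc i) - G i)) (nat \<lfloor>2 ^ N * s\<rfloor>))"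
    unfolding sq_dist_def set_lebesgue_integral_def
  proof (rule integral_mono_AE)
    show "integrable lborel (\<lambda>t. indicat_real {0..1} t *\<^sub>R (ext g t - ext (dyadic_step N x) t)\<^sup>2)"
      using set_integrable_ext_diff[OF g dyadic_step_in_G0[OF x]] by (simp add: set_integrable_def)
    define C where "C = (\<Sum>i\<le>2 ^ N. \<bar>\<delta> + (G (Suc i) - G i)\<bar>)"
    have "set_integrable lborel {0..1} (\<lambda>s::real. \<delta> + (G (Suc (nat \<lfloor>2 ^ N * s\<rfloor>)) - G (nat \<lfloor>2 ^ N * s\<rfloor>)))"
    proof (rule set_integrable_unit_bounded)
      fix s :: real assume "s \<in> {0..1}"
      then show "\<bar>\<delta> + (G (Suc (nat \<lfloor>2 ^ N * s\<rfloor>)) - G (nat \<lfloor>2 ^ N * s\<rfloor>))\<bar> \<le> C"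
        unfolding C_def using dyadic_index_le[of s N]
        by (intro member_le_sum[where f = "\<lambda>i. \<bar>\<delta> + (G (Suc i) - G i)\<bar>"]) auto
    qed measurable
    then show "integrable lborel (\<lambda>s::real. indicat_real {0..1} s *\<^sub>R (\<lambda>i. \<delta> + (G (Suc i) - G i)) (nat \<lfloor>2 ^ N * s\<rfloor>))"
      by (simp add: set_integrable_def)
    show "AE t in lborel. indicat_real {0..1} t *\<^sub>R (ext g t - ext (dyadic_step N x) t)\<^sup>2
       \<le> indicat_real {0..1} t *\<^sub>R (\<lambda>i. \<delta> + (G (Suc i) - G i)) (nat \<lfloor>2 ^ N * t\<rfloor>)"
      using AE_lborel_singleton[of 1]
    proof eventually_elim
      case (elim t)
      show ?case
      proof (cases "t \<in> {0..<1}")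
        case t: True
        define i where "i = nat \<lfloor>2 ^ N * t\<rfloor>"
        have i: "i < 2 ^ N" using dyadic_index_less[OF t] by (simp add: i_def)
        have ti: "t \<in> {std_partition N i..<std_partition N (Suc i)}"
          using dyadic_index_iff[of t N i] t by (auto simp: i_def)
        have b: "std_partition N i \<in> {0..1}" "std_partition N (Suc i) \<in> {0..1}"
          using i by (auto intro!: std_partition_bounds simp del: atLeastAtMost_iff)
        have "g t \<le> G (Suc i)" using G0_mono[OF g, of t "std_partition N (Suc i)"] t ti b i by (auto simp: G)
        moreover have "G i \<le> g t"
          using G0_mono[OF g, of "std_partition N i" t] G0_bounds[OF g, of t] t ti b i by (auto simp: G)
        moreover have "\<bar>G i - bd (std_size N) x i\<bar> \<le> \<delta>"
          using near[of i] i S \<delta> by (auto simp: G bd_def abs_minus_commute)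
        ultimately have d: "\<bar>g t - bd (std_size N) x i\<bar> \<le> \<delta> + (G (Suc i) - G i)" by linarith
        have "bd (std_size N) x i \<in> {0..1}" by (rule nondecreasing_point_bounds[OF x]) (use i S in auto)
        then have "\<bar>g t - bd (std_size N) x i\<bar> \<le> 1" using G0_bounds[OF g, of t] t by auto
        then have "(g t - bd (std_size N) x i)\<^sup>2 \<le> \<bar>g t - bd (std_size N) x i\<bar>"
          using power_decreasing[of 1 2 "\<bar>g t - bd (std_size N) x i\<bar>"] by simp
        with d show ?thesis
          using t x by (simp add: ext_eq g ext_dyadic_step i_def)
      qed (use elim in auto)
    qed
  qed
  also have "\<dots> = (\<Sum>i<2 ^ N. \<delta> + (G (Suc i) - G i)) / 2 ^ N"
    by (rule integral_dyadic)
  also have "(\<Sum>i<2 ^ N. \<delta> + (G (Suc i) - G i)) = 2 ^ N * \<delta> + (G (2 ^ N) - G 0)"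
    by (simp only: sum.distrib sum_lessThan_telescope) simp
  also have "\<dots> = 2 ^ N * \<delta> + 1" using g1 by (simp add: G)
  finally show ?thesis by (simp add: add_divide_distrib)
qed

lemma nondecreasing_dyadic_sample:
  assumes g: "g \<in> G0"
  shows "nondecreasing_point (std_size N) (dyadic_sample N g)"
  unfolding nondecreasing_point_def
proof (intro allI impI)
  fix i assume i: "i \<le> std_size N"
  have b: "std_partition N j \<in> {0..1}" if "j \<le> Suc (std_size N)" for j
    using std_partition_bounds[of j N] that by (simp add: Suc_std_size)
  have "std_partition N i \<le> std_partition N (Suc i)" by (auto simp: std_partition_def divide_right_mono)
  then have "g (std_partition N i) \<le> g (std_partition N (Suc i))"
    using b[of i] b[of "Suc i"] i by (intro G0_mono[OF g]) auto
  then show "bd (std_size N) (dyadic_sample N g) i \<le> bd (std_size N) (dyadic_sample N g) (i + 1)"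
    using i G0_bounds[OF g b[of i]] G0_bounds[OF g b[of "Suc i"]]
    by (auto simp: bd_def dyadic_sample_def)
qed

lemma dyadic_sample_step_G0: "g \<in> G0 \<Longrightarrow> dyadic_step N (dyadic_sample N g) \<in> G0"
  by (intro dyadic_step_in_G0 nondecreasing_dyadic_sample)

lemma sq_dist_dyadic_sample:
  "g \<in> G0 \<Longrightarrow> sq_dist g (dyadic_step N (dyadic_sample N g)) \<le> 1 / 2 ^ N"
  using sq_dist_dyadic_approx[OF _ nondecreasing_dyadic_sample, of g g N 0] by (auto simp: dyadic_sample_def)

lemma L2_dist_dyadic_sample:
  "g \<in> G0 \<Longrightarrow> L2_dist g (dyadic_step N (dyadic_sample N g)) \<le> sqrt (1 / 2 ^ N)"
  using sq_dist_dyadic_sample[of g N] by (simp add: L2_dist_sq_dist dyadic_sample_step_G0)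

lemma sqrt_half_power_tendsto: "(\<lambda>N. sqrt (c / 2 ^ N)) \<longlonglongrightarrow> 0"
proof -
  have "(\<lambda>N. c / 2 ^ N :: real) \<longlonglongrightarrow> 0"
    by (rule LIMSEQ_divide_realpow_zero) simp
  from tendsto_real_sqrt[OF this] show ?thesis by simp
qed

section \<open>Separability and measurable maps into \<open>G0\<close>\<close>

definition G0_net :: "(real \<Rightarrow> real) set" where
  "G0_net = (\<Union>N. dyadic_step N ` ({1..std_size N} \<rightarrow>\<^sub>E \<rat>)) \<inter> G0"

lemma countable_G0_net: "countable G0_net"
  unfolding G0_net_def by (intro countable_Int1 countable_UN countable_image countable_PiE) (auto simp: countable_rat)

lemma dense_G0_net:
  assumes g: "g \<in> G0" and e: "e > 0"
  shows "\<exists>f\<in>G0_net. L2_dist f g < e"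
proof -
  have "eventually (\<lambda>N. sqrt (2 / 2 ^ N) < e) sequentially"
    using order_tendstoD(2)[OF sqrt_half_power_tendsto e] .
  then obtain N where N: "sqrt (2 / 2 ^ N) < e" by (auto simp: eventually_sequentially)
  \<comment> \<open>Rounding down to multiples of \<open>1 / 2 ^ N\<close> is monotone and fixes 0
    and 1, so the rounded sample stays nondecreasing. It moves each value by at most
    \<open>1 / 2 ^ N\<close>, the same amount as the discretisation error; hence the numerator
    2.\<close>
  define x where "x = (\<lambda>i\<in>{1..std_size N}. of_int \<lfloor>2 ^ N * g (std_partition N i)\<rfloor> / 2 ^ N :: real)"
  let ?r = "\<lambda>y::real. of_int \<lfloor>2 ^ N * y\<rfloor> / 2 ^ N :: real"
  have r: "?r y \<le> ?r z" if "y \<le> z" for y z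
    using that by (intro divide_right_mono) (auto intro!: floor_mono)
  have r01: "?r 0 = 0" "?r 1 = 1" by auto
  have bd: "bd (std_size N) x i = ?r (bd (std_size N) (dyadic_sample N g) i)" if "i \<le> std_size N + 1" for i
    using that r01 by (auto simp: bd_def x_def dyadic_sample_def)
  have x: "nondecreasing_point (std_size N) x"
    using nondecreasing_dyadic_sample[OF g, of N] r
    unfolding nondecreasing_point_def by (auto simp: bd)
  have near: "\<bar>x i - g (std_partition N i)\<bar> \<le> 1 / 2 ^ N" if "i \<in> {1..std_size N}" for i
  proof -
    let ?y = "g (std_partition N i)"
    have "\<bar>of_int \<lfloor>2 ^ N * ?y\<rfloor> - 2 ^ N * ?y\<bar> \<le> 1" by linarith
    then have "\<bar>of_int \<lfloor>2 ^ N * ?y\<rfloor> - 2 ^ N * ?y\<bar> / 2 ^ N \<le> 1 / 2 ^ N" by (intro divide_right_mono) auto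
    also have "\<bar>of_int \<lfloor>2 ^ N * ?y\<rfloor> - 2 ^ N * ?y\<bar> / 2 ^ N = \<bar>?r ?y - ?y\<bar>"
    proof -
      have "?r ?y - ?y = (of_int \<lfloor>2 ^ N * ?y\<rfloor> - 2 ^ N * ?y) / 2 ^ N" by (simp add: diff_divide_distrib)
      then show ?thesis by (simp only: abs_divide) simp
    qed
    finally show ?thesis using that by (simp add: x_def)
  qed
  have "sq_dist g (dyadic_step N x) \<le> 2 / 2 ^ N"
    using sq_dist_dyadic_approx[OF g x near] by simp
  then have "L2_dist (dyadic_step N x) g \<le> sqrt (2 / 2 ^ N)"
    using g dyadic_step_in_G0[OF x] by (simp add: L2_dist_sq_dist sq_dist_commute)
  moreover have "dyadic_step N x \<in> G0_net"
    unfolding G0_net_def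
  proof (intro IntI UN_I[of N] imageI)
    show "x \<in> {1..std_size N} \<rightarrow>\<^sub>E \<rat>" by (auto simp: x_def)
  qed (use dyadic_step_in_G0[OF x] in auto)
  ultimately show ?thesis using N by (intro bexI[of _ "dyadic_step N x"]) auto
qed

text \<open>Discretisation moves each function by at most \<open>sqrt (1 / 2 ^ N)\<close>, so the
  distance is a limit of expressions in finitely many dyadic values.\<close>

lemma L2_dist_dyadic_limit:
  assumes f: "f \<in> G0" and g: "g \<in> G0"
  shows "(\<lambda>N. partition_dist (std_size N) (std_partition N) (dyadic_sample N f) (dyadic_sample N g)) \<longlonglongrightarrow> L2_dist f g"
proof (rule LIM_zero_cancel, rule tendsto_0_le[where K = 2])
  interpret Metric_space G0 L2_dist by (rule Metric_space_G0)
  show "\<forall>\<^sub>F N in sequentially. norm (partition_dist (std_size N) (std_partition N) (dyadic_sample N f) (dyadic_sample N g) - L2_dist f g)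
     \<le> norm (sqrt (1 / 2 ^ N)) * 2"
  proof (intro always_eventually allI)
    fix N
    let ?p = "\<lambda>g. dyadic_step N (dyadic_sample N g)"
    have p: "?p f \<in> G0" "?p g \<in> G0" using f g by (auto intro: dyadic_sample_step_G0)
    have "L2_dist (?p f) (?p g) \<le> L2_dist (?p f) f + L2_dist f g + L2_dist g (?p g)"
      "L2_dist f g \<le> L2_dist f (?p f) + L2_dist (?p f) (?p g) + L2_dist (?p g) g"
      using triangle[OF p(1) f p(2)] triangle[OF f g p(2)] triangle[OF f p(1) g] triangle[OF p(1) p(2) g] by auto
    then have "\<bar>L2_dist (?p f) (?p g) - L2_dist f g\<bar> \<le> 2 * sqrt (1 / 2 ^ N)"
      using L2_dist_dyadic_sample[OF f, of N] L2_dist_dyadic_sample[OF g, of N] commute[of "?p f" f] commute[of "?p g" g]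
      by linarith
    then show "norm (partition_dist (std_size N) (std_partition N) (dyadic_sample N f) (dyadic_sample N g) - L2_dist f g)
     \<le> norm (sqrt (1 / 2 ^ N)) * 2"
      by (subst L2_dist_dyadic_step[symmetric]) (auto simp: nondecreasing_dyadic_sample f g)
  qed
  show "(\<lambda>N. sqrt (1 / 2 ^ N)) \<longlonglongrightarrow> 0" by (rule sqrt_half_power_tendsto)
qed

text \<open>Separability reduces the claim to distances from the points of a countable net, and each
  such distance is a limit of functions of the dyadic values of \<open>f\<close>.\<close>

lemma measurable_into_G0:
  assumes f: "f \<in> space M \<rightarrow> G0"
    and meas: "\<And>N i. i \<in> {1..std_size N} \<Longrightarrow> (\<lambda>\<omega>. f \<omega> (std_partition N i)) \<in> borel_measurable M"
  shows "f \<in> measurable M (metric_borel G0 L2_dist)"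
proof (rule measurable_metric_borel[OF Metric_space_G0 _ countable_G0_net dense_G0_net f])
  show "G0_net \<subseteq> G0" by (simp add: G0_net_def)
  fix y assume "y \<in> G0_net"
  then have y: "y \<in> G0" by (simp add: G0_net_def)
  show "(\<lambda>\<omega>. L2_dist y (f \<omega>)) \<in> borel_measurable M"
  proof (rule borel_measurable_LIMSEQ_real)
    show "(\<lambda>N. partition_dist (std_size N) (std_partition N) (dyadic_sample N y) (dyadic_sample N (f \<omega>))) \<longlonglongrightarrow> L2_dist y (f \<omega>)"
      if "\<omega> \<in> space M" for \<omega>
      using f that by (intro L2_dist_dyadic_limit y) auto
    show "(\<lambda>\<omega>. partition_dist (std_size N) (std_partition N) (dyadic_sample N y) (dyadic_sample N (f \<omega>))) \<in> borel_measurable M" for N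
    proof -
      have [measurable]: "(\<lambda>\<omega>. dyadic_sample N (f \<omega>) i) \<in> borel_measurable M" if "i \<in> {1..std_size N}" for i
        using meas[OF that] that by (simp add: dyadic_sample_def)
      show ?thesis
        unfolding partition_dist_def by measurable
    qed
  qed
qed

section \<open>The entropic measure\<close>

text \<open>The value at 1 is prescribed because the total stick mass can be smaller than 1, for
  instance if all sticks vanish. In this way every path lies in \<open>G0\<close>, and the values at
  interior partition points are unaffected.\<close>

definition entropic_path :: "(real \<times> real) stream \<Rightarrow> real \<Rightarrow> real" where
  "entropic_path \<omega> = (\<lambda>s\<in>{0..1}. if s < 1 then stick_mass {0<..s} \<omega> else 1)"

text \<open>Tannery's theorem, with the stick weights as summable majorant. Each summand is
  eventually constant as \<open>s\<close> decreases to \<open>t\<close>: an atom at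
  \<open>u \<le> t\<close> stays counted, and an atom at \<open>u > t\<close> is not counted until
  \<open>s\<close> reaches \<open>u\<close>.\<close>

lemma stick_mass_right_continuous:
  "((\<lambda>s. stick_mass {0<..s} \<omega>) \<longlongrightarrow> stick_mass {0<..t} \<omega>) (at_right t)"
proof -
  have lim: "((\<lambda>s. stick_weight \<omega> k * indicator {0<..s} (snd (\<omega> !! k))) \<longlongrightarrow>
      stick_weight \<omega> k * indicator {0<..t} (snd (\<omega> !! k))) (at_right t)" for k
  proof (intro tendsto_mult tendsto_const tendsto_eventually)
    let ?u = "snd (\<omega> !! k)"
    show "\<forall>\<^sub>F s in at_right t. indicator {0<..s} ?u = indicator {0<..t} ?u"
      unfolding eventually_at_right_field
      by (rule exI[of _ "if ?u \<le> t then t + 1 else ?u"]) (auto simp: indicator_def)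
  qed
  have bound: "\<forall>\<^sub>F (k, s) in at_top \<times>\<^sub>F at_right t.
      norm (stick_weight \<omega> k * indicator {0<..s} (snd (\<omega> !! k))) \<le> stick_weight \<omega> k"
    by (intro always_eventually) (auto simp: stick_weight_nonneg indicator_def)
  show ?thesis
    unfolding stick_mass_def
    using tannerys_theorem[where a = "\<lambda>k s. stick_weight \<omega> k * indicator {0<..s} (snd (\<omega> !! k))",
      OF lim bound summable_stick_weight] by simp
qed

lemma entropic_path_in_G0: "entropic_path \<omega> \<in> G0"
proof -
  have "continuous (at_right t) (entropic_path \<omega>)" if t: "t \<in> {0..<1}" for t
  proof -
    have "eventually (\<lambda>s. stick_mass {0<..s} \<omega> = entropic_path \<omega> s) (at_right t)"
      unfolding eventually_at_right_field using t by (intro exI[of _ 1]) (auto simp: entropic_path_def)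
    from tendsto_cong[OF this] stick_mass_right_continuous[of \<omega> t]
    have "(entropic_path \<omega> \<longlongrightarrow> stick_mass {0<..t} \<omega>) (at_right t)" by blast
    then show ?thesis using t by (simp add: continuous_within entropic_path_def[of \<omega>])
  qed
  moreover have "mono_on {0..1} (entropic_path \<omega>)"
    by (auto intro!: mono_onI simp: entropic_path_def stick_mass_le_1 intro!: stick_mass_mono)
  moreover have "entropic_path \<omega> \<in> {0..1} \<rightarrow>\<^sub>E {0..1}"
    by (auto simp: entropic_path_def PiE_iff stick_mass_nonneg stick_mass_le_1)
  ultimately show ?thesis by (auto simp: G0_def entropic_path_def)
qed

lemma std_partition_inner: "i \<in> {1..std_size N} \<Longrightarrow> std_partition N i \<in> {0<..<1}"
proof -
  assume i: "i \<in> {1..std_size N}"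
  then have "i < 2 ^ N" using Suc_std_size[of N] by simp
  then have "real i < 2 ^ N" by (metis of_nat_less_iff of_nat_numeral of_nat_power)
  then show ?thesis using i by (simp add: std_partition_def)
qed

lemma measurable_entropic_path:
  "entropic_path \<in> measurable (stream_space (stick_base \<beta>)) (metric_borel G0 L2_dist)"
proof (rule measurable_into_G0)
  show "entropic_path \<in> space (stream_space (stick_base \<beta>)) \<rightarrow> G0"
    by (auto simp: entropic_path_in_G0)
  fix N i assume "i \<in> {1..std_size N}"
  then have "(\<lambda>\<omega>. entropic_path \<omega> (std_partition N i)) = stick_mass {0<..std_partition N i}"
    using std_partition_inner[of i N] by (auto simp: entropic_path_def)
  then show "(\<lambda>\<omega>. entropic_path \<omega> (std_partition N i)) \<in> borel_measurable (stream_space (stick_base \<beta>))"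
    by simp
qed

definition entropic_measure :: "real \<Rightarrow> (real \<Rightarrow> real) measure" where
  "entropic_measure \<beta> = distr (stream_space (stick_base \<beta>)) (metric_borel G0 L2_dist) entropic_path"

abbreviation sample_at :: "nat \<Rightarrow> (nat \<Rightarrow> real) \<Rightarrow> (real \<Rightarrow> real) \<Rightarrow> nat \<Rightarrow> real" where
  "sample_at N t g \<equiv> (\<lambda>i\<in>{1..N}. g (t i))"

lemma measurable_sample_at:
  assumes "is_partition N t"
  shows "sample_at N t \<in> measurable (metric_borel G0 L2_dist) (\<Pi>\<^sub>M i\<in>{1..N}. borel)"
  using partition_inner[OF assms]
  by (intro measurable_restrict measurable_eval_G0) (force simp del: One_nat_def)

lemma measurable_sample_at_unit:
  assumes "is_partition N t"
  shows "sample_at N t \<in> measurable (metric_borel G0 L2_dist) (\<Pi>\<^sub>M i\<in>{1..N}. restrict_space borel {0..1})"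
proof (intro measurable_restrict measurable_restrict_space2)
  fix i assume "i \<in> {1..N}"
  then have t: "t i \<in> {0..1}" using partition_inner[OF assms, of i] by auto
  show "(\<lambda>g. g (t i)) \<in> space (metric_borel G0 L2_dist) \<rightarrow> {0..1}"
    using G0_bounds[OF _ t] by (auto simp: space_metric_borel[OF Metric_space_G0])
  show "(\<lambda>g. g (t i)) \<in> borel_measurable (metric_borel G0 L2_dist)"
    by (rule measurable_eval_G0[OF t])
qed

text \<open>A retraction of R^N onto the cube, through which test functions on the cube become
  functions on R^N.\<close>

lemma measurable_clamp_cube:
  "(\<lambda>x. \<lambda>i\<in>{1..N}. clamp01 (x i)) \<in> measurable (\<Pi>\<^sub>M i\<in>{1..N}. borel) (\<Pi>\<^sub>M i\<in>{1..N}. restrict_space borel {0..1})"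
  by (intro measurable_restrict measurable_restrict_space2 measurable_compose[OF _ measurable_clamp01]
       measurable_component_singleton) (auto simp: clamp01_bounds)

lemma clamp_cube_id: "x \<in> {1..N} \<rightarrow>\<^sub>E {0..1} \<Longrightarrow> (\<lambda>i\<in>{1..N}. clamp01 (x i)) = x"
  by (auto simp: fun_eq_iff PiE_iff extensional_def clamp01_id)

lemma dirichlet_integral_cube:
  assumes u: "u \<in> borel_measurable (\<Pi>\<^sub>M i\<in>{1..N}. restrict_space borel {0..1})"
    and part: "is_partition N t" and \<beta>: "\<beta> > 0"
  shows "dirichlet_integral \<beta> N t u = (LINT x|dirichlet_measure \<beta> N t. u (\<lambda>i\<in>{1..N}. clamp01 (x i)))"
proof (rule dirichlet_integral_eq[OF _ _ \<beta>])
  show "(\<lambda>x. u (\<lambda>i\<in>{1..N}. clamp01 (x i))) \<in> borel_measurable (\<Pi>\<^sub>M i\<in>{1..N}. borel)"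
    by (rule measurable_compose[OF measurable_clamp_cube u])
  show "u x = u (\<lambda>i\<in>{1..N}. clamp01 (x i))" if "x \<in> simplex_set N" for x
    using that by (subst clamp_cube_id) (auto simp: simplex_set_def)
  show "t i < t (i + 1)" if "i \<le> N" for i using part that by (simp add: is_partition_def)
qed

lemma is_entropic_measure_exists:
  assumes \<beta>: "\<beta> > 0"
  shows "is_entropic_measure \<beta> (entropic_measure \<beta>)"
  unfolding is_entropic_measure_def
proof (intro conjI allI impI; (elim conjE)?)
  interpret base: prob_space "stick_base \<beta>" using \<beta> by (rule prob_space_stick_base)
  interpret S: prob_space "stream_space (stick_base \<beta>)" by (rule base.prob_space_stream_space)
  show "borel_prob_on G0 L2_dist (entropic_measure \<beta>)"
    by (auto simp: borel_prob_on_def borel_measure_on_def entropic_measure_def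
      intro!: Metric_space_G0 S.prob_space_distr measurable_entropic_path)
  fix N t and u :: "(nat \<Rightarrow> real) \<Rightarrow> real"
  assume part: "is_partition N t"
    and u: "u \<in> borel_measurable (\<Pi>\<^sub>M i\<in>{1..N}. restrict_space borel {0..1})"
  let ?c = "\<lambda>x. \<lambda>i\<in>{1..N}. clamp01 (x i)"
  have uc: "(\<lambda>x. u (?c x)) \<in> borel_measurable (\<Pi>\<^sub>M i\<in>{1..N}. borel)"
    by (rule measurable_compose[OF measurable_clamp_cube u])
  have mass: "(\<lambda>\<omega>. \<lambda>i\<in>{1..N}. stick_mass {0<..t i} \<omega>) \<in> measurable (stream_space (stick_base \<beta>)) (\<Pi>\<^sub>M i\<in>{1..N}. borel)"
    by (intro measurable_restrict measurable_stick_mass) auto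
  have "(LINT g|entropic_measure \<beta>. u (sample_at N t g)) = (LINT \<omega>|stream_space (stick_base \<beta>). u (sample_at N t (entropic_path \<omega>)))"
    unfolding entropic_measure_def
    by (rule integral_distr[OF measurable_entropic_path measurable_compose[OF measurable_sample_at_unit[OF part] u]])
  also have "\<dots> = (LINT \<omega>|stream_space (stick_base \<beta>). u (?c (\<lambda>i\<in>{1..N}. stick_mass {0<..t i} \<omega>)))"
  proof (intro Bochner_Integration.integral_cong refl arg_cong[where f = u] ext)
    fix \<omega> i
    show "sample_at N t (entropic_path \<omega>) i = ?c (\<lambda>i\<in>{1..N}. stick_mass {0<..t i} \<omega>) i"
      using partition_inner[OF part, of i]
      by (auto simp: entropic_path_def clamp01_id stick_mass_nonneg stick_mass_le_1)
  qed
  also have "\<dots> = (LINT x|distr (stream_space (stick_base \<beta>)) (\<Pi>\<^sub>M i\<in>{1..N}. borel) (\<lambda>\<omega>. \<lambda>i\<in>{1..N}. stick_mass {0<..t i} \<omega>). u (?c x))"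
    by (rule integral_distr[OF mass uc, symmetric])
  also have "\<dots> = dirichlet_integral \<beta> N t u"
    by (simp only: dirichlet_measure_eq_distr_stick[OF part \<beta>] dirichlet_integral_cube[OF u part \<beta>])
  finally show "(LINT g|entropic_measure \<beta>. u (sample_at N t g)) = dirichlet_integral \<beta> N t u" .
qed

text \<open>Turns the defining integral identities into an equality of measures: products of ramps
  are bounded measurable test functions, and they determine a finite measure.\<close>

lemma entropic_measure_law:
  assumes Q: "is_entropic_measure \<beta> Q" and part: "is_partition N t" and \<beta>: "\<beta> > 0"
  shows "distr Q (\<Pi>\<^sub>M i\<in>{1..N}. borel) (sample_at N t) = dirichlet_measure \<beta> N t"
proof (rule measure_eqI_PiM_ramp[where I = "{1..N}"])
  have sets_Q: "sets Q = sets (metric_borel G0 L2_dist)" and "prob_space Q"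
    using Q by (auto simp: is_entropic_measure_def borel_prob_on_def borel_measure_on_def)
  interpret prob_space Q by fact
  interpret D: prob_space "dirichlet_measure \<beta> N t" by (rule prob_space_dirichlet_measure[OF part \<beta>])
  have m: "sample_at N t \<in> measurable Q (\<Pi>\<^sub>M i\<in>{1..N}. borel)"
    unfolding measurable_cong_sets[OF sets_Q refl] by (rule measurable_sample_at[OF part])
  show "finite_measure (distr Q (\<Pi>\<^sub>M i\<in>{1..N}. borel) (sample_at N t))"
    by (rule finite_measure_distr[OF m])
  show "finite_measure (dirichlet_measure \<beta> N t)" by (rule D.finite_measure_axioms)
  fix c n
  let ?u = "\<lambda>x. \<Prod>i\<in>{1..N}. ramp (c i) n (x i)"
  have u: "?u \<in> borel_measurable (\<Pi>\<^sub>M i\<in>{1..N}. borel)" by measurable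
  have "(\<lambda>x. x i) \<in> borel_measurable (\<Pi>\<^sub>M i\<in>{1..N}. restrict_space borel {0..1::real})" if "i \<in> {1..N}" for i
    by (rule measurable_compose[OF measurable_component_singleton[OF that] measurable_restrict_space1[OF measurable_ident_sets[OF refl]]])
  then have u': "?u \<in> borel_measurable (\<Pi>\<^sub>M i\<in>{1..N}. restrict_space borel {0..1})"
    by (intro borel_measurable_prod measurable_compose[OF _ measurable_ramp])
  have "bounded (?u ` ({1..N} \<rightarrow>\<^sub>E {0..1}))"
    by (rule boundedI[where B = 1]) (auto simp: ramp_prod_bounds)
  then have "(LINT g|Q. ?u (sample_at N t g)) = dirichlet_integral \<beta> N t ?u"
    using Q part u' unfolding is_entropic_measure_def by blast
  also have "\<dots> = (LINT x|dirichlet_measure \<beta> N t. ?u x)"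
    using part by (intro dirichlet_integral_eq[OF u _ \<beta>]) (auto simp: is_partition_def)
  finally show "(LINT x|distr Q (\<Pi>\<^sub>M i\<in>{1..N}. borel) (sample_at N t). ?u x) = (LINT x|dirichlet_measure \<beta> N t. ?u x)"
    by (subst integral_distr[OF m u])
qed (auto simp: sets_dirichlet_measure)

section \<open>A generating pi-system of dyadic boxes\<close>

definition dyadic_box :: "nat \<Rightarrow> (real \<Rightarrow> real) \<Rightarrow> (real \<Rightarrow> real) set" where
  "dyadic_box N c = {g\<in>G0. \<forall>i\<in>{1..std_size N}. g (std_partition N i) \<le> c (std_partition N i)}"

definition dyadic_boxes :: "(real \<Rightarrow> real) set set" where
  "dyadic_boxes = {dyadic_box N c | N c. N \<ge> 1}"

text \<open>Dyadic grids are nested: point \<open>i\<close> of level \<open>N\<close> is point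
  \<open>i * 2 ^ (M - N)\<close> of level \<open>M\<close>. The bound of a box is a function of the
  grid point and not of its index, so it keeps its meaning at the finer level; points new at level
  \<open>M\<close> are constrained by \<open>d\<close> alone.\<close>

lemma Int_dyadic_box:
  assumes "N \<le> M"
  shows "dyadic_box N c \<inter> dyadic_box M d =
    dyadic_box M (\<lambda>q. if q \<in> std_partition N ` {1..std_size N} then min (c q) (d q) else d q)"
proof -
  have refine: "\<exists>j\<in>{1..std_size M}. std_partition M j = std_partition N i" if i: "i \<in> {1..std_size N}" for i
  proof (intro bexI[of _ "i * 2 ^ (M - N)"])
    have "i + 1 \<le> 2 ^ N" using i Suc_std_size[of N] by simp
    then have "(i + 1) * 2 ^ (M - N) \<le> 2 ^ N * 2 ^ (M - N)" by (rule mult_right_mono) simp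
    also have "\<dots> = Suc (std_size M)" using assms by (simp add: Suc_std_size power_add[symmetric])
    finally have "i * 2 ^ (M - N) + 2 ^ (M - N) \<le> Suc (std_size M)" by simp
    moreover have "(1::nat) \<le> 2 ^ (M - N)" by simp
    ultimately have "i * 2 ^ (M - N) \<le> std_size M" by linarith
    then show "i * 2 ^ (M - N) \<in> {1..std_size M}" using i by simp
    have "(2::real) ^ M = 2 ^ N * 2 ^ (M - N)" using assms by (simp add: power_add[symmetric])
    then show "std_partition M (i * 2 ^ (M - N)) = std_partition N i"
      by (simp add: std_partition_def)
  qed
  show ?thesis
  proof (intro equalityI subsetI)
    fix g assume "g \<in> dyadic_box N c \<inter> dyadic_box M d"
    then show "g \<in> dyadic_box M (\<lambda>q. if q \<in> std_partition N ` {1..std_size N} then min (c q) (d q) else d q)"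
      by (auto simp: dyadic_box_def)
  next
    fix g assume g: "g \<in> dyadic_box M (\<lambda>q. if q \<in> std_partition N ` {1..std_size N} then min (c q) (d q) else d q)"
    have "g (std_partition N i) \<le> c (std_partition N i)" if i: "i \<in> {1..std_size N}" for i
    proof -
      obtain j where "j \<in> {1..std_size M}" "std_partition M j = std_partition N i" using refine[OF i] by blast
      moreover have "std_partition N i \<in> std_partition N ` {1..std_size N}" using i by blast
      ultimately show ?thesis using g by (auto simp: dyadic_box_def dest!: bspec[of _ _ j] split: if_splits)
    qed
    moreover have "g (std_partition M j) \<le> d (std_partition M j)" if j: "j \<in> {1..std_size M}" for j
      using g j by (auto simp: dyadic_box_def split: if_splits)
    ultimately show "g \<in> dyadic_box N c \<inter> dyadic_box M d"
      using g by (auto simp: dyadic_box_def)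
  qed
qed

lemma Int_stable_dyadic_boxes: "Int_stable dyadic_boxes"
proof (rule Int_stableI)
  fix A B assume "A \<in> dyadic_boxes" "B \<in> dyadic_boxes"
  then obtain N c M d where *: "A = dyadic_box N c" "B = dyadic_box M d" "N \<ge> 1" "M \<ge> 1"
    by (auto simp: dyadic_boxes_def)
  show "A \<inter> B \<in> dyadic_boxes"
  proof (cases "N \<le> M")
    case True
    from Int_dyadic_box[OF this, of c d] * show ?thesis unfolding dyadic_boxes_def by blast
  next
    case False
    then have "M \<le> N" by simp
    from Int_dyadic_box[OF this, of d c] * show ?thesis unfolding dyadic_boxes_def by (subst Int_commute) blast
  qed
qed

lemma dyadic_boxes_subset_Pow: "dyadic_boxes \<subseteq> Pow G0"
  by (auto simp: dyadic_boxes_def dyadic_box_def)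

lemma G0_eq_dyadic_box: "G0 = dyadic_box 1 (\<lambda>_. 1)"
proof -
  have "g (std_partition 1 i) \<le> 1" if "g \<in> G0" "i \<in> {1..std_size 1}" for g i
    using G0_bounds[OF that(1), of "std_partition 1 i"] std_partition_inner[OF that(2)] by simp
  then show ?thesis by (auto simp: dyadic_box_def)
qed

text \<open>One inclusion is the measurability of evaluations. The other is
  \<open>measurable_into_G0\<close> for the identity map out of the sigma-algebra generated by the
  boxes.\<close>

lemma sets_metric_borel_G0: "sets (metric_borel G0 L2_dist) = sigma_sets G0 dyadic_boxes"
proof
  have sp: "space (metric_borel G0 L2_dist) = G0" by (rule space_metric_borel[OF Metric_space_G0])
  have "dyadic_box N c \<in> sets (metric_borel G0 L2_dist)" for N c
  proof -
    have [measurable]: "(\<lambda>g. g (std_partition N i)) \<in> borel_measurable (metric_borel G0 L2_dist)" if "i \<in> {1..std_size N}" for i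
      using std_partition_inner[OF that] by (intro measurable_eval_G0) auto
    have "{g\<in>space (metric_borel G0 L2_dist). \<forall>i\<in>{1..std_size N}. g (std_partition N i) \<le> c (std_partition N i)} \<in> sets (metric_borel G0 L2_dist)"
      by measurable
    then show ?thesis by (simp add: dyadic_box_def sp)
  qed
  then show "sigma_sets G0 dyadic_boxes \<subseteq> sets (metric_borel G0 L2_dist)"
    using sets.sigma_sets_subset[of dyadic_boxes "metric_borel G0 L2_dist"] by (auto simp: sp dyadic_boxes_def)
  let ?M = "sigma G0 dyadic_boxes"
  have spM: "space ?M = G0" and setsM: "sets ?M = sigma_sets G0 dyadic_boxes"
    by (simp_all add: space_measure_of sets_measure_of dyadic_boxes_subset_Pow)
  have "(\<lambda>g. g) \<in> measurable ?M (metric_borel G0 L2_dist)"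
  proof (rule measurable_into_G0)
    fix N i assume i: "i \<in> {1..std_size N}"
    then have N: "N \<ge> 1" by (cases N) (auto simp: std_size_def)
    show "(\<lambda>g. g (std_partition N i)) \<in> borel_measurable ?M"
      unfolding borel_measurable_iff_le
    proof
      fix c
      have "g (std_partition N j) \<le> 1" if "g \<in> G0" "j \<in> {1..std_size N}" for g j
        using G0_bounds[OF that(1), of "std_partition N j"] std_partition_inner[OF that(2)] by simp
      \<comment> \<open>The bound 1 imposes no constraint on functions in \<open>G0\<close>, so a
        condition on a single value is a box.\<close>
      then have "{g\<in>G0. g (std_partition N i) \<le> c} = dyadic_box N (\<lambda>q. if q = std_partition N i then c else 1)"
        using i by (auto simp: dyadic_box_def split: if_splits)
      also have "\<dots> \<in> sets ?M"
        unfolding setsM using N by (intro sigma_sets.Basic) (auto simp: dyadic_boxes_def)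
      finally show "{g \<in> space ?M. g (std_partition N i) \<le> c} \<in> sets ?M" by (simp add: spM)
    qed
  qed (simp add: spM)
  note id = this
  show "sets (metric_borel G0 L2_dist) \<subseteq> sigma_sets G0 dyadic_boxes"
  proof
    fix A assume A: "A \<in> sets (metric_borel G0 L2_dist)"
    then have "(\<lambda>g. g) -` A \<inter> space ?M \<in> sets ?M" by (rule measurable_sets[OF id])
    moreover have "(\<lambda>g. g) -` A \<inter> space ?M = A"
      using sets.sets_into_space[OF A] unfolding spM sp by blast
    ultimately show "A \<in> sigma_sets G0 dyadic_boxes" by (simp only: setsM)
  qed
qed

lemma is_entropic_measure_unique:
  assumes \<beta>: "\<beta> > 0" and Q: "is_entropic_measure \<beta> Q" "is_entropic_measure \<beta> Q'"
  shows "Q = Q'"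
proof (rule measure_eqI_generator_eq[OF Int_stable_dyadic_boxes dyadic_boxes_subset_Pow, where A = "\<lambda>_. G0"])
  have sets: "sets Q = sets (metric_borel G0 L2_dist)" "sets Q' = sets (metric_borel G0 L2_dist)"
    and "prob_space Q"
    using Q by (auto simp: is_entropic_measure_def borel_prob_on_def borel_measure_on_def)
  interpret prob_space Q by fact
  show "sets Q = sigma_sets G0 dyadic_boxes" "sets Q' = sigma_sets G0 dyadic_boxes"
    using sets sets_metric_borel_G0 by auto
  have box: "emeasure Q (dyadic_box N c) = emeasure (dirichlet_measure \<beta> (std_size N) (std_partition N)) (\<Pi>\<^sub>E i\<in>{1..std_size N}. {..c (std_partition N i)})"
    if Q: "is_entropic_measure \<beta> Q" and s: "sets Q = sets (metric_borel G0 L2_dist)" and N: "N \<ge> 1" for Q N c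
  proof -
    note part = is_partition_std[OF N]
    have m: "sample_at (std_size N) (std_partition N) \<in> measurable Q (\<Pi>\<^sub>M i\<in>{1..std_size N}. borel)"
      unfolding measurable_cong_sets[OF s refl] by (rule measurable_sample_at[OF part])
    have sp: "space Q = G0" using sets_eq_imp_space_eq[OF s] by (simp add: space_metric_borel[OF Metric_space_G0])
    have "dyadic_box N c = sample_at (std_size N) (std_partition N) -` (\<Pi>\<^sub>E i\<in>{1..std_size N}. {..c (std_partition N i)}) \<inter> space Q"
      by (auto simp: dyadic_box_def sp PiE_iff)
    then show ?thesis
      unfolding entropic_measure_law[OF Q part \<beta>, symmetric]
      by (subst emeasure_distr[OF m]) (auto intro!: sets_PiM_I_finite)
  qed
  show "emeasure Q X = emeasure Q' X" if "X \<in> dyadic_boxes" for X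
    using that box[OF Q(1) sets(1)] box[OF Q(2) sets(2)] by (auto simp: dyadic_boxes_def)
  show "range (\<lambda>_::nat. G0) \<subseteq> dyadic_boxes"
    using G0_eq_dyadic_box by (auto simp: dyadic_boxes_def)
  show "emeasure Q G0 \<noteq> \<infinity>" by simp
qed auto

section \<open>Dirichlet measures on the simplex\<close>

lemma partition_dist_L2_set:
  assumes "is_partition N t"
  shows "partition_dist N t x y = L2_set (\<lambda>i. \<bar>x i - y i\<bar> * sqrt (t (i + 1) - t i)) {1..N}"
  unfolding partition_dist_def L2_set_def
  using assms by (intro arg_cong[where f = sqrt] sum.cong refl)
    (auto simp: power_mult_distrib is_partition_def less_imp_le)

text \<open>As the gaps of a partition are positive, the metric controls every coordinate. This
  makes it separate points and makes the coordinates continuous.\<close>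

lemma coord_le_partition_dist:
  assumes part: "is_partition N t" and i: "i \<in> {1..N}"
  shows "\<bar>x i - y i\<bar> * sqrt (t (i + 1) - t i) \<le> partition_dist N t x y"
  unfolding partition_dist_L2_set[OF part]
  by (rule member_le_L2_set[of _ i "\<lambda>i. \<bar>x i - y i\<bar> * sqrt (t (i + 1) - t i)"]) (use i in auto)

lemma partition_gap: "is_partition N t \<Longrightarrow> i \<in> {1..N} \<Longrightarrow> t (i + 1) - t i > 0"
  by (auto simp: is_partition_def)

lemma Metric_space_simplex:
  assumes part: "is_partition N t"
  shows "Metric_space (simplex_set N) (partition_dist N t)"
proof
  show "0 \<le> partition_dist N t x y" for x y
    unfolding partition_dist_def by (auto intro!: sum_nonneg)
  show "partition_dist N t x y = partition_dist N t y x" for x y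
    unfolding partition_dist_def by (simp add: abs_minus_commute)
  show "partition_dist N t x y = 0 \<longleftrightarrow> x = y" if xy: "x \<in> simplex_set N" "y \<in> simplex_set N" for x y
  proof
    assume 0: "partition_dist N t x y = 0"
    have "x i = y i" if "i \<in> {1..N}" for i
    proof -
      have "\<bar>x i - y i\<bar> * sqrt (t (i + 1) - t i) \<le> 0"
        using coord_le_partition_dist[OF part that, of x y] 0 by simp
      then show ?thesis using partition_gap[OF part that] by (simp add: mult_le_0_iff)
    qed
    moreover have "x \<in> extensional {1..N}" "y \<in> extensional {1..N}" using xy by (auto simp: simplex_set_def PiE_def)
    ultimately show "x = y" by (intro extensionalityI[of _ "{1..N}"]) auto
  qed (simp add: partition_dist_def)
  show "partition_dist N t x z \<le> partition_dist N t x y + partition_dist N t y z" for x y z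
  proof -
    have gap: "t i \<le> t (Suc i)" if "i \<le> N" for i
      using part that by (auto simp: is_partition_def less_imp_le)
    have "partition_dist N t x z \<le> L2_set (\<lambda>i. \<bar>x i - y i\<bar> * sqrt (t (i + 1) - t i) + \<bar>y i - z i\<bar> * sqrt (t (i + 1) - t i)) {1..N}"
      unfolding partition_dist_L2_set[OF part] distrib_right[symmetric]
      by (intro L2_set_mono mult_right_mono) (auto simp: gap)
    also have "\<dots> \<le> partition_dist N t x y + partition_dist N t y z"
      unfolding partition_dist_L2_set[OF part] by (rule L2_set_triangle_ineq)
    finally show ?thesis .
  qed
qed

lemma continuous_map_coord:
  assumes part: "is_partition N t" and i: "i \<in> {1..N}"
  shows "continuous_map (Metric_space.mtopology (simplex_set N) (partition_dist N t)) euclideanreal (\<lambda>x. x i)"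
proof -
  interpret Metric_space "simplex_set N" "partition_dist N t" by (rule Metric_space_simplex[OF part])
  have "openin mtopology {x \<in> simplex_set N. x i \<in> U}" if "open U" for U
    unfolding openin_mtopology
  proof safe
    fix x assume x: "x \<in> simplex_set N" "x i \<in> U"
    then obtain e where e: "e > 0" "\<And>y. dist y (x i) < e \<Longrightarrow> y \<in> U"
      using \<open>open U\<close> unfolding open_dist by blast
    let ?s = "sqrt (t (i + 1) - t i)"
    have s: "?s > 0" using partition_gap[OF part i] by simp
    have "y i \<in> U" if "y \<in> mball x (e * ?s)" for y
    proof (rule e(2))
      have "\<bar>x i - y i\<bar> * ?s < e * ?s"
        using coord_le_partition_dist[OF part i, of x y] that by simp
      then show "dist (y i) (x i) < e" using s by (simp add: dist_real_def abs_minus_commute)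
    qed
    then show "\<exists>r>0. mball x r \<subseteq> {x \<in> simplex_set N. x i \<in> U}"
      using e(1) s by (intro exI[of _ "e * ?s"]) (auto simp: in_mball)
  qed
  then show ?thesis by (simp add: continuous_map_def)
qed

lemma continuous_map_ramp_prod:
  assumes part: "is_partition N t"
  shows "continuous_map (Metric_space.mtopology (simplex_set N) (partition_dist N t)) euclideanreal
     (\<lambda>x. \<Prod>i\<in>{1..N}. ramp (c i) n (x i))"
proof (intro continuous_map_prod)
  fix i assume "i \<in> {1..N}"
  from continuous_map_compose[OF continuous_map_coord[OF part this], of euclideanreal "ramp (c i) n"]
  show "continuous_map (Metric_space.mtopology (simplex_set N) (partition_dist N t)) euclideanreal (\<lambda>x. ramp (c i) n (x i))"
    by (simp add: o_def continuous_on_ramp)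
qed simp

lemma measurable_simplex_inclusion:
  assumes part: "is_partition N t"
  shows "(\<lambda>x. x) \<in> measurable (metric_borel (simplex_set N) (partition_dist N t)) (\<Pi>\<^sub>M i\<in>{1..N}. borel)"
proof (rule measurable_PiM_single')
  show "(\<lambda>x. x i) \<in> borel_measurable (metric_borel (simplex_set N) (partition_dist N t))" if "i \<in> {1..N}" for i
    by (rule borel_measurable_metric_borel[OF Metric_space_simplex[OF part] continuous_map_coord[OF part that]])
  show "(\<lambda>x. x) \<in> space (metric_borel (simplex_set N) (partition_dist N t)) \<rightarrow> {1..N} \<rightarrow>\<^sub>E space borel"
    unfolding space_metric_borel[OF Metric_space_simplex[OF part]] by (auto simp: simplex_set_def PiE_iff)
qed

lemma dense_simplex:
  assumes part: "is_partition N t" and x: "x \<in> simplex_set N" and e: "e > 0"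
  shows "\<exists>y \<in> simplex_set N \<inter> ({1..N} \<rightarrow>\<^sub>E \<rat>). partition_dist N t y x < e"
proof -
  \<comment> \<open>Each coordinate is lowered by less than \<open>e / 2\<close> but stays above the
    old value of its left neighbour, hence above the lowered one too; strict order is
    preserved.\<close>
  have "\<exists>q\<in>\<rat>. max (bd N x (i - 1)) (x i - e / 2) < q \<and> q < x i" if "i \<in> {1..N}" for i
  proof (rule Rats_dense_in_real)
    obtain j where "i = Suc j" using \<open>i \<in> {1..N}\<close> by (cases i) auto
    then have "bd N x (i - 1) < bd N x i" using x that by (auto simp: simplex_set_def)
    then show "max (bd N x (i - 1)) (x i - e / 2) < x i" using that e by (auto simp: bd_def)
  qed
  then obtain q where q: "\<And>i. i \<in> {1..N} \<Longrightarrow> q i \<in> \<rat> \<and> max (bd N x (i - 1)) (x i - e / 2) < q i \<and> q i < x i"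
    by metis
  define y where "y = restrict q {1..N}"
  have y: "y i \<in> \<rat>" "bd N x (i - 1) < y i" "x i - e / 2 < y i" "y i < x i" if "i \<in> {1..N}" for i
    using q[OF that] that by (auto simp: y_def)
  have "increment N i y > 0" if i: "i \<le> N" for i
  proof -
    have "bd N y i \<le> bd N x i" using i y(4)[of i] by (cases "i = 0") (auto simp: bd_def)
    also have "bd N x i < bd N y (i + 1)"
    proof (cases "i = N")
      case True
      have "bd N x i < bd N x (i + 1)" using x i by (auto simp: simplex_set_def)
      then show ?thesis using True by (simp add: bd_def)
    next
      case False
      then show ?thesis using y(2)[of "i + 1"] i by (simp add: bd_def)
    qed
    finally show ?thesis by (simp add: increment_def)
  qed
  then have ys: "y \<in> simplex_set N" by (intro simplex_setI) (auto simp: y_def)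
  have "partition_dist N t y x \<le> e / 2"
  proof -
    have "(\<Sum>i=1..N. \<bar>y i - x i\<bar>\<^sup>2 * \<bar>t (i + 1) - t i\<bar>) \<le> (\<Sum>i=1..N. (e / 2)\<^sup>2 * (t (i + 1) - t i))"
    proof (rule sum_mono)
      fix i assume i: "i \<in> {1..N}"
      have "\<bar>y i - x i\<bar> \<le> e / 2" using y(3,4)[OF i] by linarith
      then have "\<bar>y i - x i\<bar>\<^sup>2 \<le> (e / 2)\<^sup>2" by (rule power_mono) simp
      then show "\<bar>y i - x i\<bar>\<^sup>2 * \<bar>t (i + 1) - t i\<bar> \<le> (e / 2)\<^sup>2 * (t (i + 1) - t i)"
        using partition_gap[OF part i] by (simp add: mult_right_mono)
    qed
    also have "\<dots> = (e / 2)\<^sup>2 * (t (N + 1) - t 1)"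
      unfolding sum_distrib_left[symmetric]
      using sum_Suc_diff[of 1 N t] part by (simp add: is_partition_def)
    also have "\<dots> \<le> (e / 2)\<^sup>2"
      using partition_bounds[OF part, of 1] part by (intro mult_left_le) (auto simp: is_partition_def)
    finally show ?thesis unfolding partition_dist_def using e by (intro real_le_lsqrt) auto
  qed
  then show ?thesis using e ys y(1) by (intro bexI[of _ y]) (auto simp: y_def)
qed

text \<open>A retraction of R^N onto the simplex, constant off it. It carries the Dirichlet measure
  over to the metric Borel sets of the simplex; the choice of the constant is invisible, because the
  complement of the simplex is null.\<close>

definition simplex_proj :: "nat \<Rightarrow> (nat \<Rightarrow> real) \<Rightarrow> nat \<Rightarrow> real" where
  "simplex_proj N x = (if x \<in> simplex_set N then x else SOME y. y \<in> simplex_set N)"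

lemma partition_in_simplex: "is_partition N t \<Longrightarrow> restrict t {1..N} \<in> simplex_set N"
  by (rule simplex_setI) (auto simp: increment_def bd_def is_partition_def)

lemma simplex_proj_in: "is_partition N t \<Longrightarrow> simplex_proj N x \<in> simplex_set N"
  using someI[of "\<lambda>y. y \<in> simplex_set N", OF partition_in_simplex] by (auto simp: simplex_proj_def)

lemma simplex_proj_id: "x \<in> simplex_set N \<Longrightarrow> simplex_proj N x = x"
  by (simp add: simplex_proj_def)

lemma simplex_set_measurable: "simplex_set N \<in> sets (\<Pi>\<^sub>M i\<in>{1..N}. borel)"
proof -
  have "simplex_set N = {x \<in> space (\<Pi>\<^sub>M i\<in>{1..N}. borel). \<forall>i\<in>{..N}. increment N i x > 0}"
  proof (intro equalityI subsetI)
    fix x assume x: "x \<in> simplex_set N"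
    then have "x \<in> extensional {1..N}" by (simp add: simplex_set_def PiE_def)
    with increment_pos[OF x] show "x \<in> {x \<in> space (\<Pi>\<^sub>M i\<in>{1..N}. borel). \<forall>i\<in>{..N}. increment N i x > 0}"
      by (simp add: space_PiM PiE_def)
  qed (auto simp: space_PiM PiE_def intro!: simplex_setI)
  also have "\<dots> \<in> sets (\<Pi>\<^sub>M i\<in>{1..N}. borel)"
  proof -
    have [measurable]: "increment N i \<in> borel_measurable (\<Pi>\<^sub>M i\<in>{1..N}. borel)" if "i \<in> {..N}" for i
      using that by (intro measurable_increment) auto
    show ?thesis by measurable
  qed
  finally show ?thesis .
qed

lemma measurable_simplex_proj:
  assumes part: "is_partition N t"
  shows "simplex_proj N \<in> measurable (\<Pi>\<^sub>M i\<in>{1..N}. borel) (metric_borel (simplex_set N) (partition_dist N t))"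
proof (rule measurable_metric_borel[OF Metric_space_simplex[OF part], where D = "simplex_set N \<inter> ({1..N} \<rightarrow>\<^sub>E \<rat>)"])
  show "countable (simplex_set N \<inter> ({1..N} \<rightarrow>\<^sub>E \<rat>))"
    by (intro countable_Int2 countable_PiE) (auto simp: countable_rat)
  show "\<exists>y \<in> simplex_set N \<inter> ({1..N} \<rightarrow>\<^sub>E \<rat>). partition_dist N t y x < e" if "x \<in> simplex_set N" "e > 0" for x e
    by (rule dense_simplex[OF part that])
  fix y
  note [measurable] = simplex_set_measurable
  have [measurable]: "(\<lambda>x. simplex_proj N x i) \<in> borel_measurable (\<Pi>\<^sub>M i\<in>{1..N}. borel)" if "i \<in> {1..N}" for i
  proof -
    have "(\<lambda>x. if x \<in> simplex_set N then x i else (SOME y. y \<in> simplex_set N) i) \<in> borel_measurable (\<Pi>\<^sub>M i\<in>{1..N}. borel)"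
      using that by measurable
    moreover have "(\<lambda>x. simplex_proj N x i) = (\<lambda>x. if x \<in> simplex_set N then x i else (SOME y. y \<in> simplex_set N) i)"
      by (auto simp: simplex_proj_def)
    ultimately show ?thesis by simp
  qed
  show "(\<lambda>x. partition_dist N t y (simplex_proj N x)) \<in> borel_measurable (\<Pi>\<^sub>M i\<in>{1..N}. borel)"
    unfolding partition_dist_def by measurable
qed (auto simp: simplex_proj_in[OF part])

definition partition_measure :: "real \<Rightarrow> nat \<Rightarrow> (nat \<Rightarrow> real) \<Rightarrow> (nat \<Rightarrow> real) measure" where
  "partition_measure \<beta> N t = distr (dirichlet_measure \<beta> N t) (metric_borel (simplex_set N) (partition_dist N t)) (simplex_proj N)"

lemma dirichlet_integral_simplex:
  assumes u: "u \<in> borel_measurable (metric_borel (simplex_set N) (partition_dist N t))"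
    and part: "is_partition N t" and \<beta>: "\<beta> > 0"
  shows "(LINT x|partition_measure \<beta> N t. u x) = dirichlet_integral \<beta> N t u"
proof -
  have m: "simplex_proj N \<in> measurable (dirichlet_measure \<beta> N t) (metric_borel (simplex_set N) (partition_dist N t))"
    unfolding measurable_cong_sets[OF sets_dirichlet_measure refl] by (rule measurable_simplex_proj[OF part])
  have "(LINT x|partition_measure \<beta> N t. u x) = (LINT x|dirichlet_measure \<beta> N t. u (simplex_proj N x))"
    unfolding partition_measure_def by (rule integral_distr[OF m u])
  also have "\<dots> = dirichlet_integral \<beta> N t u"
    using part by (intro dirichlet_integral_eq[symmetric, OF _ _ \<beta>] measurable_compose[OF measurable_simplex_proj[OF part] u])
      (auto simp: simplex_proj_id is_partition_def)
  finally show ?thesis .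
qed

lemma is_partition_measure_exists:
  assumes part: "is_partition N t" and \<beta>: "\<beta> > 0"
  shows "is_partition_measure \<beta> N t (partition_measure \<beta> N t)"
  using dirichlet_integral_simplex[OF borel_measurable_metric_borel[OF Metric_space_simplex[OF part]] part \<beta>]
  by (auto simp: is_partition_measure_def borel_measure_on_def Metric_space_simplex[OF part] partition_measure_def)

lemma prob_space_partition_measure:
  assumes "is_partition N t" "\<beta> > 0"
  shows "prob_space (partition_measure \<beta> N t)"
  unfolding partition_measure_def
  by (rule prob_space.prob_space_distr[OF prob_space_dirichlet_measure[OF assms]])
     (subst measurable_cong_sets[OF sets_dirichlet_measure refl], rule measurable_simplex_proj[OF assms(1)])

text \<open>Products of ramps are continuous for the partition metric and identify the image of
  \<open>\<mu>\<close> in R^N as the Dirichlet measure. Since \<open>simplex_proj\<close> inverts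
  the inclusion, \<open>\<mu>\<close> is recovered from this image.\<close>

lemma is_partition_measure_unique:
  assumes part: "is_partition N t" and \<beta>: "\<beta> > 0" and \<mu>: "is_partition_measure \<beta> N t \<mu>"
  shows "\<mu> = partition_measure \<beta> N t"
proof -
  let ?mb = "metric_borel (simplex_set N) (partition_dist N t)"
  let ?P = "\<Pi>\<^sub>M i\<in>{1..N}. borel :: real measure"
  have sets: "sets \<mu> = sets ?mb"
    and int: "\<And>u. continuous_map (Metric_space.mtopology (simplex_set N) (partition_dist N t)) euclideanreal u \<Longrightarrow>
      bounded (u ` simplex_set N) \<Longrightarrow> (LINT x|\<mu>. u x) = dirichlet_integral \<beta> N t u"
    using \<mu> by (auto simp: is_partition_measure_def borel_measure_on_def)
  interpret D: prob_space "dirichlet_measure \<beta> N t" by (rule prob_space_dirichlet_measure[OF part \<beta>])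
  have dir: "\<And>i. i \<le> N \<Longrightarrow> t i < t (i + 1)" using part by (simp add: is_partition_def)
  have incl: "(\<lambda>x. x) \<in> measurable \<mu> ?P"
    unfolding measurable_cong_sets[OF sets refl] by (rule measurable_simplex_inclusion[OF part])
  \<comment> \<open>The test function 1 yields finiteness: the real-valued \<open>measure\<close> of
    a set of infinite mass is 0, so the value 1 excludes infinite mass.\<close>
  have "(LINT x|\<mu>. 1) = dirichlet_integral \<beta> N t (\<lambda>_. 1)"
    by (rule int) (auto intro: boundedI[where B = 1])
  also have "\<dots> = (LINT x|dirichlet_measure \<beta> N t. 1)"
    using dir by (intro dirichlet_integral_eq[OF _ _ \<beta>]) auto
  finally have "measure \<mu> (space \<mu>) = 1" by (simp add: D.prob_space)
  then have fin: "finite_measure \<mu>"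
    by (intro finite_measureI) (auto simp: measure_def)
  then interpret finite_measure \<mu> .
  have "distr \<mu> ?P (\<lambda>x. x) = dirichlet_measure \<beta> N t"
  proof (rule measure_eqI_PiM_ramp[where I = "{1..N}"])
    show "finite_measure (distr \<mu> ?P (\<lambda>x. x))" by (rule finite_measure_distr[OF incl])
    show "finite_measure (dirichlet_measure \<beta> N t)" by (rule D.finite_measure_axioms)
    fix c n
    let ?u = "\<lambda>x. \<Prod>i\<in>{1..N}. ramp (c i) n (x i)"
    have u: "?u \<in> borel_measurable ?P" by measurable
    have "(LINT x|distr \<mu> ?P (\<lambda>x. x). ?u x) = (LINT x|\<mu>. ?u x)"
      by (rule integral_distr[OF incl u])
    also have "\<dots> = dirichlet_integral \<beta> N t ?u"
      by (intro int continuous_map_ramp_prod[OF part] boundedI[where B = 1]) (auto simp: ramp_prod_bounds)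
    also have "\<dots> = (LINT x|dirichlet_measure \<beta> N t. ?u x)"
      using dir by (intro dirichlet_integral_eq[OF u _ \<beta>]) auto
    finally show "(LINT x|distr \<mu> ?P (\<lambda>x. x). ?u x) = (LINT x|dirichlet_measure \<beta> N t. ?u x)" .
  qed (auto simp: sets_dirichlet_measure)
  then have "partition_measure \<beta> N t = distr (distr \<mu> ?P (\<lambda>x. x)) ?mb (simplex_proj N)"
    by (simp add: partition_measure_def)
  also have "\<dots> = distr \<mu> ?mb (simplex_proj N \<circ> (\<lambda>x. x))"
    by (rule distr_distr[OF measurable_simplex_proj[OF part] incl])
  also have "\<dots> = distr \<mu> ?mb (\<lambda>x. x)"
  proof (intro distr_cong refl)
    fix x assume "x \<in> space \<mu>"
    then have "x \<in> simplex_set N"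
      using sets_eq_imp_space_eq[OF sets] by (simp add: space_metric_borel[OF Metric_space_simplex[OF part]])
    then show "(simplex_proj N \<circ> (\<lambda>x. x)) x = x" by (simp add: simplex_proj_id)
  qed
  also have "\<dots> = \<mu>" by (rule distr_id2) (simp add: sets)
  finally show ?thesis by simp
qed

section \<open>Measured Gromov--Hausdorff convergence\<close>

lemma continuous_map_metric_limit:
  assumes X: "Metric_space X d" and \<phi>: "continuous_map (Metric_space.mtopology X d) euclideanreal \<phi>"
    and f: "\<And>n. f n \<in> X" "x \<in> X" "(\<lambda>n. d (f n) x) \<longlonglongrightarrow> 0"
  shows "(\<lambda>n. \<phi> (f n)) \<longlonglongrightarrow> \<phi> x"
proof -
  interpret Metric_space X d by (rule X)
  have "limitin mtopology f x sequentially"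
    unfolding limitin_metric
    using f order_tendstoD(2)[OF f(3)] by auto
  from continuous_map_limit[OF \<phi> this] show ?thesis by (simp add: o_def)
qed

text \<open>Helly's theorem gives convergence at the continuity points of a nondecreasing limit. All
  other points form a countable, hence null set, and dominated convergence turns this into
  convergence of the distances.\<close>

lemma G0_convergent_subsequence:
  assumes g: "\<And>n. g n \<in> G0"
  shows "\<exists>s h. strict_mono (s :: nat \<Rightarrow> nat) \<and> h \<in> G0 \<and> (\<lambda>n. L2_dist (g (s n)) h) \<longlonglongrightarrow> 0"
proof -
  obtain s F where s: "strict_mono (s :: nat \<Rightarrow> nat)"
    and F: "\<And>x. continuous (at_right x) F" "mono F" "\<And>x. \<bar>F x\<bar> \<le> 1"
    and lim: "\<And>x. continuous (at x) F \<Longrightarrow> (\<lambda>n. ext (g (s n)) x) \<longlonglongrightarrow> F x"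
  proof -
    have "\<bar>ext (g n) x\<bar> \<le> 1" for n x using ext_bounds[OF g] by (simp add: abs_le_iff order_trans[of _ 0])
    from Helly_selection[of "\<lambda>n. ext (g n)", OF continuous_ext[OF g] mono_ext[OF g] this]
    show ?thesis using that by blast
  qed
  have discont: "countable {x. \<not> isCont F x}" by (rule mono_ctble_discont[OF F(2)])
  \<comment> \<open>Helly's theorem only bounds the absolute value. The sign comes from a continuity
    point to the left of 0, where all extended functions vanish; one exists because the
    discontinuities are countable.\<close>
  have F0: "F x \<ge> 0" if "x \<ge> 0" for x
  proof -
    have "\<not> {-1<..<0::real} \<subseteq> {x. \<not> isCont F x}"
      using countable_subset[OF _ discont] uncountable_open_interval[of "-1" "0::real"] by auto
    then obtain z where z: "z < 0" "isCont F z" by auto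
    have "F z = 0"
      using LIMSEQ_unique[OF lim[OF z(2)]] z(1) by (simp add: ext_def)
    with monoD[OF F(2), of z x] z that show ?thesis by simp
  qed
  \<comment> \<open>\<open>h\<close> is given the value 1 at 1 that membership in \<open>G0\<close>
    demands; monotonicity survives because \<open>F\<close> is at most 1, and the distance does not
    see a single point.\<close>
  define h where "h = (\<lambda>t\<in>{0..1}. if t < 1 then F t else 1)"
  have F1: "F x \<le> 1" for x using F(3)[of x] by simp
  have "h \<in> G0"
  proof -
    have "continuous (at_right t) h" if t: "t \<in> {0..<1}" for t
    proof -
      have "eventually (\<lambda>s. F s = h s) (at_right t)"
        unfolding eventually_at_right_field using t by (intro exI[of _ 1]) (auto simp: h_def)
      from tendsto_cong[OF this] F(1)[of t]
      have "(h \<longlongrightarrow> F t) (at_right t)" unfolding continuous_within by blast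
      then show ?thesis using t by (simp add: continuous_within h_def)
    qed
    moreover have "mono_on {0..1} h"
      using monoD[OF F(2)] F1 by (intro mono_onI) (auto simp: h_def)
    moreover have "h \<in> {0..1} \<rightarrow>\<^sub>E {0..1}"
      using F0 F1 by (auto simp: h_def)
    ultimately show ?thesis by (auto simp: G0_def h_def)
  qed
  have "(\<lambda>n. sq_dist (g (s n)) h) \<longlonglongrightarrow> (LINT t|lborel. indicator {0..1::real} t *\<^sub>R 0)"
    unfolding sq_dist_def set_lebesgue_integral_def
  proof (rule integral_dominated_convergence[where w = "indicator {0..1}"])
    note [measurable] = measurable_ext[OF g] measurable_ext[OF \<open>h \<in> G0\<close>]
    show "(\<lambda>t. indicat_real {0..1} t *\<^sub>R (ext (g (s n)) t - ext h t)\<^sup>2) \<in> borel_measurable lborel" for n by measurable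
    show "AE t in lborel. norm (indicat_real {0..1} t *\<^sub>R (ext (g (s n)) t - ext h t)\<^sup>2) \<le> indicator {0..1} t" for n
      using ext_diff_bound[OF g \<open>h \<in> G0\<close>] by (intro AE_I2) (auto simp: indicator_def abs_square_le_1)
    have "AE t in lborel. isCont F t"
      using AE_not_in[OF countable_imp_null_set_lborel[OF discont]] by simp
    then show "AE t in lborel. (\<lambda>n. indicat_real {0..1} t *\<^sub>R (ext (g (s n)) t - ext h t)\<^sup>2) \<longlonglongrightarrow> indicat_real {0..1} t *\<^sub>R 0"
    proof eventually_elim
      case (elim t)
      show ?case
      proof (cases "t \<in> {0..<1}")
        case True
        then have "ext h t = F t" by (simp add: ext_def h_def)
        then have "(\<lambda>n. indicat_real {0..1} t *\<^sub>R (ext (g (s n)) t - ext h t)\<^sup>2) \<longlonglongrightarrow> indicat_real {0..1} t *\<^sub>R (F t - F t)\<^sup>2"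
          using lim[OF elim] by (intro tendsto_intros) auto
        then show ?thesis by simp
      next
        case False
        then show ?thesis by (cases "t = 1") (auto simp: ext_def)
      qed
    qed
  qed auto
  then have "(\<lambda>n. sqrt (sq_dist (g (s n)) h)) \<longlonglongrightarrow> sqrt 0"
    by (intro tendsto_real_sqrt) simp
  then have "(\<lambda>n. L2_dist (g (s n)) h) \<longlonglongrightarrow> 0"
    using g \<open>h \<in> G0\<close> by (simp add: L2_dist_sq_dist)
  with s \<open>h \<in> G0\<close> show ?thesis by blast
qed

lemma continuous_map_G0_bounded:
  assumes \<phi>: "continuous_map (Metric_space.mtopology G0 L2_dist) euclideanreal \<phi>"
  shows "\<exists>C. \<forall>g\<in>G0. \<bar>\<phi> g\<bar> \<le> C"
proof (rule ccontr)
  assume "\<not> ?thesis"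
  then have "\<forall>n. \<exists>g\<in>G0. real n < \<bar>\<phi> g\<bar>" by (meson not_le)
  then obtain g where g: "\<And>n. g n \<in> G0" "\<And>n. real n < \<bar>\<phi> (g n)\<bar>" by metis
  obtain s h where s: "strict_mono (s :: nat \<Rightarrow> nat)" and h: "h \<in> G0" "(\<lambda>n. L2_dist (g (s n)) h) \<longlonglongrightarrow> 0"
    using G0_convergent_subsequence[of g, OF g(1)] by (elim exE conjE)
  have "(\<lambda>n. \<phi> (g (s n))) \<longlonglongrightarrow> \<phi> h"
    by (rule continuous_map_metric_limit[where X = G0 and d = L2_dist and f = "\<lambda>n. g (s n)" and x = h, OF Metric_space_G0 \<phi> _ h]) (rule g(1))
  then have "convergent (\<lambda>n. \<phi> (g (s n)))" by (rule convergentI)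
  then have "Bseq (\<lambda>n. \<phi> (g (s n)))" by (rule convergent_imp_Bseq)
  then obtain K where K: "\<And>n. \<bar>\<phi> (g (s n))\<bar> \<le> K" by (auto simp: Bseq_def)
  obtain n where n: "K \<le> real n" using real_arch_simple by blast
  have "real n \<le> real (s n)" using seq_suble[OF s, of n] by simp
  also have "\<dots> < \<bar>\<phi> (g (s n))\<bar>" by (rule g(2))
  finally show False using K[of n] n by simp
qed

lemma dyadic_step_eps_isometry:
  assumes N: "N \<ge> 1"
  shows "eps_isometry (sqrt (2 / 2 ^ N)) (simplex_set (std_size N)) (partition_dist (std_size N) (std_partition N)) G0 L2_dist (dyadic_step N)"
  unfolding eps_isometry_def
proof (intro conjI ballI)
  show "dyadic_step N \<in> simplex_set (std_size N) \<rightarrow> G0"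
    by (auto intro: dyadic_step_in_G0 nondecreasing_point_simplex)
  show "\<bar>partition_dist (std_size N) (std_partition N) x y - L2_dist (dyadic_step N x) (dyadic_step N y)\<bar> \<le> sqrt (2 / 2 ^ N)"
    if "x \<in> simplex_set (std_size N)" "y \<in> simplex_set (std_size N)" for x y
    using that by (simp add: L2_dist_dyadic_step nondecreasing_point_simplex)
  fix g assume g: "g \<in> G0"
  let ?n = "std_size N"
  note part = is_partition_std[OF N]
  define \<delta> :: real where "\<delta> = 1 / 2 ^ N"
  have \<delta>: "0 < \<delta>" "\<delta> \<le> 1" by (auto simp: \<delta>_def)
  \<comment> \<open>The sample of \<open>g\<close> may have ties, so it is mixed with the strictly
    increasing partition itself. The weight \<open>\<delta> = 1 / 2 ^ N\<close> moves each value by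
    at most \<open>\<delta>\<close>, which together with the discretisation error gives
    \<open>2 / 2 ^ N\<close>.\<close>
  define x where "x = (\<lambda>i\<in>{1..?n}. (1 - \<delta>) * g (std_partition N i) + \<delta> * std_partition N i)"
  have bd: "bd ?n x i = (1 - \<delta>) * bd ?n (dyadic_sample N g) i + \<delta> * std_partition N i" if "i \<le> ?n + 1" for i
    using that part by (auto simp: bd_def x_def dyadic_sample_def is_partition_def)
  have x: "x \<in> simplex_set ?n"
  proof (rule simplex_setI)
    fix i assume i: "i \<le> ?n"
    have "0 \<le> (1 - \<delta>) * (bd ?n (dyadic_sample N g) (i + 1) - bd ?n (dyadic_sample N g) i)"
      using nondecreasing_dyadic_sample[OF g, of N] \<delta> i by (auto simp: nondecreasing_point_def)
    moreover have "0 < \<delta> * (std_partition N (i + 1) - std_partition N i)"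
      using \<delta> partition_strict_mono[OF part, of i "i + 1"] i by simp
    ultimately show "increment ?n i x > 0"
      using i by (simp add: increment_def bd algebra_simps)
  qed (simp add: x_def)
  have "\<bar>x i - g (std_partition N i)\<bar> \<le> \<delta>" if i: "i \<in> {1..?n}" for i
  proof -
    have s: "std_partition N i \<in> {0..1}" using std_partition_inner[OF i] by simp
    have "x i - g (std_partition N i) = \<delta> * (std_partition N i - g (std_partition N i))"
      using i by (simp add: x_def algebra_simps)
    moreover have "\<bar>std_partition N i - g (std_partition N i)\<bar> \<le> 1"
      using s G0_bounds[OF g s] by auto
    ultimately show ?thesis
      using \<delta> mult_left_le[of "\<bar>std_partition N i - g (std_partition N i)\<bar>" \<delta>] by (simp add: abs_mult)
  qed
  then have "sq_dist g (dyadic_step N x) \<le> \<delta> + 1 / 2 ^ N"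
    using \<delta> by (intro sq_dist_dyadic_approx g nondecreasing_point_simplex x) auto
  then have "sq_dist g (dyadic_step N x) \<le> 2 / 2 ^ N" by (simp add: \<delta>_def)
  then have "L2_dist g (dyadic_step N x) \<le> sqrt (2 / 2 ^ N)"
    using g dyadic_step_in_G0[OF nondecreasing_point_simplex[OF x]] by (simp add: L2_dist_sq_dist)
  with x show "\<exists>x\<in>simplex_set ?n. L2_dist g (dyadic_step N x) \<le> sqrt (2 / 2 ^ N)" by blast
qed

lemma measurable_dyadic_step:
  assumes N: "N \<ge> 1"
  shows "dyadic_step N \<in> measurable (metric_borel (simplex_set (std_size N)) (partition_dist (std_size N) (std_partition N))) (metric_borel G0 L2_dist)"
proof (rule measurable_into_G0)
  note part = is_partition_std[OF N]
  let ?M = "metric_borel (simplex_set (std_size N)) (partition_dist (std_size N) (std_partition N))"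
  show "dyadic_step N \<in> space ?M \<rightarrow> G0"
    unfolding space_metric_borel[OF Metric_space_simplex[OF part]]
    by (auto intro: dyadic_step_in_G0 nondecreasing_point_simplex)
  have coord: "(\<lambda>x. x i) \<in> borel_measurable ?M" if "i \<in> {1..std_size N}" for i
    by (rule borel_measurable_metric_borel[OF Metric_space_simplex[OF part] continuous_map_coord[OF part that]])
  fix K j assume "j \<in> {1..std_size K}"
  then have q: "std_partition K j \<in> {0..1}" using std_partition_inner[of j K] by simp
  let ?i = "nat \<lfloor>2 ^ N * std_partition K j\<rfloor>"
  have "(\<lambda>x. bd (std_size N) x i) \<in> borel_measurable ?M" if "i \<le> std_size N + 1" for i
    unfolding bd_def using that by (intro measurable_If_const coord) auto
  moreover have "?i \<le> std_size N + 1" using dyadic_index_le[OF q, of N] Suc_std_size[of N] by simp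
  ultimately have "(\<lambda>x. bd (std_size N) x ?i) \<in> borel_measurable ?M" by blast
  then show "(\<lambda>x. dyadic_step N x (std_partition K j)) \<in> borel_measurable ?M"
    using q by (simp add: dyadic_step_def)
qed

text \<open>All approximating integrals are moved to the single probability space of
  \<open>Q\<close>, where weak convergence can be replaced by almost sure convergence. The
  projection occurs because the sample lies in the simplex only almost surely.\<close>

lemma integral_dyadic_step:
  fixes \<phi> :: "(real \<Rightarrow> real) \<Rightarrow> real"
  assumes N: "N \<ge> 1" and \<beta>: "\<beta> > 0" and Q: "is_entropic_measure \<beta> Q"
    and \<phi>: "\<phi> \<in> borel_measurable (metric_borel G0 L2_dist)"
  defines "mb \<equiv> metric_borel (simplex_set (std_size N)) (partition_dist (std_size N) (std_partition N))"
  shows "(LINT x|partition_measure \<beta> (std_size N) (std_partition N). \<phi> (dyadic_step N x)) =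
      (LINT g|Q. \<phi> (dyadic_step N (simplex_proj (std_size N) (dyadic_sample N g))))"
    and "(\<lambda>g. \<phi> (dyadic_step N (simplex_proj (std_size N) (dyadic_sample N g)))) \<in> borel_measurable Q"
    and "AE g in Q. dyadic_sample N g \<in> simplex_set (std_size N)"
proof -
  let ?P = "\<Pi>\<^sub>M i\<in>{1..std_size N}. borel :: real measure"
  let ?D = "dirichlet_measure \<beta> (std_size N) (std_partition N)"
  note part = is_partition_std[OF N]
  have sets_Q: "sets Q = sets (metric_borel G0 L2_dist)"
    using Q by (auto simp: is_entropic_measure_def borel_prob_on_def borel_measure_on_def)
  have sample: "dyadic_sample N \<in> measurable Q ?P"
    unfolding measurable_cong_sets[OF sets_Q refl] dyadic_sample_def[abs_def]
    by (rule measurable_sample_at[OF part])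
  have law: "distr Q ?P (dyadic_sample N) = ?D"
    using entropic_measure_law[OF Q part \<beta>] by (simp add: dyadic_sample_def[abs_def])
  have u: "(\<lambda>x. \<phi> (dyadic_step N x)) \<in> borel_measurable mb"
    unfolding mb_def by (rule measurable_compose[OF measurable_dyadic_step[OF N] \<phi>])
  have proj: "simplex_proj (std_size N) \<in> measurable ?P mb"
    unfolding mb_def by (rule measurable_simplex_proj[OF part])
  then have proj': "simplex_proj (std_size N) \<in> measurable ?D mb"
    by (subst measurable_cong_sets[OF sets_dirichlet_measure refl])
  have up: "(\<lambda>x. \<phi> (dyadic_step N (simplex_proj (std_size N) x))) \<in> borel_measurable ?P"
    by (rule measurable_compose[OF proj u])
  have "(LINT x|partition_measure \<beta> (std_size N) (std_partition N). \<phi> (dyadic_step N x)) =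
      (LINT x|?D. \<phi> (dyadic_step N (simplex_proj (std_size N) x)))"
    unfolding partition_measure_def mb_def[symmetric] by (rule integral_distr[OF proj' u])
  also have "\<dots> = (LINT g|Q. \<phi> (dyadic_step N (simplex_proj (std_size N) (dyadic_sample N g))))"
    unfolding law[symmetric] by (rule integral_distr[OF sample up])
  finally show "(LINT x|partition_measure \<beta> (std_size N) (std_partition N). \<phi> (dyadic_step N x)) =
      (LINT g|Q. \<phi> (dyadic_step N (simplex_proj (std_size N) (dyadic_sample N g))))" .
  show "(\<lambda>g. \<phi> (dyadic_step N (simplex_proj (std_size N) (dyadic_sample N g)))) \<in> borel_measurable Q"
    by (rule measurable_compose[OF sample up])
  have "AE x in distr Q ?P (dyadic_sample N). x \<in> simplex_set (std_size N)"
    unfolding law by (rule AE_dirichlet_measure)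
  then show "AE g in Q. dyadic_sample N g \<in> simplex_set (std_size N)"
    by (rule AE_distrD[OF sample])
qed

lemma integral_partition_measure_tendsto:
  assumes \<beta>: "\<beta> > 0" and Q: "is_entropic_measure \<beta> Q"
    and \<phi>: "continuous_map (Metric_space.mtopology G0 L2_dist) euclideanreal \<phi>"
  shows "(\<lambda>n. LINT x|partition_measure \<beta> (std_size (Suc n)) (std_partition (Suc n)). \<phi> (dyadic_step (Suc n) x))
     \<longlonglongrightarrow> (LINT g|Q. \<phi> g)"
proof -
  have sets_Q: "sets Q = sets (metric_borel G0 L2_dist)" and "prob_space Q"
    using Q by (auto simp: is_entropic_measure_def borel_prob_on_def borel_measure_on_def)
  interpret prob_space Q by fact
  have sp: "space Q = G0" using sets_eq_imp_space_eq[OF sets_Q] by (simp add: space_metric_borel[OF Metric_space_G0])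
  have \<phi>m: "\<phi> \<in> borel_measurable (metric_borel G0 L2_dist)"
    by (rule borel_measurable_metric_borel[OF Metric_space_G0 \<phi>])
  obtain C where C: "\<And>g. g \<in> G0 \<Longrightarrow> \<bar>\<phi> g\<bar> \<le> C" using continuous_map_G0_bounded[OF \<phi>] by blast
  let ?p = "\<lambda>n g. dyadic_step (Suc n) (simplex_proj (std_size (Suc n)) (dyadic_sample (Suc n) g))"
  have "(\<lambda>n. LINT g|Q. \<phi> (?p n g)) \<longlonglongrightarrow> (LINT g|Q. \<phi> g)"
  proof (rule integral_dominated_convergence[where w = "\<lambda>_. C"])
    show "\<phi> \<in> borel_measurable Q" unfolding measurable_cong_sets[OF sets_Q refl] by (rule \<phi>m)
    show "(\<lambda>g. \<phi> (?p n g)) \<in> borel_measurable Q" for n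
      by (rule integral_dyadic_step(2)[OF _ \<beta> Q \<phi>m]) simp
    show "AE g in Q. norm (\<phi> (?p n g)) \<le> C" for n
    proof (rule AE_I2)
      fix g
      have "?p n g \<in> G0"
        by (intro dyadic_step_in_G0 nondecreasing_point_simplex simplex_proj_in[OF is_partition_std]) simp
      then show "norm (\<phi> (?p n g)) \<le> C" using C by simp
    qed
    \<comment> \<open>Countably many null sets are discarded at once; for the remaining
      \<open>g\<close> the projection is the identity at every level, and the step functions are
      discretisations of \<open>g\<close> itself.\<close>
    have "AE g in Q. \<forall>n. dyadic_sample (Suc n) g \<in> simplex_set (std_size (Suc n))"
      unfolding AE_all_countable using integral_dyadic_step(3)[OF _ \<beta> Q \<phi>m] by simp
    then show "AE g in Q. (\<lambda>n. \<phi> (?p n g)) \<longlonglongrightarrow> \<phi> g"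
      using AE_space
    proof eventually_elim
      case (elim g)
      then have g: "g \<in> G0" by (simp add: sp)
      have "(\<lambda>n. \<phi> (dyadic_step (Suc n) (dyadic_sample (Suc n) g))) \<longlonglongrightarrow> \<phi> g"
      proof (rule continuous_map_metric_limit[where X = G0 and d = L2_dist and x = g, OF Metric_space_G0 \<phi> dyadic_sample_step_G0[OF g] g])
        interpret Metric_space G0 L2_dist by (rule Metric_space_G0)
        show "(\<lambda>n. L2_dist (dyadic_step (Suc n) (dyadic_sample (Suc n) g)) g) \<longlonglongrightarrow> 0"
        proof (rule tendsto_sandwich[OF _ _ tendsto_const LIMSEQ_Suc[OF sqrt_half_power_tendsto]])
          show "\<forall>\<^sub>F n in sequentially. L2_dist (dyadic_step (Suc n) (dyadic_sample (Suc n) g)) g \<le> sqrt (1 / 2 ^ Suc n)"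
            by (subst commute) (intro always_eventually allI L2_dist_dyadic_sample g)
        qed simp
      qed
      then show ?case using elim by (simp add: simplex_proj_id)
    qed
  qed simp
  then show ?thesis
    by (subst integral_dyadic_step(1)[OF _ \<beta> Q \<phi>m]) simp_all
qed

text \<open>The sequence starts with \<open>Suc n\<close> because the standard partition of level 0
  has no interior point and is not a partition in the sense of \<open>is_partition\<close>;
  accordingly \<open>\<mu> 0\<close> is unconstrained. Uniqueness replaces the given measures by the
  constructed ones.\<close>

theorem proposition8p3:
  fixes \<beta> :: real
  assumes "\<beta> > 0"
  shows "(\<exists>!Q. is_entropic_measure \<beta> Q) \<and>
    (\<forall>N t. is_partition N t \<longrightarrow> (\<exists>!\<mu>. is_partition_measure \<beta> N t \<mu>)) \<and>
    (\<forall>Q \<mu>. is_entropic_measure \<beta> Q \<and>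
       (\<forall>N\<ge>1. is_partition_measure \<beta> (std_size N) (std_partition N) (\<mu> N)) \<longrightarrow>
       mGH_converges (\<lambda>n. simplex_set (std_size (Suc n)))
         (\<lambda>n. partition_dist (std_size (Suc n)) (std_partition (Suc n)))
         (\<lambda>n. \<mu> (Suc n))
         G0 L2_dist Q)"
proof (intro conjI allI impI)
  show "\<exists>!Q. is_entropic_measure \<beta> Q"
    using is_entropic_measure_exists[OF assms] is_entropic_measure_unique[OF assms] by blast
  show "\<exists>!\<mu>. is_partition_measure \<beta> N t \<mu>" if "is_partition N t" for N t
    using is_partition_measure_exists[OF that assms] is_partition_measure_unique[OF that assms] by blast
  fix Q and \<mu> :: "nat \<Rightarrow> (nat \<Rightarrow> real) measure"
  assume *: "is_entropic_measure \<beta> Q \<and> (\<forall>N\<ge>1. is_partition_measure \<beta> (std_size N) (std_partition N) (\<mu> N))"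
  then have Q: "is_entropic_measure \<beta> Q" by simp
  have part: "is_partition (std_size (Suc n)) (std_partition (Suc n))" for n by (rule is_partition_std) simp
  have \<mu>: "\<mu> (Suc n) = partition_measure \<beta> (std_size (Suc n)) (std_partition (Suc n))" for n
    using * by (intro is_partition_measure_unique[OF part assms]) simp
  have sets_\<mu>: "sets (\<mu> (Suc n)) = sets (metric_borel (simplex_set (std_size (Suc n))) (partition_dist (std_size (Suc n)) (std_partition (Suc n))))" for n
    by (simp add: \<mu> partition_measure_def)
  show "mGH_converges (\<lambda>n. simplex_set (std_size (Suc n)))
         (\<lambda>n. partition_dist (std_size (Suc n)) (std_partition (Suc n))) (\<lambda>n. \<mu> (Suc n)) G0 L2_dist Q"
    unfolding mGH_converges_def
  proof (intro conjI allI exI[of _ "\<lambda>n. sqrt (2 / 2 ^ Suc n)"] exI[of _ "\<lambda>n. dyadic_step (Suc n)"] impI)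
    show "borel_prob_on (simplex_set (std_size (Suc n))) (partition_dist (std_size (Suc n)) (std_partition (Suc n))) (\<mu> (Suc n))" for n
      using prob_space_partition_measure[OF part assms] sets_\<mu>
      by (simp add: borel_prob_on_def borel_measure_on_def Metric_space_simplex[OF part] \<mu>)
    show "borel_prob_on G0 L2_dist Q" using Q by (simp add: is_entropic_measure_def)
    show "(\<lambda>n. sqrt (2 / 2 ^ Suc n)) \<longlonglongrightarrow> 0" by (rule LIMSEQ_Suc[OF sqrt_half_power_tendsto])
    show "eps_isometry (sqrt (2 / 2 ^ Suc n)) (simplex_set (std_size (Suc n)))
        (partition_dist (std_size (Suc n)) (std_partition (Suc n))) G0 L2_dist (dyadic_step (Suc n))" for n
      by (rule dyadic_step_eps_isometry) simp
    show meas: "dyadic_step (Suc n) \<in> measurable (metric_borel (simplex_set (std_size (Suc n))) (partition_dist (std_size (Suc n)) (std_partition (Suc n))))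
       (metric_borel G0 L2_dist)" for n
      by (rule measurable_dyadic_step) simp
    fix \<phi> assume \<phi>: "continuous_map (Metric_space.mtopology G0 L2_dist) euclideanreal \<phi>"
    have "(LINT g|distr (\<mu> (Suc n)) (metric_borel G0 L2_dist) (dyadic_step (Suc n)). \<phi> g) =
        (LINT x|partition_measure \<beta> (std_size (Suc n)) (std_partition (Suc n)). \<phi> (dyadic_step (Suc n) x))" for n
      unfolding \<mu>[symmetric]
      by (rule integral_distr) (use meas borel_measurable_metric_borel[OF Metric_space_G0 \<phi>] in
        \<open>simp_all add: measurable_cong_sets[OF sets_\<mu> refl]\<close>)
    then show "(\<lambda>n. integral\<^sup>L (distr (\<mu> (Suc n)) (metric_borel G0 L2_dist) (dyadic_step (Suc n))) \<phi>) \<longlonglongrightarrow> integral\<^sup>L Q \<phi>"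
      using integral_partition_measure_tendsto[OF assms Q \<phi>] by simp
  qed simp
qed

end
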